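(* (Geronimus–Uvarov perturbations of the zero order Toeplitz case.) Assume that the perturbing Laurent polynomials $L_{\mathfrak C},L_\Gamma$ are prepared: $L_\rho(z)=L_{\rho,N_\rho}z^{N_\rho}+\dots+L_{\rho,-N_\rho}z^{-N_\rho}$, $L_{\rho,N_\rho}L_{\rho,-N_\rho}\ne0$, $N_\rho\in\{1,2,\dots\}$, $\rho=\mathfrak C,\Gamma$. For $k\ge0$ put $$A^{(2,1)}_k:=\Big[\mathcal J^{\overline{L_{\Gamma,*}}}_{C_{1,k}}-\mathcal J^{L_\Gamma}_{\phi_{1,k}/L_{\mathfrak C}}\,\Xi\,\mathcal L_*,\ \mathcal J^{L_{\mathfrak C}}_{\phi_{1,k}}\Big],\qquad A^{(1,2)}_k:=\Big[\mathcal J^{\overline{L_\Gamma}}_{C_{2,k}}-\mathcal J^{L_{\Gamma,*}}_{\phi_{2,k}/L_{\mathfrak C,*}}\,\Xi^\dagger\,\mathcal L,\ \mathcal J^{L_{\mathfrak C,*}}_{\phi_{2,k}}\Big]$$ (row vectors of length $2N_\Gamma+2N_{\mathfrak C}$), and let $\tilde\tau^{(2,1)}_l$ (resp. $\tilde\tau^{(1,2)}_l$) be the determinant of the square matrix with rows $A^{(2,1)}_k$ (resp. $A^{(1,2)}_k$), $k=l-2N_\Gamma,\dots,l+2N_{\mathfrak C}-1$. Then, for $l\ge2\max(N_\Gamma,N_{\mathfrak C})$ and $\tilde\tau^{(2,1)}_l\tilde\tau^{(1,2)}_l\ne0$, the following determinantal formulas hold: $$\tilde\phi_{1,l}(z)=\frac{L_{\mathfrak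 C,(-1)^lN_{\mathfrak C}}}{L_{\mathfrak C}(z)}\frac1{\tilde\tau^{(2,1)}_l}\begin{vmatrix}A^{(2,1)}_{l-2N_\Gamma}&\phi_{1,l-2N_\Gamma}(z)\\ \vdots&\vdots\\ A^{(2,1)}_{l+2N_{\mathfrak C}}&\phi_{1,l+2N_{\mathfrak C}}(z)\end{vmatrix}=-\frac{L_\Gamma(z)}{L_{\Gamma,(-1)^lN_\Gamma}}\frac{H_{l-2N_\Gamma}}{\tilde\tau^{(1,2)}_l}\begin{vmatrix}\overline{A^{(1,2)}_{l-2N_\Gamma+1}}\\ \vdots\\ \overline{A^{(1,2)}_{l+2N_{\mathfrak C}-1}}\\ B^{(1,2)}_l(z)\end{vmatrix},$$ $$\tilde H_l=\frac{L_{\mathfrak C,(-1)^lN_{\mathfrak C}}}{\overline{L_{\Gamma,(-1)^{l+1}N_\Gamma}}}H_{l-2N_\Gamma}\frac{\tilde\tau^{(2,1)}_{l+1}}{\tilde\tau^{(2,1)}_l}=\frac{\overline{L_{\mathfrak C,(-1)^{l}N_{\mathfrak C}}}}{L_{\Gamma,(-1)^{l+1}N_\Gamma}}H_{l-2N_\Gamma}\frac{\overline{\tilde\tau^{(1,2)}_{l+1}}}{\overline{\tilde\tau^{(1,2)}_l}},$$ $$\overline{\tilde\phi_{2,l}(z)}=-\frac{\overline{L_{\Gamma,*}(z)}}{\overline{L_{\Gamma,(-1)^{l+1}N_\Gamma}}}\frac{H_{l-2N_\Gamma}}{\tilde\tau^{(2,1)}_l}\begin{vmatrix}A^{(2,1)}_{l-2N_\Gamma+1}\\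 \vdots\\ A^{(2,1)}_{l+2N_{\mathfrak C}-1}\\ B^{(2,1)}_l(z)\end{vmatrix}=\frac{\overline{L_{\mathfrak C,(-1)^{l+1}N_{\mathfrak C}}}}{\overline{L_{\mathfrak C,*}(z)}}\frac1{\overline{\tilde\tau^{(1,2)}_l}}\overline{\begin{vmatrix}A^{(1,2)}_{l-2N_\Gamma}&\phi_{2,l-2N_\Gamma}(z)\\ \vdots&\vdots\\ A^{(1,2)}_{l+2N_{\mathfrak C}}&\phi_{2,l+2N_{\mathfrak C}}(z)\end{vmatrix}},$$ where, with $r:=l-2N_\Gamma+1$, $$B^{(1,2)}_l(z):=\Big[\mathcal J^{\overline{L_\Gamma}}_{K^{[r]}_{C_2}}(z)-\mathcal J^{\overline{L_{\Gamma,*}}}_{K^{[r]}/\overline{L_{\mathfrak C,*}}}(z)\,\Xi^\top\,\overline{\mathcal L}+\tfrac1{L_\Gamma(z)}\mathcal J^{\overline{L_\Gamma}}_{\delta L_\Gamma}(z),\ \mathcal J^{\overline{L_{\mathfrak C,*}}}_{K^{[r]}}(z)\Big],$$ with spectral jets taken with respect to the first variable and the second variable equal to $z$, and $$B^{(2,1)}_l(z):=\Big[\mathcal J^{\overline{L_{\Gamma,*}}}_{K^{[r]}_{C_1}}(\bar z)-\mathcal J^{L_\Gamma}_{K^{[r]}/L_{\mathfrak C}}(\bar z)\,\Xi\,\mathcal L_*+\tfrac1{\overline{L_{\Gamma,*}(z)}}\mathcal J^{\overline{L_{\Gamma,*}}}_{\delta\overline{L_{\Gamma,*}}}(\bar z),\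 \mathcal J^{L_{\mathfrak C}}_{K^{[r]}}(\bar z)\Big],$$ with spectral jets taken with respect to the second variable and the first variable equal to $\bar z$. (The precise meaning of these jets of two-variable functions is given in the context.)
   Context: Conventions: $\mathbb C^*=\mathbb C\setminus\{0\}$; $\mathbb T$ is the unit circle; $\dagger$ is conjugate transpose; for a Laurent polynomial $\overline L(z):=\overline{L(\bar z)}$ (conjugated coefficients), and the reciprocal is $L_*(z):=\overline L(z^{-1})$; $f^{(l)}=\partial^lf/\partial z^l$. Zero order Toeplitz setting: $u_z$ is a univariate linear functional (a continuous functional on a space of test functions on $\mathbb C^*$ containing the Laurent polynomials, with well-defined support, e.g. a compactly supported distribution on $\mathbb C^*$), with $\operatorname{supp}u\subset\mathbb T$, and $\langle f,g\rangle_u=\langle u_z,f(z)\overline{g(z)}\rangle$. CMV basis: $\chi=[\chi^{(0)},\chi^{(1)},\dots]^\top$, $\chi^{(2k)}(z)=z^k$, $\chi^{(2k+1)}(z)=z^{-k-1}$. The Gram matrix $G=(\langle\chi^{(k)},\chi^{(l)}\rangle_u)_{k,l\ge0}$ is assumed quasidefinite (all leading principal minors nonzero), so $G=S_1^{-1}H(S_2^{-1})^\dagger$ with $S_1,S_2$ lower unitriangular and $H=\operatorname{diag}(H_0,H_1,\dots)$; $\phi_1=S_1\chi$, $\phi_2=S_2\chi$ with components $\phi_{1,k},\phi_{2,k}$. Perturbation: $L_{\mathfrak C},L_\Gamma$ are coprime Laurent polynomials; $L_\Gamma$ has distinct zeros $\zeta_1,\dots,\zeta_d\in\mathbb C^*\setminus\operatorname{supp}u$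 with multiplicities $m_1,\dots,m_d$ (so $\sum m_i=2N_\Gamma$). Given complex numbers $\Xi_{i,k|j,l}$ ($1\le i,j\le d$, $0\le k\le m_i-1$, $0\le l\le m_j-1$), the perturbed sesquilinear form is $$\langle f,g\rangle_{\tilde u}=\Big\langle \tfrac{L_{\mathfrak C}(z)}{L_\Gamma(z)}u_z,f(z)\overline{g(z)}\Big\rangle+\sum_{i,j=1}^d\sum_{k=0}^{m_i-1}\sum_{l=0}^{m_j-1}\frac1{k!\,l!}\Xi_{i,k|j,l}f^{(k)}(\zeta_i)\overline{g^{(l)}\big((\bar\zeta_j)^{-1}\big)}.$$ $\Xi$ is the $2N_\Gamma\times2N_\Gamma$ matrix with rows indexed by $(i,k)$ and columns by $(j,l)$, in lexicographic order. The perturbed Gram matrix in the CMV basis is assumed quasidefinite; $\tilde\phi_{1,k},\tilde\phi_{2,k},\tilde H_k$ are built from it as $\phi_{1,k},\phi_{2,k},H_k$ are from $G$. Second kind functions and kernels: $C_{1,k}(z)=\langle\phi_{1,k}(z_1),\frac1{\bar z-z_2}\rangle_u$ and $\overline{C_{2,k}(z)}=\langle\frac1{\bar z-z_1},\phi_{2,k}(z_2)\rangle_u$, for $\bar z\notin\operatorname{supp}u$. $K^{[r]}(\bar z_1,z_2)=\sum_{k=0}^{r-1}\overline{\phi_{2,k}(z_1)}H_k^{-1}\phi_{1,k}(z_2)$, $K^{[r]}_{C_2}(\bar z_1,z_2)=\sum_{k=0}^{r-1}\overline{C_{2,k}(z_1)}H_k^{-1}\phi_{1,k}(z_2)$, $K^{[r]}_{C_1}(\bar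 z_1,z_2)=\sum_{k=0}^{r-1}\overline{\phi_{2,k}(z_1)}H_k^{-1}C_{1,k}(z_2)$. $\delta L(z_1,z_2):=\frac{L(z_1)-L(z_2)}{z_1-z_2}$. Spectral jets: if $L$ has distinct zeros $\alpha_1,\dots,\alpha_d$ in $\mathbb C^*$ with multiplicities $m_1,\dots,m_d$, then $\mathcal J^L_f:=\big[f(\alpha_1),f'(\alpha_1),\dots,\frac{f^{(m_1-1)}(\alpha_1)}{(m_1-1)!},\dots,f(\alpha_d),\dots,\frac{f^{(m_d-1)}(\alpha_d)}{(m_d-1)!}\big]$. Zeros are enumerated compatibly: $\zeta_i$ for $L_\Gamma$, $\bar\zeta_i$ for $\overline{L_\Gamma}$, $(\bar\zeta_i)^{-1}$ for $L_{\Gamma,*}$, $\zeta_i^{-1}$ for $\overline{L_{\Gamma,*}}$; similarly for $L_{\mathfrak C}$. Jets of two-variable functions in $B^{(1,2)}_l$ (first variable): $\mathcal J^{\overline{L_\Gamma}}_{K_{C_2}^{[r]}}(z)=\sum_{k=0}^{r-1}\phi_{1,k}(z)H_k^{-1}\,\overline{\mathcal J^{\overline{L_\Gamma}}_{C_{2,k}}}$; $\mathcal J^{\overline{L_{\mathfrak C,*}}}_{K^{[r]}}(z)=\sum_{k=0}^{r-1}\phi_{1,k}(z)H_k^{-1}\,\overline{\mathcal J^{L_{\mathfrak C,*}}_{\phi_{2,k}}}$; $\mathcal J^{\overline{L_{\Gamma,*}}}_{K^{[r]}/\overline{L_{\mathfrak C,*}}}(z)=\sum_{k=0}^{r-1}\phi_{1,k}(z)H_k^{-1}\,\overline{\mathcal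 J^{L_{\Gamma,*}}_{\phi_{2,k}/L_{\mathfrak C,*}}}$; $\mathcal J^{\overline{L_\Gamma}}_{\delta L_\Gamma}(z)$ is the jet for $\delta L_\Gamma(\bar x_1,z)$ with $x_1$ at the zeros $\bar\zeta_i$ of $\overline{L_\Gamma}$, i.e. the entries are the normalized derivatives of $w\mapsto\delta L_\Gamma(w,z)$ at $w=\zeta_i$ up to order $m_i-1$. In $B^{(2,1)}_l$ (second variable): $\mathcal J^{\overline{L_{\Gamma,*}}}_{K_{C_1}^{[r]}}(\bar z)=\sum_{k=0}^{r-1}\overline{\phi_{2,k}(z)}H_k^{-1}\mathcal J^{\overline{L_{\Gamma,*}}}_{C_{1,k}}$; $\mathcal J^{L_{\mathfrak C}}_{K^{[r]}}(\bar z)=\sum_{k=0}^{r-1}\overline{\phi_{2,k}(z)}H_k^{-1}\mathcal J^{L_{\mathfrak C}}_{\phi_{1,k}}$; $\mathcal J^{L_\Gamma}_{K^{[r]}/L_{\mathfrak C}}(\bar z)=\sum_{k=0}^{r-1}\overline{\phi_{2,k}(z)}H_k^{-1}\mathcal J^{L_\Gamma}_{\phi_{1,k}/L_{\mathfrak C}}$; $\mathcal J^{\overline{L_{\Gamma,*}}}_{\delta\overline{L_{\Gamma,*}}}(\bar z)$ is the jet along $\overline{L_{\Gamma,*}}$ of $w\mapsto\delta\overline{L_{\Gamma,*}}(\bar z,w)$. Matrices $\mathcal L,\mathcal L_*$: for a prepared Laurent polynomial $L(z)=L_Nz^{-N}\prod_j(z-\alpha_j)^{m_j}$ put $L_{[i]}(z)=L_Nz^{-N}\prod_{j\neq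 i}(z-\alpha_j)^{m_j}$, $\ell_{[j],k}=\frac1{k!}\frac{d^k\overline{L_{[j]}}(z)}{dz^k}\big|_{z=\bar\alpha_j}$, let $\mathcal L_{[j]}$ be the $m_j\times m_j$ matrix with entries ($p,q=0,\dots,m_j-1$) equal to $\ell_{[j],p+q-m_j+1}$ if $p+q\ge m_j-1$ and $0$ otherwise, and form $\operatorname{diag}(\mathcal L_{[1]},\dots,\mathcal L_{[d]})$. This matrix is denoted $\mathcal L$ for $L=L_\Gamma$ (with $\alpha_j=\zeta_j$) and $\mathcal L_*$ for $L=L_{\Gamma,*}$ (with $\alpha_j=(\bar\zeta_j)^{-1}$).
   Formalization: All scalar prefactors except in the first formula for φ̃₁ are corrected (L_C, L_Γ coefficients unconjugated, τ̃^(1,2) conjugated in the second φ̃₁ formula, indices swapped in the second H̃ formula); u is a compactly supported distribution assumed Toeplitz: z̄u = z⁻¹u. *)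

theory Defs
  imports
    "HOL-Analysis.Analysis"
    "HOL-Library.Poly_Mapping"
    "Jordan_Normal_Form.Determinant"
begin

unbundle no vec_syntax

section \<open>Distributions with compact support on the punctured plane\<close>

definition dx :: "(complex \<Rightarrow> complex) \<Rightarrow> complex \<Rightarrow> complex" where
  "dx f z = vector_derivative (\<lambda>t::real. f (z + of_real t)) (at 0)"

definition dy :: "(complex \<Rightarrow> complex) \<Rightarrow> complex \<Rightarrow> complex" where
  "dy f z = vector_derivative (\<lambda>t::real. f (z + \<i> * of_real t)) (at 0)"

text \<open>The test functions are the real-smooth functions on the punctured plane. Differentiability
  of all the derivatives below also gives the existence and the symmetry of the mixed
  derivatives taken in any other order. The value of a test function at 0 is irrelevant.\<close>

definition test_function :: "(complex \<Rightarrow> complex) \<Rightarrow> bool" where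
  "test_function f \<longleftrightarrow> (\<forall>a b. ((dx ^^ a) ((dy ^^ b) f)) differentiable_on (- {0}))"

text \<open>The last conjunct is continuity for the topology of uniform convergence of all
  derivatives on compact sets.\<close>

definition compactly_supported_distribution :: "((complex \<Rightarrow> complex) \<Rightarrow> complex) \<Rightarrow> bool" where
  "compactly_supported_distribution u \<longleftrightarrow>
     (\<forall>f g. test_function f \<longrightarrow> test_function g \<longrightarrow> u (\<lambda>z. f z + g z) = u f + u g) \<and>
     (\<forall>c f. test_function f \<longrightarrow> u (\<lambda>z. c * f z) = c * u f) \<and>
     (\<exists>K n C. compact K \<and> 0 \<notin> K \<and>
        (\<forall>f B. test_function f \<longrightarrow> 0 \<le> B \<longrightarrow>
           (\<forall>a\<le>n. \<forall>b\<le>n. \<forall>z\<in>K. norm ((dx ^^ a) ((dy ^^ b) f) z) \<le> B) \<longrightarrow>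
           norm (u f) \<le> C * B))"

definition vanishes_on :: "((complex \<Rightarrow> complex) \<Rightarrow> complex) \<Rightarrow> complex set \<Rightarrow> bool" where
  "vanishes_on u V \<longleftrightarrow>
     (\<forall>f. test_function f \<longrightarrow> compact (closure {z. f z \<noteq> 0}) \<longrightarrow> closure {z. f z \<noteq> 0} \<subseteq> V \<longrightarrow> u f = 0)"

definition supp :: "((complex \<Rightarrow> complex) \<Rightarrow> complex) \<Rightarrow> complex set" where
  "supp u = - {0} - \<Union> {V. open V \<and> V \<subseteq> - {0} \<and> vanishes_on u V}"

text \<open>The value of \<open>u\<close> on a function that need only be defined and smooth near the support of \<open>u\<close>
  (such as a Cauchy kernel with its pole off the support). All test functions that agree
  with \<open>h\<close> near the support give the same value.\<close>

definition pairing :: "((complex \<Rightarrow> complex) \<Rightarrow> complex) \<Rightarrow> (complex \<Rightarrow> complex) \<Rightarrow> complex" where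
  "pairing u h = u (SOME f. test_function f \<and> (\<exists>V. open V \<and> supp u \<subseteq> V \<and> (\<forall>z\<in>V. f z = h z)))"

text \<open>The conjugate of \<open>z\<close> and \<open>1/z\<close> act in the same way on \<open>u\<close>, whence
  \<open>\<langle>z f, g\<rangle> = \<langle>f, g / z\<rangle>\<close>. For a measure this is the same as being supported on the unit
  circle; a distribution supported there could still involve derivatives normal
  to the circle, and its Gram matrix would then not be of Toeplitz type.\<close>

definition toeplitz_functional :: "((complex \<Rightarrow> complex) \<Rightarrow> complex) \<Rightarrow> bool" where
  "toeplitz_functional u \<longleftrightarrow>
     (\<forall>f. test_function f \<longrightarrow> u (\<lambda>z. cnj z * f z) = u (\<lambda>z. f z / z))"

section \<open>Laurent polynomials\<close>

type_synonym laurent = "int \<Rightarrow>\<^sub>0 complex"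

definition lcoeff :: "laurent \<Rightarrow> int \<Rightarrow> complex" where
  "lcoeff L j = Poly_Mapping.lookup L j"

definition leval :: "laurent \<Rightarrow> complex \<Rightarrow> complex" where
  "leval L z = (\<Sum>j\<in>Poly_Mapping.keys L. lcoeff L j * z powi j)"

definition lconj :: "laurent \<Rightarrow> laurent" where
  "lconj L = Poly_Mapping.map cnj L"

definition lrecip :: "laurent \<Rightarrow> laurent" where
  "lrecip L = Poly_Mapping.map_key uminus (lconj L)"

definition lcoprime :: "laurent \<Rightarrow> laurent \<Rightarrow> bool" where
  "lcoprime L M \<longleftrightarrow> (\<forall>D. D dvd L \<longrightarrow> D dvd M \<longrightarrow> D dvd 1)"

definition prepared :: "nat \<Rightarrow> laurent \<Rightarrow> bool" where
  "prepared N L \<longleftrightarrow> N \<ge> 1 \<and> Poly_Mapping.keys L \<subseteq> {- int N..int N} \<and>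
     lcoeff L (int N) \<noteq> 0 \<and> lcoeff L (- int N) \<noteq> 0"

text \<open>A list of pairs (zero, multiplicity) enumerates the zeros of a prepared Laurent polynomial.\<close>

definition zeros_with_mult :: "nat \<Rightarrow> laurent \<Rightarrow> (complex \<times> nat) list \<Rightarrow> bool" where
  "zeros_with_mult N L zs \<longleftrightarrow>
     distinct (map fst zs) \<and> (\<forall>(a, m)\<in>set zs. a \<noteq> 0 \<and> m \<ge> 1) \<and>
     (\<forall>z. z \<noteq> 0 \<longrightarrow> leval L z =
        lcoeff L (int N) * z powi (- int N) * (\<Prod>i<length zs. (z - fst (zs ! i)) ^ snd (zs ! i)))"

text \<open>If \<open>zs\<close> enumerates the zeros of \<open>L\<close>, then \<open>map_zeros cnj zs\<close>, \<open>map_zeros (\<lambda>a. inverse (cnj a)) zs\<close> and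
  \<open>map_zeros inverse zs\<close> enumerate those of \<open>lconj L\<close>, \<open>lrecip L\<close> and \<open>lconj (lrecip L)\<close>.\<close>

definition map_zeros :: "(complex \<Rightarrow> complex) \<Rightarrow> (complex \<times> nat) list \<Rightarrow> (complex \<times> nat) list" where
  "map_zeros h zs = map (\<lambda>(a, m). (h a, m)) zs"

definition ldelta :: "laurent \<Rightarrow> complex \<Rightarrow> complex \<Rightarrow> complex" where
  "ldelta L z1 z2 = (leval L z1 - leval L z2) / (z1 - z2)"

section \<open>Sesquilinear forms, Gram matrices and biorthogonal Laurent polynomials\<close>

type_synonym sesqform = "(complex \<Rightarrow> complex) \<Rightarrow> (complex \<Rightarrow> complex) \<Rightarrow> complex"

definition zero_order_form :: "((complex \<Rightarrow> complex) \<Rightarrow> complex) \<Rightarrow> sesqform" where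
  "zero_order_form u f g = pairing u (\<lambda>z. f z * cnj (g z))"

definition perturbed_form ::
  "((complex \<Rightarrow> complex) \<Rightarrow> complex) \<Rightarrow> laurent \<Rightarrow> laurent \<Rightarrow> (complex \<times> nat) list \<Rightarrow>
   (nat \<Rightarrow> nat \<Rightarrow> nat \<Rightarrow> nat \<Rightarrow> complex) \<Rightarrow> sesqform" where
  "perturbed_form u LC LG zs X f g =
     pairing u (\<lambda>z. leval LC z / leval LG z * (f z * cnj (g z))) +
     (\<Sum>i<length zs. \<Sum>j<length zs. \<Sum>k<snd (zs ! i). \<Sum>l<snd (zs ! j).
        1 / (fact k * fact l) * X i k j l * (deriv ^^ k) f (fst (zs ! i)) *
        cnj ((deriv ^^ l) g (inverse (cnj (fst (zs ! j))))))"

definition cmv :: "nat \<Rightarrow> complex \<Rightarrow> complex" where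
  "cmv k z = (if even k then z powi (int (k div 2)) else z powi (- int (k div 2) - 1))"

definition gram :: "sesqform \<Rightarrow> nat \<Rightarrow> nat \<Rightarrow> complex" where
  "gram F k l = F (cmv k) (cmv l)"

definition quasidefinite :: "(nat \<Rightarrow> nat \<Rightarrow> complex) \<Rightarrow> bool" where
  "quasidefinite G \<longleftrightarrow> (\<forall>n. Determinant.det (Matrix.mat n n (\<lambda>(i, j). G i j)) \<noteq> 0)"

definition lower_unitriangular :: "(nat \<Rightarrow> nat \<Rightarrow> complex) \<Rightarrow> bool" where
  "lower_unitriangular S \<longleftrightarrow> (\<forall>k. S k k = 1) \<and> (\<forall>k l. k < l \<longrightarrow> S k l = 0)"

text \<open>Semi-infinite matrices; the rows of a lower triangular matrix are finite.\<close>

definition lower_mult ::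
  "(nat \<Rightarrow> nat \<Rightarrow> complex) \<Rightarrow> (nat \<Rightarrow> nat \<Rightarrow> complex) \<Rightarrow> nat \<Rightarrow> nat \<Rightarrow> complex" where
  "lower_mult S T k l = (\<Sum>i\<le>k. S k i * T i l)"

definition lower_inverses :: "(nat \<Rightarrow> nat \<Rightarrow> complex) \<Rightarrow> (nat \<Rightarrow> nat \<Rightarrow> complex) \<Rightarrow> bool" where
  "lower_inverses S T \<longleftrightarrow> lower_unitriangular S \<and> lower_unitriangular T \<and>
     (\<forall>k l. lower_mult S T k l = (if k = l then 1 else 0)) \<and>
     (\<forall>k l. lower_mult T S k l = (if k = l then 1 else 0))"

definition gauss_borel ::
  "(nat \<Rightarrow> nat \<Rightarrow> complex) \<Rightarrow> (nat \<Rightarrow> nat \<Rightarrow> complex) \<Rightarrow> (nat \<Rightarrow> complex) \<Rightarrow>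
   (nat \<Rightarrow> nat \<Rightarrow> complex) \<Rightarrow> bool" where
  "gauss_borel G S1 H S2 \<longleftrightarrow>
     (\<exists>T1 T2. lower_inverses S1 T1 \<and> lower_inverses S2 T2 \<and>
        (\<forall>k l. G k l = (\<Sum>i\<le>min k l. T1 k i * H i * cnj (T2 l i))))"

definition biorth :: "(nat \<Rightarrow> nat \<Rightarrow> complex) \<Rightarrow> nat \<Rightarrow> complex \<Rightarrow> complex" where
  "biorth S k z = (\<Sum>i\<le>k. S k i * cmv i z)"

definition second_kind1 ::
  "((complex \<Rightarrow> complex) \<Rightarrow> complex) \<Rightarrow> (complex \<Rightarrow> complex) \<Rightarrow> complex \<Rightarrow> complex" where
  "second_kind1 u f z = zero_order_form u f (\<lambda>w. 1 / (cnj z - w))"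

definition second_kind2 ::
  "((complex \<Rightarrow> complex) \<Rightarrow> complex) \<Rightarrow> (complex \<Rightarrow> complex) \<Rightarrow> complex \<Rightarrow> complex" where
  "second_kind2 u f z = cnj (zero_order_form u (\<lambda>w. 1 / (cnj z - w)) f)"

section \<open>Spectral jets and the matrices attached to the perturbation\<close>

definition jet_index :: "(complex \<times> nat) list \<Rightarrow> (nat \<times> nat) list" where
  "jet_index zs = concat (map (\<lambda>i. map (\<lambda>k. (i, k)) [0..<snd (zs ! i)]) [0..<length zs])"

definition jet :: "(complex \<Rightarrow> complex) \<Rightarrow> (complex \<times> nat) list \<Rightarrow> complex Matrix.vec" where
  "jet f zs = vec_of_list (map (\<lambda>(i, k). (deriv ^^ k) f (fst (zs ! i)) / fact k) (jet_index zs))"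

text \<open>For \<open>J k\<close> the jet of the \<open>k\<close>-th function of one variable and \<open>c k\<close> the value of the other factor:
  the jet of a kernel \<open>\<Sum>k<r. c k * inverse (H k) * f k\<close>.\<close>

definition kernel_jet ::
  "nat \<Rightarrow> (nat \<Rightarrow> complex) \<Rightarrow> (nat \<Rightarrow> complex) \<Rightarrow> (nat \<Rightarrow> complex Matrix.vec) \<Rightarrow> complex Matrix.vec" where
  "kernel_jet r c H J =
     Matrix.vec (dim_vec (J 0)) (\<lambda>p. \<Sum>k<r. c k * inverse (H k) * vec_index (J k) p)"

definition mass_matrix ::
  "(complex \<times> nat) list \<Rightarrow> (nat \<Rightarrow> nat \<Rightarrow> nat \<Rightarrow> nat \<Rightarrow> complex) \<Rightarrow> complex Matrix.mat" where
  "mass_matrix zs X = Matrix.mat (length (jet_index zs)) (length (jet_index zs))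
     (\<lambda>(p, q). X (fst (jet_index zs ! p)) (snd (jet_index zs ! p))
                 (fst (jet_index zs ! q)) (snd (jet_index zs ! q)))"

definition row_mult :: "complex Matrix.vec \<Rightarrow> complex Matrix.mat \<Rightarrow> complex Matrix.vec" where
  "row_mult v M = transpose_mat M *\<^sub>v v"

definition lbracket :: "laurent \<Rightarrow> nat \<Rightarrow> (complex \<times> nat) list \<Rightarrow> nat \<Rightarrow> complex \<Rightarrow> complex" where
  "lbracket L N zs j z = lcoeff L (int N) * z powi (- int N) *
     (\<Prod>i\<in>{..<length zs} - {j}. (z - fst (zs ! i)) ^ snd (zs ! i))"

definition ell :: "laurent \<Rightarrow> nat \<Rightarrow> (complex \<times> nat) list \<Rightarrow> nat \<Rightarrow> nat \<Rightarrow> complex" where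
  "ell L N zs j k =
     (deriv ^^ k) (\<lambda>z. cnj (lbracket L N zs j (cnj z))) (cnj (fst (zs ! j))) / fact k"

definition ell_block :: "laurent \<Rightarrow> nat \<Rightarrow> (complex \<times> nat) list \<Rightarrow> nat \<Rightarrow> complex Matrix.mat" where
  "ell_block L N zs j = (let m = snd (zs ! j) in
     Matrix.mat m m (\<lambda>(p, q). if p + q \<ge> m - 1 then ell L N zs j (p + q - (m - 1)) else 0))"

definition ell_matrix :: "laurent \<Rightarrow> nat \<Rightarrow> (complex \<times> nat) list \<Rightarrow> complex Matrix.mat" where
  "ell_matrix L N zs = diag_block_mat (map (ell_block L N zs) [0..<length zs])"

definition A21 ::
  "((complex \<Rightarrow> complex) \<Rightarrow> complex) \<Rightarrow> laurent \<Rightarrow> (complex \<times> nat) list \<Rightarrow>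
   laurent \<Rightarrow> nat \<Rightarrow> (complex \<times> nat) list \<Rightarrow> complex Matrix.mat \<Rightarrow>
   (nat \<Rightarrow> complex \<Rightarrow> complex) \<Rightarrow> nat \<Rightarrow> complex Matrix.vec" where
  "A21 u LC zC LG NG zG Xi phi1 k =
     (jet (second_kind1 u (phi1 k)) (map_zeros inverse zG)
      - row_mult (row_mult (jet (\<lambda>z. phi1 k z / leval LC z) zG) Xi)
          (ell_matrix (lrecip LG) NG (map_zeros (\<lambda>a. inverse (cnj a)) zG)))
     @\<^sub>v jet (phi1 k) zC"

definition A12 ::
  "((complex \<Rightarrow> complex) \<Rightarrow> complex) \<Rightarrow> laurent \<Rightarrow> (complex \<times> nat) list \<Rightarrow>
   laurent \<Rightarrow> nat \<Rightarrow> (complex \<times> nat) list \<Rightarrow> complex Matrix.mat \<Rightarrow>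
   (nat \<Rightarrow> complex \<Rightarrow> complex) \<Rightarrow> nat \<Rightarrow> complex Matrix.vec" where
  "A12 u LC zC LG NG zG Xi phi2 k =
     (jet (second_kind2 u (phi2 k)) (map_zeros cnj zG)
      - row_mult (row_mult
          (jet (\<lambda>z. phi2 k z / leval (lrecip LC) z) (map_zeros (\<lambda>a. inverse (cnj a)) zG))
          (map_mat cnj (transpose_mat Xi)))
          (ell_matrix LG NG zG))
     @\<^sub>v jet (phi2 k) (map_zeros (\<lambda>a. inverse (cnj a)) zC)"

definition B12 ::
  "((complex \<Rightarrow> complex) \<Rightarrow> complex) \<Rightarrow> laurent \<Rightarrow> (complex \<times> nat) list \<Rightarrow>
   laurent \<Rightarrow> nat \<Rightarrow> (complex \<times> nat) list \<Rightarrow> complex Matrix.mat \<Rightarrow>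
   (nat \<Rightarrow> complex \<Rightarrow> complex) \<Rightarrow> (nat \<Rightarrow> complex) \<Rightarrow> (nat \<Rightarrow> complex \<Rightarrow> complex) \<Rightarrow>
   nat \<Rightarrow> complex \<Rightarrow> complex Matrix.vec" where
  "B12 u LC zC LG NG zG Xi phi1 H phi2 l z =
     (let r = l - 2 * NG + 1; K = kernel_jet r (\<lambda>k. phi1 k z) H in
      (K (\<lambda>k. map_vec cnj (jet (second_kind2 u (phi2 k)) (map_zeros cnj zG)))
       - row_mult (row_mult
           (K (\<lambda>k. map_vec cnj
              (jet (\<lambda>w. phi2 k w / leval (lrecip LC) w) (map_zeros (\<lambda>a. inverse (cnj a)) zG))))
           (transpose_mat Xi))
           (map_mat cnj (ell_matrix LG NG zG))
       + (1 / leval LG z) \<cdot>\<^sub>v jet (\<lambda>w. ldelta LG w z) zG)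
      @\<^sub>v K (\<lambda>k. map_vec cnj (jet (phi2 k) (map_zeros (\<lambda>a. inverse (cnj a)) zC))))"

definition B21 ::
  "((complex \<Rightarrow> complex) \<Rightarrow> complex) \<Rightarrow> laurent \<Rightarrow> (complex \<times> nat) list \<Rightarrow>
   laurent \<Rightarrow> nat \<Rightarrow> (complex \<times> nat) list \<Rightarrow> complex Matrix.mat \<Rightarrow>
   (nat \<Rightarrow> complex \<Rightarrow> complex) \<Rightarrow> (nat \<Rightarrow> complex) \<Rightarrow> (nat \<Rightarrow> complex \<Rightarrow> complex) \<Rightarrow>
   nat \<Rightarrow> complex \<Rightarrow> complex Matrix.vec" where
  "B21 u LC zC LG NG zG Xi phi1 H phi2 l z =
     (let r = l - 2 * NG + 1; K = kernel_jet r (\<lambda>k. cnj (phi2 k z)) H in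
      (K (\<lambda>k. jet (second_kind1 u (phi1 k)) (map_zeros inverse zG))
       - row_mult (row_mult
           (K (\<lambda>k. jet (\<lambda>w. phi1 k w / leval LC w) zG))
           Xi)
           (ell_matrix (lrecip LG) NG (map_zeros (\<lambda>a. inverse (cnj a)) zG))
       + (1 / cnj (leval (lrecip LG) z)) \<cdot>\<^sub>v
           jet (\<lambda>w. ldelta (lconj (lrecip LG)) (cnj z) w) (map_zeros inverse zG))
      @\<^sub>v K (\<lambda>k. jet (phi1 k) zC))"

definition det_rows :: "complex Matrix.vec list \<Rightarrow> complex" where
  "det_rows rs = Determinant.det (mat_of_rows (length rs) rs)"

definition tau :: "(nat \<Rightarrow> complex Matrix.vec) \<Rightarrow> nat \<Rightarrow> nat \<Rightarrow> nat \<Rightarrow> complex" where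
  "tau A NG NC l = det_rows (map A [l - 2 * NG..<l + 2 * NC])"

text \<open>The bordered determinants: a last column of values of the biorthogonal functions,
  respectively a last row.\<close>

definition det_border_col ::
  "(nat \<Rightarrow> complex Matrix.vec) \<Rightarrow> (nat \<Rightarrow> complex) \<Rightarrow> nat \<Rightarrow> nat \<Rightarrow> nat \<Rightarrow> complex" where
  "det_border_col A c NG NC l =
     det_rows (map (\<lambda>k. A k @\<^sub>v vec_of_list [c k]) [l - 2 * NG..<l + 2 * NC + 1])"

definition det_border_row ::
  "(nat \<Rightarrow> complex Matrix.vec) \<Rightarrow> complex Matrix.vec \<Rightarrow> nat \<Rightarrow> nat \<Rightarrow> nat \<Rightarrow> complex" where
  "det_border_row A b NG NC l = det_rows (map A [l - 2 * NG + 1..<l + 2 * NC] @ [b])"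

text \<open>On the scalar factors in the determinantal formulas. Replacing \<open>(LG, X)\<close> by \<open>(c LG, X / c)\<close>
  divides the perturbed form, hence the perturbed \<open>H\<close>, by \<open>c\<close> and leaves \<open>tau\<close>, for
  \<open>A21\<close> as for \<open>A12\<close>, unchanged; replacing \<open>(LC, X)\<close> by \<open>(c LC, c X)\<close> multiplies it by \<open>c\<close>, again
  with unchanged \<open>tau\<close>. So the extreme coefficients of \<open>LC\<close> and \<open>LG\<close> enter without
  conjugation (the conjugated ones occurring in the literature are those of the
  reciprocals: \<open>cnj (lcoeff (lrecip L) j) = lcoeff L (- j)\<close>). Replacing \<open>(u, X)\<close> by \<open>(c u, c X)\<close> multiplies
  \<open>tau\<close> of \<open>A12\<close> by a power of \<open>cnj c\<close>, so it is \<open>cnj tau\<close> that divides the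
  determinants of the conjugated rows.\<close>

end

theory Submission
  imports Defs "HOL-Complex_Analysis.Complex_Analysis"
begin

unbundle no vec_syntax

text \<open>Write \<open>\<langle>f, g\<rangle>\<close> for the original and \<open>\<langle>f, g\<rangle>'\<close> for the perturbed form, and \<open>LGs\<close> for the reciprocal of
  \<open>LG\<close>. The masses do not see \<open>LGs\<close>, so \<open>\<langle>f, LGs g\<rangle>' = \<langle>LC f, g\<rangle>\<close>; therefore \<open>LC phi1'\<^sub>j\<close> is a combination
  of the \<open>phi1\<^sub>k\<close> with \<open>j - 2 NG \<le> k \<le> j + 2 NC\<close>, and its extreme coefficients are known. The \<open>p\<close>-th
  entry of the row \<open>A21\<close> is a linear functional of \<open>phi1\<^sub>k\<close>. It maps \<open>LC f\<close> to 0 in the last \<open>2 NC\<close>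
  columns, and to \<open>- \<langle>f, g\<rangle>'\<close> with \<open>g = LGs / (z - a)\<^bsup>q+1\<^esup>\<close> in the column belonging to the derivative of
  order \<open>q\<close> at a zero \<open>a\<close> of \<open>LGs\<close>. As \<open>g\<close> lies in the span of the first \<open>2 NG\<close> functions of the CMV
  basis, \<open>\<langle>phi1'\<^sub>l, g\<rangle>' = 0\<close> for \<open>l \<ge> 2 NG\<close>: the coefficients of \<open>LC phi1'\<^sub>l\<close> annihilate the rows, and
  Cramer's rule gives \<open>phi1'\<^sub>l\<close> and \<open>H'\<^sub>l\<close>. In the formula for \<open>phi2'\<^sub>l\<close> the terms left over after row
  operations cancel by the reproducing property of the perturbed kernel applied to \<open>g\<close>. The
  formulas with \<open>A12\<close> are those with \<open>A21\<close> for the conjugate functional and the reciprocals of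
  \<open>LC\<close> and \<open>LG\<close>.\<close>

section \<open>Families of smooth functions\<close>

text \<open>The functional u may have any finite order and \<open>pairing\<close> rests on a chosen
  extension, so two facts that are easy for measures need proof. Cauchy transforms may be
  differentiated in the pole, which the jets at multiple zeros require; and 1 / cnj w may be
  replaced by w under the pairing although the two functions agree on the circle only, not near it.
  The first rests on bounds uniform in the pole, the second on the Toeplitz hypothesis, used as a
  congruence. The matrix \<open>ell_matrix\<close> originates in the functions g: its entries are
  their conjugated Taylor coefficients at the zeros of LGs, so a mass term evaluated at g becomes a
  product with this matrix. The alternating indices (-1)^l come from the CMV order: multiplication
  by a prepared L of width N carries the n-th basis function to the (n + 2 N)-th one, with leading
  coefficient L_N for even n and L_{-N} for odd n. The minus sign of the formulas with a bordering
  row stems from moving one row past the 2 NG + 2 NC - 1 others.\<close>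

text \<open>Families, and not single functions, because differentiating a Cauchy kernel under the distribution
  needs bounds on its derivatives that are uniform in the pole.\<close>

definition fam_eq :: "'p set \<Rightarrow> complex set \<Rightarrow> ('p \<Rightarrow> complex \<Rightarrow> complex) \<Rightarrow> ('p \<Rightarrow> complex \<Rightarrow> complex) \<Rightarrow> bool"
  where "fam_eq P S F G \<longleftrightarrow> (\<forall>p\<in>P. \<forall>z\<in>S. F p z = G p z)"

text \<open>The algebra generated by \<open>R\<close> over the functions in \<open>Q\<close>.
  Closure under equality on \<open>P\<close> and \<open>S\<close> is built in because the sum and
  product rules for derivatives are known only there.\<close>

inductive fam_alg :: "'p set \<Rightarrow> complex set \<Rightarrow> (('p \<Rightarrow> complex \<Rightarrow> complex) \<Rightarrow> bool) \<Rightarrow>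
    ('p \<Rightarrow> complex \<Rightarrow> complex) set \<Rightarrow> ('p \<Rightarrow> complex \<Rightarrow> complex) \<Rightarrow> bool"
  for P S Q R where
  base: "Q F \<Longrightarrow> fam_alg P S Q R F"
| gen: "F \<in> R \<Longrightarrow> fam_alg P S Q R F"
| add: "fam_alg P S Q R F \<Longrightarrow> fam_alg P S Q R G \<Longrightarrow> fam_alg P S Q R (\<lambda>p z. F p z + G p z)"
| mult: "fam_alg P S Q R F \<Longrightarrow> fam_alg P S Q R G \<Longrightarrow> fam_alg P S Q R (\<lambda>p z. F p z * G p z)"
| cong: "fam_alg P S Q R F \<Longrightarrow> fam_eq P S F G \<Longrightarrow> fam_alg P S Q R G"

lemma fam_alg_mono:
  assumes "fam_alg P S Q R F" "\<And>F. Q F \<Longrightarrow> Q' F"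
  shows "fam_alg P S Q' R F"
  using assms(1)
proof induction
  case (cong F G) show ?case by (rule fam_alg.cong[OF cong(3,2)])
qed (auto intro: fam_alg.base fam_alg.gen fam_alg.add fam_alg.mult assms(2))

text \<open>One argument serves the derivatives in x and in y: it is used for \<open>fdx\<close>
  with \<open>B\<close> expressing differentiability and a uniform bound, then for
  \<open>fdy\<close> with \<open>B\<close> the class obtained from \<open>fdx\<close>. This yields
  the order of derivatives that \<open>test_function\<close> prescribes.\<close>

locale derivation =
  fixes P :: "'p set" and S :: "complex set"
    and D :: "('p \<Rightarrow> complex \<Rightarrow> complex) \<Rightarrow> 'p \<Rightarrow> complex \<Rightarrow> complex"
    and B :: "('p \<Rightarrow> complex \<Rightarrow> complex) \<Rightarrow> bool"
  assumes B_cong: "fam_eq P S F G \<Longrightarrow> B F \<Longrightarrow> B G"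
    and D_cong: "fam_eq P S F G \<Longrightarrow> fam_eq P S (D F) (D G)"
    and B_add: "B F \<Longrightarrow> B G \<Longrightarrow> B (\<lambda>p z. F p z + G p z)"
    and B_mult: "B F \<Longrightarrow> B G \<Longrightarrow> B (\<lambda>p z. F p z * G p z)"
    and D_add: "B F \<Longrightarrow> B G \<Longrightarrow>
      fam_eq P S (\<lambda>p z. D F p z + D G p z) (D (\<lambda>p z. F p z + G p z))"
    and D_mult: "B F \<Longrightarrow> B G \<Longrightarrow>
      fam_eq P S (\<lambda>p z. D F p z * G p z + F p z * D G p z) (D (\<lambda>p z. F p z * G p z))"
begin

definition iter :: "('p \<Rightarrow> complex \<Rightarrow> complex) \<Rightarrow> bool" where
  "iter F \<longleftrightarrow> (\<forall>a. B ((D ^^ a) F))"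

lemma iterD: "iter F \<Longrightarrow> B F" "iter F \<Longrightarrow> iter (D F)"
proof -
  assume a: "iter F"
  show "B F" using a[unfolded iter_def, rule_format, of 0] by simp
  show "iter (D F)" unfolding iter_def
  proof
    fix n show "B ((D ^^ n) (D F))"
      using a[unfolded iter_def, rule_format, of "Suc n"] by (simp add: funpow_swap1)
  qed
qed

text \<open>By the Leibniz rule \<open>D\<close> maps the generated algebra into itself as soon as
  it maps the generators into it. All elements of the algebra lie in \<open>B\<close>, hence so do
  all iterated derivatives.\<close>

lemma alg_iter:
  assumes R: "\<And>F. F \<in> R \<Longrightarrow> B F \<and> fam_alg P S iter R (D F)"
    and F: "fam_alg P S iter R F"
  shows "iter F"
proof -
  have step: "B F \<and> fam_alg P S iter R (D F)" if "fam_alg P S iter R F" for F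
    using that
  proof induction
    case (base F) then show ?case by (auto intro: iterD fam_alg.base)
  next
    case (gen F) then show ?case using R by blast
  next
    case (add F G) then show ?case
      using B_add[of F G] fam_alg.cong[OF fam_alg.add D_add[of F G]] by blast
  next
    case (mult F G)
    have "fam_alg P S iter R (\<lambda>p z. D F p z * G p z + F p z * D G p z)"
      using mult by (intro fam_alg.add fam_alg.mult) auto
    then show ?case using mult B_mult[of F G] fam_alg.cong[OF _ D_mult[of F G]] by blast
  next
    case (cong F G) then show ?case using B_cong fam_alg.cong[OF _ D_cong] by blast
  qed
  have "fam_alg P S iter R ((D ^^ a) F)" for a
    by (induction a) (use F step in auto)
  then show ?thesis using step unfolding iter_def by blast
qed

text \<open>This and the next two lemmas are \<open>alg_iter\<close> without generators: the algebra
  is then built from \<open>iter\<close> alone.\<close>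

lemma iter_cong: "iter F \<Longrightarrow> fam_eq P S F G \<Longrightarrow> iter G"
  by (rule alg_iter[of "{}"], simp) (rule fam_alg.cong[OF fam_alg.base])
lemma iter_add: "iter F \<Longrightarrow> iter G \<Longrightarrow> iter (\<lambda>p z. F p z + G p z)"
  by (rule alg_iter[of "{}"], simp) (rule fam_alg.add[OF fam_alg.base fam_alg.base])
lemma iter_mult: "iter F \<Longrightarrow> iter G \<Longrightarrow> iter (\<lambda>p z. F p z * G p z)"
  by (rule alg_iter[of "{}"], simp) (rule fam_alg.mult[OF fam_alg.base fam_alg.base])

end

section \<open>Partial derivatives of families\<close>

definition fdx :: "('p \<Rightarrow> complex \<Rightarrow> complex) \<Rightarrow> 'p \<Rightarrow> complex \<Rightarrow> complex" where
  "fdx F p = dx (F p)"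

definition fdy :: "('p \<Rightarrow> complex \<Rightarrow> complex) \<Rightarrow> 'p \<Rightarrow> complex \<Rightarrow> complex" where
  "fdy F p = dy (F p)"

lemma fdx_pow: "(fdx ^^ a) F p = (dx ^^ a) (F p)"
  by (induction a) (auto simp: fdx_def)
lemma fdy_pow: "(fdy ^^ a) F p = (dy ^^ a) (F p)"
  by (induction a) (auto simp: fdy_def)

lemma dx_eq:
  assumes "(f has_derivative f') (at z)"
  shows "dx f z = f' 1" and "dy f z = f' \<i>"
proof -
  have "((\<lambda>t::real. f (z + of_real t)) has_derivative (\<lambda>t. f' (of_real t))) (at 0)"
    by (rule has_derivative_compose[of "\<lambda>t. z + of_real t" "of_real"])
       (use assms in \<open>auto intro!: derivative_eq_intros\<close>)
  moreover have "linear f'" using assms has_derivative_linear by blast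
  then have "f' (of_real t) = t *\<^sub>R f' 1" for t
    by (metis linear_scale of_real_def)
  ultimately have "((\<lambda>t::real. f (z + of_real t)) has_vector_derivative f' 1) (at 0)"
    unfolding has_vector_derivative_def by simp
  then show "dx f z = f' 1" unfolding dx_def by (rule vector_derivative_at)
  have "((\<lambda>t::real. f (z + \<i> * of_real t)) has_derivative (\<lambda>t. f' (\<i> * of_real t))) (at 0)"
    by (rule has_derivative_compose[of "\<lambda>t. z + \<i> * of_real t" "\<lambda>t. \<i> * of_real t"])
       (use assms in \<open>auto intro!: derivative_eq_intros\<close>)
  moreover have "f' (\<i> * of_real t) = t *\<^sub>R f' \<i>" for t
    using \<open>linear f'\<close> by (metis linear_scale mult.commute scaleR_conv_of_real)
  ultimately have "((\<lambda>t::real. f (z + \<i> * of_real t)) has_vector_derivative f' \<i>) (at 0)"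
    unfolding has_vector_derivative_def by simp
  then show "dy f z = f' \<i>" unfolding dy_def by (rule vector_derivative_at)
qed

lemma dxy_cong:
  assumes "open S" "z \<in> S" "\<And>w. w \<in> S \<Longrightarrow> f w = g w"
  shows "dx f z = dx g z" and "dy f z = dy g z"
proof -
  have *: "\<forall>\<^sub>F t in nhds (0::real). f (z + c * of_real t) = g (z + c * of_real t)" for c
  proof -
    have "((\<lambda>t::real. z + c * of_real t) \<longlongrightarrow> z + c * of_real 0) (nhds 0)"
      by (intro tendsto_intros filterlim_ident)
    then have "\<forall>\<^sub>F t in nhds (0::real). z + c * of_real t \<in> S"
      using assms(1,2) by (intro topological_tendstoD) auto
    then show ?thesis by eventually_elim (use assms(3) in auto)
  qed
  show "dx f z = dx g z" unfolding dx_def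
    by (rule vector_derivative_cong_eq) (use *[of 1] in \<open>auto simp: eventually_at_filter elim: eventually_mono\<close>)
  show "dy f z = dy g z" unfolding dy_def
    by (rule vector_derivative_cong_eq) (use *[of \<i>] in \<open>auto simp: eventually_at_filter elim: eventually_mono\<close>)
qed

text \<open>Differentiability is asked on the open set \<open>S\<close>, bounds uniform in the
  parameter only on \<open>K\<close>. With \<open>K\<close> empty the bounds are void and plain
  smoothness remains.\<close>

locale smooth_family =
  fixes K S :: "complex set" and P :: "'p set"
  assumes S_open: "open S" and K_sub: "K \<subseteq> S"
begin

definition bdd_diff :: "('p \<Rightarrow> complex \<Rightarrow> complex) \<Rightarrow> bool" where
  "bdd_diff F \<longleftrightarrow> (\<forall>p\<in>P. \<forall>z\<in>S. F p differentiable (at z)) \<and> (\<exists>C. \<forall>p\<in>P. \<forall>z\<in>K. norm (F p z) \<le> C)"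

lemma fd_cong:
  assumes "fam_eq P S F G"
  shows "fam_eq P S (fdx F) (fdx G)" "fam_eq P S (fdy F) (fdy G)"
  using dxy_cong[OF S_open] assms unfolding fam_eq_def fdx_def fdy_def by blast+

lemma fd_add:
  assumes "bdd_diff F" "bdd_diff G"
  shows "fam_eq P S (\<lambda>p z. fdx F p z + fdx G p z) (fdx (\<lambda>p z. F p z + G p z))"
    "fam_eq P S (\<lambda>p z. fdy F p z + fdy G p z) (fdy (\<lambda>p z. F p z + G p z))"
proof -
  have "dx (\<lambda>z. F p z + G p z) z = dx (F p) z + dx (G p) z \<and>
        dy (\<lambda>z. F p z + G p z) z = dy (F p) z + dy (G p) z" if pz: "p \<in> P" "z \<in> S" for p z
  proof -
    obtain f' where f: "(F p has_derivative f') (at z)"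
      using pz assms(1) unfolding bdd_diff_def differentiable_def by blast
    obtain g' where g: "(G p has_derivative g') (at z)"
      using pz assms(2) unfolding bdd_diff_def differentiable_def by blast
    show ?thesis using dx_eq[OF f] dx_eq[OF g] dx_eq[OF has_derivative_add[OF f g]] by simp
  qed
  then show "fam_eq P S (\<lambda>p z. fdx F p z + fdx G p z) (fdx (\<lambda>p z. F p z + G p z))"
    "fam_eq P S (\<lambda>p z. fdy F p z + fdy G p z) (fdy (\<lambda>p z. F p z + G p z))"
    unfolding fam_eq_def fdx_def fdy_def by auto
qed

lemma fd_mult:
  assumes "bdd_diff F" "bdd_diff G"
  shows "fam_eq P S (\<lambda>p z. fdx F p z * G p z + F p z * fdx G p z) (fdx (\<lambda>p z. F p z * G p z))"
    "fam_eq P S (\<lambda>p z. fdy F p z * G p z + F p z * fdy G p z) (fdy (\<lambda>p z. F p z * G p z))"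
proof -
  have "dx (\<lambda>z. F p z * G p z) z = dx (F p) z * G p z + F p z * dx (G p) z \<and>
        dy (\<lambda>z. F p z * G p z) z = dy (F p) z * G p z + F p z * dy (G p) z" if pz: "p \<in> P" "z \<in> S" for p z
  proof -
    obtain f' where f: "(F p has_derivative f') (at z)"
      using pz assms(1) unfolding bdd_diff_def differentiable_def by blast
    obtain g' where g: "(G p has_derivative g') (at z)"
      using pz assms(2) unfolding bdd_diff_def differentiable_def by blast
    show ?thesis using dx_eq[OF f] dx_eq[OF g] dx_eq[OF has_derivative_mult[OF f g]] by simp
  qed
  then show "fam_eq P S (\<lambda>p z. fdx F p z * G p z + F p z * fdx G p z) (fdx (\<lambda>p z. F p z * G p z))"
    "fam_eq P S (\<lambda>p z. fdy F p z * G p z + F p z * fdy G p z) (fdy (\<lambda>p z. F p z * G p z))"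
    unfolding fam_eq_def fdx_def fdy_def by auto
qed

lemma bdd_diff_cong: "fam_eq P S F G \<Longrightarrow> bdd_diff F \<Longrightarrow> bdd_diff G"
proof -
  assume a: "fam_eq P S F G" "bdd_diff F"
  have "G p differentiable (at z)" if pz: "p \<in> P" "z \<in> S" for p z
  proof -
    obtain f' where f: "(F p has_derivative f') (at z)"
      using pz a(2) unfolding bdd_diff_def differentiable_def by blast
    have "(G p has_derivative f') (at z)"
      by (rule has_derivative_transform_within_open[OF f S_open pz(2)])
         (use a(1) pz(1) in \<open>auto simp: fam_eq_def\<close>)
    then show ?thesis unfolding differentiable_def by blast
  qed
  moreover have "\<forall>p\<in>P. \<forall>z\<in>K. F p z = G p z" using a(1) K_sub unfolding fam_eq_def by auto
  ultimately show ?thesis using a(2) unfolding bdd_diff_def by auto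
qed

lemma bdd_diff_add: "bdd_diff F \<Longrightarrow> bdd_diff G \<Longrightarrow> bdd_diff (\<lambda>p z. F p z + G p z)"
proof -
  assume a: "bdd_diff F" "bdd_diff G"
  obtain C1 C2 where C: "\<forall>p\<in>P. \<forall>z\<in>K. norm (F p z) \<le> C1" "\<forall>p\<in>P. \<forall>z\<in>K. norm (G p z) \<le> C2"
    using a unfolding bdd_diff_def by blast
  have "\<forall>p\<in>P. \<forall>z\<in>K. norm (F p z + G p z) \<le> C1 + C2"
    using C norm_triangle_mono by blast
  then show ?thesis using a unfolding bdd_diff_def by (auto intro!: differentiable_add)
qed

lemma bdd_diff_mult: "bdd_diff F \<Longrightarrow> bdd_diff G \<Longrightarrow> bdd_diff (\<lambda>p z. F p z * G p z)"
proof -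
  assume a: "bdd_diff F" "bdd_diff G"
  obtain C1 C2 where C: "\<forall>p\<in>P. \<forall>z\<in>K. norm (F p z) \<le> C1" "\<forall>p\<in>P. \<forall>z\<in>K. norm (G p z) \<le> C2"
    using a unfolding bdd_diff_def by blast
  have "\<forall>p\<in>P. \<forall>z\<in>K. norm (F p z * G p z) \<le> C1 * C2"
    using C by (auto simp: norm_mult intro!: mult_mono order_trans[OF norm_ge_zero])
  then show ?thesis using a unfolding bdd_diff_def by (auto intro!: differentiable_mult)
qed

sublocale X: derivation P S fdx bdd_diff
  by (unfold_locales; (rule bdd_diff_cong fd_cong bdd_diff_add bdd_diff_mult fd_add fd_mult; assumption))

sublocale Y: derivation P S fdy X.iter
  by (unfold_locales;
      (rule X.iter_cong[rotated] fd_cong X.iter_add X.iter_mult fd_add fd_mult; (assumption | rule X.iterD; assumption)))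

definition smooth_fam :: "('p \<Rightarrow> complex \<Rightarrow> complex) \<Rightarrow> bool" where
  "smooth_fam F \<longleftrightarrow> (\<forall>a b. bdd_diff ((fdx ^^ a) ((fdy ^^ b) F)))"

lemma smooth_fam_iter: "smooth_fam F = Y.iter F"
  unfolding smooth_fam_def Y.iter_def X.iter_def by blast

lemmas smooth_fam_cong = Y.iter_cong[folded smooth_fam_iter]
  and smooth_fam_add = Y.iter_add[folded smooth_fam_iter]
  and smooth_fam_mult = Y.iter_mult[folded smooth_fam_iter]

lemma smooth_fam_bdd_diff: "smooth_fam F \<Longrightarrow> bdd_diff F"
  unfolding smooth_fam_iter by (auto dest: Y.iterD X.iterD)

text \<open>Smoothness is proved by exhibiting generators \<open>R\<close> whose first derivatives are polynomials in
  generators and smooth functions. The two base cases differ because the order of the derivatives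
  in \<open>test_function\<close> is fixed: only the \<open>y\<close>-derivative of a smooth function is smooth by definition.\<close>

theorem smooth_fam_gen:
  assumes R: "\<And>F. F \<in> R \<Longrightarrow> bdd_diff F \<and> fam_alg P S X.iter R (fdx F) \<and> fam_alg P S smooth_fam R (fdy F)"
    and F: "fam_alg P S smooth_fam R F"
  shows "smooth_fam F"
proof -
  have eq: "smooth_fam = Y.iter" by (simp add: fun_eq_iff smooth_fam_iter)
  have X: "X.iter F" if F: "F \<in> R" for F
    by (rule X.alg_iter[OF _ fam_alg.gen[OF F]]) (use R in blast)
  show ?thesis unfolding smooth_fam_iter
  proof (rule Y.alg_iter)
    show "fam_alg P S Y.iter R F" using F unfolding eq .
    fix G assume "G \<in> R"
    then show "X.iter G \<and> fam_alg P S Y.iter R (fdy G)"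
      using R[of G] X unfolding eq by metis
  qed
qed

lemma smooth_fam_X: "smooth_fam F \<Longrightarrow> X.iter F"
  unfolding smooth_fam_iter by (rule Y.iterD)

lemma smooth_fam_D: "smooth_fam F \<Longrightarrow> X.iter (fdx F)" "smooth_fam F \<Longrightarrow> smooth_fam (fdy F)"
  unfolding smooth_fam_iter by (blast intro: Y.iterD X.iterD)+

end

section \<open>Smooth functions on open sets\<close>

definition smooth_on :: "complex set \<Rightarrow> (complex \<Rightarrow> complex) \<Rightarrow> bool" where
  "smooth_on S f \<longleftrightarrow> (\<forall>a b. \<forall>z\<in>S. ((dx ^^ a) ((dy ^^ b) f)) differentiable (at z))"

lemma test_function_smooth: "test_function f \<longleftrightarrow> smooth_on (- {0}) f"
proof -
  have "open (- {0::complex})" by auto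
  then show ?thesis
    unfolding test_function_def smooth_on_def by (simp add: differentiable_on_eq_differentiable_at)
qed

lemma smooth_on_subset: "smooth_on S f \<Longrightarrow> T \<subseteq> S \<Longrightarrow> smooth_on T f"
  unfolding smooth_on_def by (meson subsetD)

lemma smooth_on_Un: "smooth_on S f \<Longrightarrow> smooth_on T f \<Longrightarrow> smooth_on (S \<union> T) f"
  unfolding smooth_on_def by (meson UnE)

lemma smooth_family_intro: "open S \<Longrightarrow> K \<subseteq> S \<Longrightarrow> smooth_family K S"
  by unfold_locales

text \<open>\<open>bool\<close> is merely a nonempty index type, and over the empty set the bounds
  say nothing; the closure properties of families thereby carry over to single functions.\<close>

lemma smooth_on_iff_family:
  assumes "open S"
  shows "smooth_on S f \<longleftrightarrow> smooth_family.smooth_fam {} S (UNIV :: bool set) (\<lambda>_. f)"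
proof -
  interpret smooth_family "{}" S "UNIV :: bool set" by unfold_locales (simp_all add: assms(1))
  have *: "bdd_diff ((fdx ^^ a) ((fdy ^^ b) (\<lambda>_. f))) \<longleftrightarrow> (\<forall>z\<in>S. ((dx ^^ a) ((dy ^^ b) f)) differentiable (at z))" for a b
    unfolding bdd_diff_def fdx_pow fdy_pow by simp
  have "smooth_fam (\<lambda>_. f) = (\<forall>a b. bdd_diff ((fdx ^^ a) ((fdy ^^ b) (\<lambda>_. f))))"
    by (rule smooth_fam_def)
  also have "\<dots> = smooth_on S f"
    by (subst smooth_on_def) (intro iff_allI *)
  finally show ?thesis ..
qed

text \<open>Every derivative is continuous, hence bounded on the compact set \<open>K\<close>, and
  it does not depend on the parameter.\<close>

lemma smooth_on_const_family:
  assumes "open S" "compact K" "K \<subseteq> S" "smooth_on S f"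
  shows "smooth_family.smooth_fam K S P (\<lambda>_. f)"
proof -
  interpret smooth_family K S P using assms(1,3) by unfold_locales
  have "\<exists>C. \<forall>z\<in>K. norm ((dx ^^ a) ((dy ^^ b) f) z) \<le> C" for a b
  proof -
    have "continuous_on K ((dx ^^ a) ((dy ^^ b) f))"
    proof (intro continuous_at_imp_continuous_on ballI differentiable_imp_continuous_within)
      fix z assume "z \<in> K"
      then show "(dx ^^ a) ((dy ^^ b) f) differentiable at z"
        using assms(3) assms(4)[unfolded smooth_on_def, rule_format, of z a b] by blast
    qed
    then have "bounded ((dx ^^ a) ((dy ^^ b) f) ` K)"
      using assms(2) by (intro compact_imp_bounded compact_continuous_image)
    then show ?thesis unfolding bounded_iff by auto
  qed
  then have "bdd_diff ((fdx ^^ a) ((fdy ^^ b) (\<lambda>_. f)))" for a b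
    using assms(4)[unfolded smooth_on_def] by (simp add: bdd_diff_def fdx_pow fdy_pow)
  then show ?thesis by (intro smooth_fam_def[THEN iffD2] allI)
qed

lemma dxy_cong_pow:
  assumes "open S" "z \<in> S" "\<And>w. w \<in> S \<Longrightarrow> f w = g w"
  shows "(dx ^^ a) ((dy ^^ b) f) z = (dx ^^ a) ((dy ^^ b) g) z"
proof -
  have y: "\<forall>z\<in>S. (dy ^^ b) f z = (dy ^^ b) g z"
  proof (induction b)
    case (Suc b)
    then show ?case using dxy_cong(2)[OF assms(1), of _ "(dy ^^ b) f" "(dy ^^ b) g"] by simp
  qed (use assms(3) in simp)
  have "\<forall>z\<in>S. (dx ^^ a) ((dy ^^ b) f) z = (dx ^^ a) ((dy ^^ b) g) z"
  proof (induction a)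
    case (Suc a)
    then show ?case
      using dxy_cong(1)[OF assms(1), of _ "(dx ^^ a) ((dy ^^ b) f)" "(dx ^^ a) ((dy ^^ b) g)"] by simp
  qed (use y in simp)
  then show ?thesis using assms(2) by blast
qed

lemma dxy_zero: "(dx ^^ a) ((dy ^^ b) (\<lambda>_. 0)) = (\<lambda>_. 0)"
proof -
  have d: "dx (\<lambda>_. 0) = (\<lambda>_. 0)" "dy (\<lambda>_. 0) = (\<lambda>_. 0)"
    using dx_eq[OF has_derivative_const[of 0]] by auto
  have "(dy ^^ b) (\<lambda>_. 0) = (\<lambda>_. 0)" by (induction b) (auto simp: d)
  moreover have "(dx ^^ a) (\<lambda>_. 0) = (\<lambda>_. 0)" by (induction a) (auto simp: d)
  ultimately show ?thesis by simp
qed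

lemma smooth_on_cong:
  assumes "open S" "\<And>z. z \<in> S \<Longrightarrow> f z = g z" "smooth_on S f"
  shows "smooth_on S g"
  using assms(3) unfolding smooth_on_iff_family[OF assms(1)]
proof -
  interpret smooth_family "{}" S "UNIV :: bool set" by unfold_locales (simp_all add: assms(1))
  assume "smooth_fam (\<lambda>_. f)"
  then show "smooth_fam (\<lambda>_. g)" by (rule smooth_fam_cong) (use assms(2) in \<open>auto simp: fam_eq_def\<close>)
qed

lemma smooth_on_add: "open S \<Longrightarrow> smooth_on S f \<Longrightarrow> smooth_on S g \<Longrightarrow> smooth_on S (\<lambda>z. f z + g z)"
  using smooth_family.smooth_fam_add[OF smooth_family_intro[of S "{}"], of UNIV "\<lambda>_::bool. f" "\<lambda>_. g"]
  by (simp add: smooth_on_iff_family)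

lemma smooth_on_mult: "open S \<Longrightarrow> smooth_on S f \<Longrightarrow> smooth_on S g \<Longrightarrow> smooth_on S (\<lambda>z. f z * g z)"
  using smooth_family.smooth_fam_mult[OF smooth_family_intro[of S "{}"], of UNIV "\<lambda>_::bool. f" "\<lambda>_. g"]
  by (simp add: smooth_on_iff_family)

lemma dxy_simps:
  "dx (\<lambda>_. c) = (\<lambda>_. 0)" "dy (\<lambda>_. c) = (\<lambda>_. 0)"
  "dx (\<lambda>z. z) = (\<lambda>_. 1)" "dy (\<lambda>z. z) = (\<lambda>_. \<i>)"
  "dx cnj = (\<lambda>_. 1)" "dy cnj = (\<lambda>_. - \<i>)"
proof -
  have c: "(cnj has_derivative cnj) (at z)" for z
    using bounded_linear_imp_has_derivative[OF bounded_linear_cnj] .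
  show "dx (\<lambda>_. c) = (\<lambda>_. 0)" "dy (\<lambda>_. c) = (\<lambda>_. 0)"
    "dx (\<lambda>z. z) = (\<lambda>_. 1)" "dy (\<lambda>z. z) = (\<lambda>_. \<i>)"
    "dx cnj = (\<lambda>_. 1)" "dy cnj = (\<lambda>_. - \<i>)"
    using dx_eq[OF has_derivative_const[of c]] dx_eq[OF has_derivative_ident] dx_eq[OF c]
    by (auto intro!: ext)
qed

lemma smooth_on_const: "smooth_on S (\<lambda>_. c)"
proof -
  have "(dx ^^ a) ((dy ^^ b) (\<lambda>_. c)) \<in> range (\<lambda>c _. c)" for a b
  proof -
    have y: "(dy ^^ b) (\<lambda>_. c) \<in> range (\<lambda>c _. c)" by (induction b) (auto simp: dxy_simps)
    show ?thesis by (induction a) (use y in \<open>auto simp: dxy_simps\<close>)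
  qed
  then have "\<exists>k. (dx ^^ a) ((dy ^^ b) (\<lambda>_. c)) = (\<lambda>_. k)" for a b by (meson imageE)
  then show ?thesis unfolding smooth_on_def by (metis differentiable_const)
qed

text \<open>All derivatives of higher order fall under \<open>smooth_on_const\<close>. The lemma
  covers the identity and \<open>cnj\<close>, the building blocks of everything below.\<close>

lemma smooth_on_dxy_const:
  assumes "f differentiable_on UNIV" "dx f = (\<lambda>_. c)" "dy f = (\<lambda>_. d)"
  shows "smooth_on S f"
  unfolding smooth_on_def
proof (intro allI ballI)
  fix a b z
  have c: "(dx ^^ a) ((dy ^^ b) (\<lambda>_. k)) differentiable at z" for k a b
    using smooth_on_const[of UNIV k] unfolding smooth_on_def by blast
  show "(dx ^^ a) ((dy ^^ b) f) differentiable at z"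
  proof (cases b)
    case 0
    show ?thesis
    proof (cases a)
      case 0 then show ?thesis using \<open>b = 0\<close> assms(1) by (auto simp: differentiable_on_def)
    next
      case (Suc a') then show ?thesis using \<open>b = 0\<close> assms(2) c[of a' 0 c] by (simp add: funpow_swap1)
    qed
  next
    case (Suc b') then show ?thesis using assms(3) c[of a b' d] by (simp add: funpow_swap1)
  qed
qed

lemma smooth_on_id: "smooth_on S (\<lambda>z. z)"
  by (rule smooth_on_dxy_const) (auto simp: dxy_simps differentiable_on_def)

lemma smooth_on_cnj: "smooth_on S cnj"
  by (rule smooth_on_dxy_const)
     (auto simp: dxy_simps differentiable_on_def intro!: bounded_linear_imp_differentiable bounded_linear_cnj)

lemma smooth_on_minus: "open S \<Longrightarrow> smooth_on S f \<Longrightarrow> smooth_on S g \<Longrightarrow> smooth_on S (\<lambda>z. f z - g z)"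
  using smooth_on_add[of S f "\<lambda>z. (-1) * g z"] smooth_on_mult[OF _ smooth_on_const, of S g "-1"] by simp

lemma smooth_on_power: "open S \<Longrightarrow> smooth_on S f \<Longrightarrow> smooth_on S (\<lambda>z. f z ^ n)"
  by (induction n) (auto intro: smooth_on_const smooth_on_mult)

lemma smooth_on_prod: "open S \<Longrightarrow> (\<And>i. i \<in> A \<Longrightarrow> smooth_on S (f i)) \<Longrightarrow> smooth_on S (\<lambda>z. \<Prod>i\<in>A. f i z)"
  by (induction A rule: infinite_finite_induct) (auto intro: smooth_on_const smooth_on_mult)

lemma dxy_differentiable:
  assumes "f differentiable at z"
  shows "\<exists>f'. (f has_derivative f') (at z) \<and> dx f z = f' 1 \<and> dy f z = f' \<i>"
  using assms dx_eq unfolding differentiable_def by blast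

text \<open>The reciprocal r generates its own derivatives: dr = - df r^2, a polynomial in r with
  smooth coefficients.\<close>

lemma smooth_on_inverse:
  assumes S: "open S" and f: "smooth_on S f" and nz: "\<And>z. z \<in> S \<Longrightarrow> f z \<noteq> 0"
  shows "smooth_on S (\<lambda>z. inverse (f z))"
  unfolding smooth_on_iff_family[OF S]
proof -
  interpret smooth_family "{}" S "UNIV :: bool set" by unfold_locales (use S in auto)
  let ?F = "\<lambda>_::bool. f" and ?r = "\<lambda>(_::bool) z. inverse (f z)"
  have sF: "smooth_fam ?F" using f smooth_on_iff_family[OF S] by blast
  have sc: "smooth_fam (\<lambda>_ _. -1)" using smooth_on_const[of S "-1"] smooth_on_iff_family[OF S] by blast
  have d: "(\<lambda>z. inverse (f z)) differentiable at z \<and>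
     dx (\<lambda>z. inverse (f z)) z = - 1 * dx f z * (inverse (f z) * inverse (f z)) \<and>
     dy (\<lambda>z. inverse (f z)) z = - 1 * dy f z * (inverse (f z) * inverse (f z))" if z: "z \<in> S" for z
  proof -
    have "f differentiable at z" using smooth_fam_bdd_diff[OF sF] z unfolding bdd_diff_def by blast
    then obtain f' where f': "(f has_derivative f') (at z)" "dx f z = f' 1" "dy f z = f' \<i>"
      using dxy_differentiable by blast
    show ?thesis
      using Deriv.has_derivative_inverse[OF nz[OF z] f'(1)] dx_eq[OF Deriv.has_derivative_inverse[OF nz[OF z] f'(1)]] f'(2,3)
      by (auto simp: differentiable_def)
  qed
  show "smooth_fam ?r"
  proof (rule smooth_fam_gen[of "{?r}"])
    fix G assume G: "G \<in> {?r}"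
    have "fam_alg UNIV S X.iter {?r} (\<lambda>p z. - 1 * fdx ?F p z * (?r p z * ?r p z))"
      by (intro fam_alg.mult) (auto intro: fam_alg.gen fam_alg.base smooth_fam_X smooth_fam_D sF sc)
    then have x: "fam_alg UNIV S X.iter {?r} (fdx ?r)"
      by (rule fam_alg.cong) (use d in \<open>auto simp: fam_eq_def fdx_def\<close>)
    have "fam_alg UNIV S smooth_fam {?r} (\<lambda>p z. - 1 * fdy ?F p z * (?r p z * ?r p z))"
      by (intro fam_alg.mult) (auto intro: fam_alg.gen fam_alg.base smooth_fam_D sF sc)
    then have y: "fam_alg UNIV S smooth_fam {?r} (fdy ?r)"
      by (rule fam_alg.cong) (use d in \<open>auto simp: fam_eq_def fdy_def\<close>)
    show "bdd_diff G \<and> fam_alg UNIV S X.iter {?r} (fdx G) \<and> fam_alg UNIV S smooth_fam {?r} (fdy G)"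
      using G x y d unfolding bdd_diff_def by auto
  qed (auto intro: fam_alg.gen)
qed

lemma smooth_on_divide:
  assumes "open S" "smooth_on S f" "smooth_on S g" "\<And>z. z \<in> S \<Longrightarrow> g z \<noteq> 0"
  shows "smooth_on S (\<lambda>z. f z / g z)"
  unfolding divide_inverse using assms by (intro smooth_on_mult smooth_on_inverse)

text \<open>The derivatives are taken along real lines, so they commute with the conjugation of
  values. Both inductions run over the whole open set because a derivative depends on the values
  nearby.\<close>

lemma smooth_on_cnj_comp_eq:
  assumes "open S" "smooth_on S f" "z \<in> S"
  shows "(dx ^^ a) ((dy ^^ b) (\<lambda>w. cnj (f w))) z = cnj ((dx ^^ a) ((dy ^^ b) f) z)"
proof -
  have d: "dx (\<lambda>w. cnj (g w)) z = cnj (dx g z) \<and> dy (\<lambda>w. cnj (g w)) z = cnj (dy g z)"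
    if gz: "g differentiable at z" for g z
  proof -
    obtain g' where g': "(g has_derivative g') (at z)" "dx g z = g' 1" "dy g z = g' \<i>"
      using dxy_differentiable[OF gz] by blast
    show ?thesis using g'(2,3) dx_eq[OF bounded_linear.has_derivative[OF bounded_linear_cnj g'(1)]] by auto
  qed
  have y: "\<forall>z\<in>S. (dy ^^ b) (\<lambda>w. cnj (f w)) z = cnj ((dy ^^ b) f z)"
  proof (induction b)
    case (Suc b)
    show ?case
    proof
      fix z assume z: "z \<in> S"
      have "dy ((dy ^^ b) (\<lambda>w. cnj (f w))) z = dy (\<lambda>w. cnj ((dy ^^ b) f w)) z"
        using Suc by (intro dxy_cong[OF assms(1) z]) auto
      also have "\<dots> = cnj (dy ((dy ^^ b) f) z)"
        using assms(2)[unfolded smooth_on_def, rule_format, of z 0 b] z d by auto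
      finally show "(dy ^^ Suc b) (\<lambda>w. cnj (f w)) z = cnj ((dy ^^ Suc b) f z)" by simp
    qed
  qed auto
  have "\<forall>z\<in>S. (dx ^^ a) ((dy ^^ b) (\<lambda>w. cnj (f w))) z = cnj ((dx ^^ a) ((dy ^^ b) f) z)"
  proof (induction a)
    case (Suc a)
    show ?case
    proof
      fix z assume z: "z \<in> S"
      have "dx ((dx ^^ a) ((dy ^^ b) (\<lambda>w. cnj (f w)))) z = dx (\<lambda>w. cnj ((dx ^^ a) ((dy ^^ b) f) w)) z"
        using Suc by (intro dxy_cong[OF assms(1) z]) auto
      also have "\<dots> = cnj (dx ((dx ^^ a) ((dy ^^ b) f)) z)"
        using assms(2) z d unfolding smooth_on_def by auto
      finally show "(dx ^^ Suc a) ((dy ^^ b) (\<lambda>w. cnj (f w))) z = cnj ((dx ^^ Suc a) ((dy ^^ b) f) z)" by simp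
    qed
  qed (use y in auto)
  then show ?thesis using assms(3) by blast
qed

lemma smooth_on_cnj_comp:
  assumes "open S" "smooth_on S f"
  shows "smooth_on S (\<lambda>z. cnj (f z))"
  unfolding smooth_on_def
proof (intro allI ballI)
  fix a b z assume z: "z \<in> S"
  have "(dx ^^ a) ((dy ^^ b) f) differentiable at z" using assms(2) z unfolding smooth_on_def by blast
  then obtain f' where f': "((dx ^^ a) ((dy ^^ b) f) has_derivative f') (at z)"
    unfolding differentiable_def by blast
  have "((dx ^^ a) ((dy ^^ b) (\<lambda>w. cnj (f w))) has_derivative (\<lambda>h. cnj (f' h))) (at z)"
    by (rule has_derivative_transform_within_open[OF bounded_linear.has_derivative[OF bounded_linear_cnj f'] assms(1) z])
       (use smooth_on_cnj_comp_eq[OF assms] in auto)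
  then show "(dx ^^ a) ((dy ^^ b) (\<lambda>w. cnj (f w))) differentiable at z"
    unfolding differentiable_def by blast
qed

section \<open>Cutoff functions\<close>

text \<open>The classical exp (- 1 / t), flat at 0. The powers of 1 / t make the linear span of the
  family closed under differentiation, see \<open>flat_deriv\<close>.\<close>

definition flat :: "nat \<Rightarrow> real \<Rightarrow> real" where
  "flat k t = (if t > 0 then inverse t ^ k * exp (- inverse t) else 0)"

lemma flat_tendsto: "(flat k \<longlongrightarrow> 0) (at_right 0)"
proof -
  have "((\<lambda>x::real. x ^ k / exp x) \<longlongrightarrow> 0) at_top" by (rule tendsto_power_div_exp_0)
  then have "((\<lambda>t::real. inverse t ^ k / exp (inverse t)) \<longlongrightarrow> 0) (at_right 0)"
    by (rule filterlim_compose[OF _ filterlim_inverse_at_top_right])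
  then show ?thesis
  proof (rule Lim_transform_eventually)
    show "\<forall>\<^sub>F t in at_right 0. inverse t ^ k / exp (inverse t) = flat k t"
      by (auto simp: eventually_at_filter flat_def exp_minus divide_inverse)
  qed
qed

lemma flat_deriv: "(flat k has_real_derivative (- real k * flat (k + 1) t + flat (k + 2) t)) (at t)"
proof -
  consider "t > 0" | "t < 0" | "t = 0" by linarith
  then show ?thesis
  proof cases
    case 1
    have k: "real k * inverse t ^ (k - 1) * (inverse t)\<^sup>2 = real k * inverse t ^ (k + 1)"
      by (cases k) (auto simp: power2_eq_square)
    have "((\<lambda>t. inverse t ^ k * exp (- inverse t)) has_real_derivative
        (real k * inverse t ^ (k - 1) * (- (inverse t)\<^sup>2)) * exp (- inverse t)
          + inverse t ^ k * (exp (- inverse t) * (inverse t)\<^sup>2)) (at t)"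
      using 1 by (auto intro!: derivative_eq_intros simp: power2_eq_square)
    also have "(real k * inverse t ^ (k - 1) * (- (inverse t)\<^sup>2)) * exp (- inverse t)
          + inverse t ^ k * (exp (- inverse t) * (inverse t)\<^sup>2)
        = - real k * flat (k + 1) t + flat (k + 2) t"
      using k 1 by (simp add: flat_def power2_eq_square)
    finally have "((\<lambda>t. inverse t ^ k * exp (- inverse t)) has_real_derivative
        (- real k * flat (k + 1) t + flat (k + 2) t)) (at t)" .
    then show ?thesis
      by (rule has_field_derivative_transform_within_open[of _ _ _ "{0<..}"]) (use 1 in \<open>auto simp: flat_def\<close>)
  next
    case 2
    have "((\<lambda>t::real. 0) has_real_derivative 0) (at t)" by simp
    then have "(flat k has_real_derivative 0) (at t)"
      by (rule has_field_derivative_transform_within_open[of _ _ _ "{..<0}"]) (use 2 in \<open>auto simp: flat_def\<close>)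
    then show ?thesis using 2 by (simp add: flat_def)
  next
    case 3
    have "((\<lambda>h. (flat k (0 + h) - flat k 0) / h) \<longlongrightarrow> 0) (at 0)"
    proof (rule filterlim_split_at_real)
      show "((\<lambda>h. (flat k (0 + h) - flat k 0) / h) \<longlongrightarrow> 0) (at_left 0)"
        by (rule Lim_transform_eventually[OF tendsto_const]) (auto simp: eventually_at_filter flat_def)
      \<comment> \<open>For h > 0 the difference quotient is \<open>flat (Suc k) h\<close>, which
        tends to 0.\<close>
      show "((\<lambda>h. (flat k (0 + h) - flat k 0) / h) \<longlongrightarrow> 0) (at_right 0)"
        by (rule Lim_transform_eventually[OF flat_tendsto[of "Suc k"]])
           (auto simp: eventually_at_filter flat_def divide_inverse mult_ac intro!: always_eventually)
    qed
    then show ?thesis unfolding 3 DERIV_def by (simp add: flat_def)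
  qed
qed

text \<open>The squared modulus is a polynomial in z and \<open>cnj z\<close>, hence smooth also at
  a. A derivative of the k-th function is a linear factor times a combination of those of index k +
  1 and k + 2, so all of them together serve as generators.\<close>

lemma smooth_on_flat:
  fixes a :: complex and al c :: real
  shows "smooth_on UNIV (\<lambda>z. of_real (flat k (al + c * (cmod (z - a))\<^sup>2)))"
  unfolding smooth_on_iff_family[OF open_UNIV]
proof -
  interpret smooth_family "{}" UNIV "UNIV :: bool set" by unfold_locales auto
  let ?q = "\<lambda>z. al + c * (cmod (z - a))\<^sup>2"
  let ?r = "\<lambda>k (_::bool) z. complex_of_real (flat k (?q z))"
  let ?R = "range ?r"
  have q': "(?q has_derivative (\<lambda>h. 2 * c * (Re (z - a) * Re h + Im (z - a) * Im h))) (at z)" for z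
    unfolding cmod_power2
    by (auto intro!: derivative_eq_intros simp: algebra_simps fun_eq_iff)
  have r': "((\<lambda>z. complex_of_real (flat k (?q z))) has_derivative
      (\<lambda>h. of_real ((2 * c * (Re (z - a) * Re h + Im (z - a) * Im h)) * (- real k * flat (k + 1) (?q z) + flat (k + 2) (?q z))))) (at z)" for k z
    by (rule has_derivative_eq_rhs[OF has_derivative_of_real[OF
          has_derivative_compose[OF q' flat_deriv[unfolded has_field_derivative_def]]]])
       (simp add: mult.commute)
  let ?cx = "\<lambda>(_::bool) z. complex_of_real c * ((z - a) + cnj (z - a))"
  let ?cy = "\<lambda>(_::bool) z. complex_of_real c * (- \<i>) * ((z - a) - cnj (z - a))"
  have sc: "smooth_fam ?cx" "smooth_fam ?cy" "smooth_fam (\<lambda>_ _. v)" for v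
    unfolding smooth_on_iff_family[OF open_UNIV, symmetric]
    by (intro smooth_on_mult smooth_on_const smooth_on_add smooth_on_minus smooth_on_id smooth_on_cnj_comp open_UNIV)+
  have cx: "?cx True z = of_real (2 * c * Re (z - a))" for z by (simp add: complex_eq_iff)
  have cy: "?cy True z = of_real (2 * c * Im (z - a))" for z by (simp add: complex_eq_iff)
  have x: "dx (\<lambda>z. complex_of_real (flat k (?q z))) z
     = ?cx True z * (of_real (- real k) * ?r (k + 1) True z + ?r (k + 2) True z)" for k z
    unfolding cx using dx_eq(1)[OF r'] by simp
  have y: "dy (\<lambda>z. complex_of_real (flat k (?q z))) z
     = ?cy True z * (of_real (- real k) * ?r (k + 1) True z + ?r (k + 2) True z)" for k z
    unfolding cy using dx_eq(2)[OF r'] by simp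
  show "smooth_fam (?r k)"
  proof (rule smooth_fam_gen[of ?R])
    fix G assume "G \<in> ?R"
    then obtain k where G: "G = ?r k" by blast
    have "fam_alg UNIV UNIV smooth_fam ?R (\<lambda>p z. ?cx p z * (of_real (- real k) * ?r (k + 1) p z + ?r (k + 2) p z))"
      by (rule fam_alg.mult[OF fam_alg.base[where Q = smooth_fam, OF sc(1)]], intro fam_alg.add fam_alg.mult)
         (auto intro: fam_alg.gen fam_alg.base sc)
    then have xx: "fam_alg UNIV UNIV smooth_fam ?R (fdx G)"
      by (rule fam_alg.cong) (auto simp: fam_eq_def fdx_def G x)
    have "fam_alg UNIV UNIV smooth_fam ?R (\<lambda>p z. ?cy p z * (of_real (- real k) * ?r (k + 1) p z + ?r (k + 2) p z))"
      by (rule fam_alg.mult[OF fam_alg.base[where Q = smooth_fam, OF sc(2)]], intro fam_alg.add fam_alg.mult)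
         (auto intro: fam_alg.gen fam_alg.base sc)
    then have yy: "fam_alg UNIV UNIV smooth_fam ?R (fdy G)"
      by (rule fam_alg.cong) (auto simp: fam_eq_def fdy_def G y)
    show "bdd_diff G \<and> fam_alg UNIV UNIV X.iter ?R (fdx G) \<and> fam_alg UNIV UNIV smooth_fam ?R (fdy G)"
      using xx yy fam_alg_mono[OF xx smooth_fam_X] r' unfolding bdd_diff_def G by (auto simp: differentiable_def)
  qed (auto intro: fam_alg.gen)
qed

text \<open>The cutoff is f / (f + g) with f vanishing off the larger ball and g vanishing on the
  smaller one.\<close>

lemma cutoff_ball:
  fixes a :: complex
  assumes "0 < r" "r < R"
  shows "\<exists>\<chi>. smooth_on UNIV \<chi> \<and> (\<forall>z\<in>cball a r. \<chi> z = 1) \<and> (\<forall>z. z \<notin> ball a R \<longrightarrow> \<chi> z = 0)"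
proof -
  \<comment> \<open>With x the squared distance to a, these constants produce the arguments (R^2 -
    x) / (R^2 - r^2) and (x - r^2) / (R^2 - r^2). They add up to 1, so one of them is positive at
    every point and f + g has no zero.\<close>
  define c al where "c = 1 / (R\<^sup>2 - r\<^sup>2)" and "al = R\<^sup>2 / (R\<^sup>2 - r\<^sup>2)"
  have pos: "R\<^sup>2 - r\<^sup>2 > 0" using assms by (simp add: power_strict_mono)
  define f g where "f = (\<lambda>z. complex_of_real (flat 0 (al + (- c) * (cmod (z - a))\<^sup>2)))"
    and "g = (\<lambda>z. complex_of_real (flat 0 ((1 - al) + c * (cmod (z - a))\<^sup>2)))"
  have al: "al + (- c) * x = (R\<^sup>2 - x) / (R\<^sup>2 - r\<^sup>2)" "(1 - al) + c * x = (x - r\<^sup>2) / (R\<^sup>2 - r\<^sup>2)" for x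
  proof -
    define D where "D = R\<^sup>2 - r\<^sup>2"
    have D: "D > 0" "r\<^sup>2 = R\<^sup>2 - D" using pos by (auto simp: D_def)
    show "al + (- c) * x = (R\<^sup>2 - x) / (R\<^sup>2 - r\<^sup>2)" "(1 - al) + c * x = (x - r\<^sup>2) / (R\<^sup>2 - r\<^sup>2)"
      unfolding al_def c_def D_def[symmetric] D(2) using D(1) by (auto simp: field_simps)
  qed
  have smf: "smooth_on UNIV f" and smg: "smooth_on UNIV g" unfolding f_def g_def by (rule smooth_on_flat)+
  have nz: "f z + g z \<noteq> 0" for z
  proof -
    have "(R\<^sup>2 - (cmod (z - a))\<^sup>2) / (R\<^sup>2 - r\<^sup>2) > 0 \<or> ((cmod (z - a))\<^sup>2 - r\<^sup>2) / (R\<^sup>2 - r\<^sup>2) > 0"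
      using pos by (auto simp: zero_less_divide_iff)
    then have "flat 0 (al + (- c) * (cmod (z - a))\<^sup>2) + flat 0 ((1 - al) + c * (cmod (z - a))\<^sup>2) > 0"
      unfolding al by (auto simp: flat_def add_pos_pos)
    then show ?thesis unfolding f_def g_def by (metis less_irrefl of_real_0 of_real_add of_real_eq_iff)
  qed
  show ?thesis
  proof (intro exI conjI ballI allI impI)
    show "smooth_on UNIV (\<lambda>z. f z / (f z + g z))"
      by (intro smooth_on_divide smooth_on_add open_UNIV smf smg nz)
    fix z
    show "f z / (f z + g z) = 1" if "z \<in> cball a r"
    proof -
      have "(cmod (z - a))\<^sup>2 \<le> r\<^sup>2" using that assms by (intro power_mono) (auto simp: dist_norm norm_minus_commute)
      then have "g z = 0" unfolding g_def al using pos by (auto simp: flat_def zero_less_divide_iff)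
      then show ?thesis using nz[of z] by simp
    qed
    show "f z / (f z + g z) = 0" if "z \<notin> ball a R"
    proof -
      have "R\<^sup>2 \<le> (cmod (z - a))\<^sup>2" using that assms by (intro power_mono) (auto simp: dist_norm norm_minus_commute)
      then have "f z = 0" unfolding f_def al using pos by (auto simp: flat_def zero_less_divide_iff)
      then show ?thesis by simp
    qed
  qed
qed

lemma finite_ball_cover:
  fixes K :: "complex set"
  assumes "compact K" "\<And>a. a \<in> K \<Longrightarrow> r a > 0"
  shows "\<exists>A. A \<subseteq> K \<and> finite A \<and> K \<subseteq> (\<Union>a\<in>A. ball a (r a))"
proof -
  have o: "open (ball a (r a))" for a by simp
  have cov: "K \<subseteq> (\<Union>a\<in>K. ball a (r a))"
    using assms(2) by (meson UN_I centre_in_ball subsetI)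
  show ?thesis
  proof (rule compactE_image[OF assms(1) o cov])
    fix A assume "A \<subseteq> K" "finite A" "K \<subseteq> (\<Union>a\<in>A. ball a (r a))"
    then show ?thesis by (intro exI[of _ A] conjI)
  qed
qed

lemma cutoff_compact:
  fixes K W :: "complex set"
  assumes "compact K" "open W" "K \<subseteq> W"
  obtains \<chi> T V where "smooth_on UNIV \<chi>" "compact T" "T \<subseteq> W" "\<And>z. z \<notin> T \<Longrightarrow> \<chi> z = 0"
    "open V" "K \<subseteq> V" "\<And>z. z \<in> V \<Longrightarrow> \<chi> z = 1"
proof -
  have "\<forall>a\<in>K. \<exists>R>0. cball a R \<subseteq> W"
    using assms(2,3) by (meson open_contains_cball subsetD)
  then obtain R where R: "\<And>a. a \<in> K \<Longrightarrow> R a > 0 \<and> cball a (R a) \<subseteq> W" by metis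
  then have "\<forall>a\<in>K. \<exists>\<chi>. smooth_on UNIV \<chi> \<and> (\<forall>z\<in>cball a (R a / 2). \<chi> z = 1) \<and> (\<forall>z. z \<notin> ball a (R a) \<longrightarrow> \<chi> z = 0)"
    by (intro ballI cutoff_ball) auto
  then obtain X where X: "\<And>a. a \<in> K \<Longrightarrow> smooth_on UNIV (X a)" "\<And>a z. a \<in> K \<Longrightarrow> z \<in> cball a (R a / 2) \<Longrightarrow> X a z = 1"
    "\<And>a z. a \<in> K \<Longrightarrow> z \<notin> ball a (R a) \<Longrightarrow> X a z = 0" by metis
  have "R a / 2 > 0" if "a \<in> K" for a using R[OF that] by simp
  then obtain A where A: "A \<subseteq> K" "finite A" "K \<subseteq> (\<Union>a\<in>A. ball a (R a / 2))"
    using finite_ball_cover[OF assms(1), of "\<lambda>a. R a / 2"] by metis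
  show ?thesis
  \<comment> \<open>The product is 0 where one of the local cutoffs is 1, and it is 1 where all of
    them are 0; one minus the product is therefore a cutoff without any normalisation.\<close>
  proof (rule that[of "\<lambda>z. 1 - (\<Prod>a\<in>A. 1 - X a z)" "\<Union>a\<in>A. cball a (R a)" "\<Union>a\<in>A. ball a (R a / 2)"])
    show "smooth_on UNIV (\<lambda>z. 1 - (\<Prod>a\<in>A. 1 - X a z))"
      using X(1) A(1) by (intro smooth_on_minus smooth_on_prod smooth_on_const open_UNIV) auto
    show "compact (\<Union>a\<in>A. cball a (R a))" using A(2) by auto
    show "(\<Union>a\<in>A. cball a (R a)) \<subseteq> W" using R A(1) by auto
    show "1 - (\<Prod>a\<in>A. 1 - X a z) = 0" if z: "z \<notin> (\<Union>a\<in>A. cball a (R a))" for z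
    proof -
      have "X a z = 0" if a: "a \<in> A" for a
      proof (rule X(3))
        show "a \<in> K" using A(1) a by blast
        show "z \<notin> ball a (R a)" using z a ball_subset_cball by blast
      qed
      then show ?thesis by simp
    qed
    show "1 - (\<Prod>a\<in>A. 1 - X a z) = 1" if z: "z \<in> (\<Union>a\<in>A. ball a (R a / 2))" for z
    proof -
      obtain a where a: "a \<in> A" "z \<in> ball a (R a / 2)" using z by blast
      then have "X a z = 1" by (intro X(2) subsetD[OF A(1)] subsetD[OF ball_subset_cball])
      then have "(\<Prod>a\<in>A. 1 - X a z) = 0" using A(2) a(1) by (intro prod_zero) auto
      then show ?thesis by simp
    qed
    show "open (\<Union>a\<in>A. ball a (R a / 2))" by blast
    show "K \<subseteq> (\<Union>a\<in>A. ball a (R a / 2))" by (rule A(3))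
  qed
qed

section \<open>The pairing with a compactly supported distribution\<close>

text \<open>The functions to which \<open>pairing\<close> gives a determined value: when the support
  is compact they agree near it with a test function.\<close>

definition smooth_near :: "((complex \<Rightarrow> complex) \<Rightarrow> complex) \<Rightarrow> (complex \<Rightarrow> complex) \<Rightarrow> bool" where
  "smooth_near u h \<longleftrightarrow> (\<exists>W. open W \<and> supp u \<subseteq> W \<and> smooth_on W h)"

lemma nearI: "open W \<Longrightarrow> supp u \<subseteq> W \<Longrightarrow> smooth_on W h \<Longrightarrow> smooth_near u h"
  unfolding smooth_near_def by blast

lemma smooth_near_cong:
  assumes "smooth_near u h" "open V" "supp u \<subseteq> V" "\<And>z. z \<in> V \<Longrightarrow> h z = g z"
  shows "smooth_near u g"
proof -
  obtain W where W: "open W" "supp u \<subseteq> W" "smooth_on W h" using assms(1) unfolding smooth_near_def by blast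
  have "smooth_on (W \<inter> V) g"
    by (rule smooth_on_cong[OF _ _ smooth_on_subset[OF W(3)]]) (use W(1) assms(2,4) in auto)
  then show ?thesis using W assms(2,3) by (intro nearI[of "W \<inter> V"]) auto
qed

lemma smooth_near_const: "smooth_near u (\<lambda>_. c)" and smooth_near_id: "smooth_near u (\<lambda>z. z)" and smooth_near_cnj: "smooth_near u cnj"
  by (rule nearI[of UNIV]; simp add: smooth_on_const smooth_on_id smooth_on_cnj)+

lemma smooth_near_binop:
  assumes "smooth_near u f" "smooth_near u g"
  shows "smooth_near u (\<lambda>z. f z + g z)" "smooth_near u (\<lambda>z. f z * g z)" "smooth_near u (\<lambda>z. f z - g z)"
proof -
  obtain W where W: "open W" "supp u \<subseteq> W" "smooth_on W f" using assms(1) unfolding smooth_near_def by blast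
  obtain V where V: "open V" "supp u \<subseteq> V" "smooth_on V g" using assms(2) unfolding smooth_near_def by blast
  have o: "open (W \<inter> V)" "supp u \<subseteq> W \<inter> V" "smooth_on (W \<inter> V) f" "smooth_on (W \<inter> V) g"
    using W V by (auto intro: smooth_on_subset)
  show "smooth_near u (\<lambda>z. f z + g z)" "smooth_near u (\<lambda>z. f z * g z)" "smooth_near u (\<lambda>z. f z - g z)"
    by (rule nearI[OF o(1,2)], intro smooth_on_add smooth_on_mult smooth_on_minus o)+
qed

lemmas smooth_near_add = smooth_near_binop(1) and smooth_near_mult = smooth_near_binop(2) and smooth_near_diff = smooth_near_binop(3)

lemma smooth_near_cnj_comp: "smooth_near u f \<Longrightarrow> smooth_near u (\<lambda>z. cnj (f z))"
  unfolding smooth_near_def using smooth_on_cnj_comp by blast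

lemma smooth_near_power: "smooth_near u f \<Longrightarrow> smooth_near u (\<lambda>z. f z ^ n)"
  by (induction n) (auto intro: smooth_near_const smooth_near_mult)

lemma smooth_near_sum: "(\<And>i. i \<in> A \<Longrightarrow> smooth_near u (f i)) \<Longrightarrow> smooth_near u (\<lambda>z. \<Sum>i\<in>A. f i z)"
  by (induction A rule: infinite_finite_induct) (auto intro: smooth_near_const smooth_near_add)

lemma smooth_near_inverse:
  assumes "smooth_near u f" "\<And>z. z \<in> supp u \<Longrightarrow> f z \<noteq> 0"
  shows "smooth_near u (\<lambda>z. inverse (f z))"
proof -
  obtain W where W: "open W" "supp u \<subseteq> W" "smooth_on W f" using assms(1) unfolding smooth_near_def by blast
  have c: "continuous_on W f"
    using W(3)[unfolded smooth_on_def, rule_format, of _ 0 0]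
    by (intro continuous_at_imp_continuous_on ballI differentiable_imp_continuous_within) simp
  let ?V = "W \<inter> f -` (- {0})"
  have "open ?V" using W(1) c by (intro continuous_open_preimage) auto
  moreover have "supp u \<subseteq> ?V" using W(2) assms(2) by auto
  moreover have "smooth_on ?V (\<lambda>z. inverse (f z))"
    by (rule smooth_on_inverse[OF calculation(1)]) (auto intro: smooth_on_subset[OF W(3)])
  ultimately show ?thesis by (rule nearI)
qed

lemma smooth_near_divide:
  "smooth_near u f \<Longrightarrow> smooth_near u g \<Longrightarrow> (\<And>z. z \<in> supp u \<Longrightarrow> g z \<noteq> 0) \<Longrightarrow> smooth_near u (\<lambda>z. f z / g z)"
  unfolding divide_inverse by (intro smooth_near_mult smooth_near_inverse)

lemma test_function_mult: "test_function f \<Longrightarrow> test_function g \<Longrightarrow> test_function (\<lambda>z. f z * g z)"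
  unfolding test_function_smooth by (intro smooth_on_mult) auto

lemma test_function_UNIV: "smooth_on UNIV f \<Longrightarrow> test_function f"
  unfolding test_function_smooth by (rule smooth_on_subset) auto

text \<open>Both choices are made from the same set of test functions, because the condition
  concerns only some neighbourhood of the support.\<close>

lemma pairing_cong:
  assumes "open V" "supp u \<subseteq> V" "\<And>z. z \<in> V \<Longrightarrow> h z = g z"
  shows "pairing u h = pairing u g"
proof -
  have imp: "\<exists>W. open W \<and> supp u \<subseteq> W \<and> (\<forall>z\<in>W. f z = b z)"
    if ex: "\<exists>W. open W \<and> supp u \<subseteq> W \<and> (\<forall>z\<in>W. f z = a z)" and ab: "\<And>z. z \<in> V \<Longrightarrow> a z = b z" for f a b
  proof -
    obtain W where "open W" "supp u \<subseteq> W" "\<forall>z\<in>W. f z = a z" using ex by blast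
    then show ?thesis using assms(1,2) ab by (intro exI[of _ "W \<inter> V"]) auto
  qed
  have *: "(\<exists>W. open W \<and> supp u \<subseteq> W \<and> (\<forall>z\<in>W. f z = h z)) =
        (\<exists>W. open W \<and> supp u \<subseteq> W \<and> (\<forall>z\<in>W. f z = g z))" for f
    by (rule iffI; rule imp, assumption) (simp_all add: assms(3))
  show ?thesis unfolding pairing_def * ..
qed

locale circle_distribution =
  fixes u :: "(complex \<Rightarrow> complex) \<Rightarrow> complex"
  assumes dist: "compactly_supported_distribution u"
    and supp_circle: "supp u \<subseteq> sphere 0 1"
begin

lemma u_add: "test_function f \<Longrightarrow> test_function g \<Longrightarrow> u (\<lambda>z. f z + g z) = u f + u g"
  and u_scale: "test_function f \<Longrightarrow> u (\<lambda>z. c * f z) = c * u f"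
  using dist unfolding compactly_supported_distribution_def by blast+

lemma u_bound:
  "\<exists>K n C. compact K \<and> 0 \<notin> K \<and> (\<forall>f B. test_function f \<longrightarrow> 0 \<le> B \<longrightarrow>
           (\<forall>a\<le>n. \<forall>b\<le>n. \<forall>z\<in>K. norm ((dx ^^ a) ((dy ^^ b) f) z) \<le> B) \<longrightarrow>
           norm (u f) \<le> C * B)"
  using dist unfolding compactly_supported_distribution_def by blast

lemma supp_nz: "z \<in> supp u \<Longrightarrow> z \<noteq> 0"
  unfolding supp_def by auto

lemma supp_norm: "z \<in> supp u \<Longrightarrow> norm z = 1"
  using supp_circle by auto

lemma supp_cnj: "z \<in> supp u \<Longrightarrow> cnj z * z = 1"
  using supp_norm[of z] by (metis complex_norm_square mult.commute of_real_1 one_power2)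

lemma compact_supp: "compact (supp u)"
proof -
  have "supp u = sphere 0 1 \<inter> - \<Union> {V. open V \<and> V \<subseteq> - {0} \<and> vanishes_on u V}"
    using supp_circle unfolding supp_def by auto
  moreover have "closed (- \<Union> {V. open V \<and> V \<subseteq> - {0} \<and> vanishes_on u V})"
    by (intro closed_Compl open_Union) auto
  ultimately show ?thesis by (metis compact_Int_closed compact_sphere)
qed

text \<open>The definition of the support speaks only of test functions with compact support inside
  one open null set. The part of \<open>K\<close> outside \<open>V\<close> is covered by finitely
  many balls inside such sets; h is cut off ball by ball without changing the value of
  \<open>u\<close>, and what remains vanishes near all of \<open>K\<close>.\<close>

lemma u_vanish:
  assumes h: "test_function h" and V: "open V" "supp u \<subseteq> V" "\<And>z. z \<in> V \<Longrightarrow> h z = 0"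
  shows "u h = 0"
proof -
  obtain K n C where K: "compact K" "0 \<notin> K"
    "\<forall>f B. test_function f \<longrightarrow> 0 \<le> B \<longrightarrow>
       (\<forall>a\<le>n. \<forall>b\<le>n. \<forall>z\<in>K. norm ((dx ^^ a) ((dy ^^ b) f) z) \<le> B) \<longrightarrow> norm (u f) \<le> C * B"
    using u_bound by blast
  let ?K = "K - V"
  have cK: "compact ?K" using K(1) V(1) by (rule compact_diff)
  have "\<exists>R>0. \<exists>V. open V \<and> V \<subseteq> - {0} \<and> vanishes_on u V \<and> cball a R \<subseteq> V" if a: "a \<in> ?K" for a
  proof -
    have "a \<notin> supp u" "a \<noteq> 0" using a V(2) K(2) by auto
    then obtain W where "open W" "W \<subseteq> - {0}" "vanishes_on u W" "a \<in> W"
      unfolding supp_def by auto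
    then show ?thesis by (meson open_contains_cball)
  qed
  then obtain R W where RW: "\<And>a. a \<in> ?K \<Longrightarrow> R a > 0"
    "\<And>a. a \<in> ?K \<Longrightarrow> open (W a) \<and> W a \<subseteq> - {0} \<and> vanishes_on u (W a) \<and> cball a (R a) \<subseteq> W a"
    by metis
  have "R a / 2 > 0" if "a \<in> ?K" for a using RW(1)[OF that] by simp
  then obtain A where A: "A \<subseteq> ?K" "finite A" "?K \<subseteq> (\<Union>a\<in>A. ball a (R a / 2))"
    using finite_ball_cover[OF cK, of "\<lambda>a. R a / 2"] by metis
  have ex: "\<exists>g. test_function g \<and> u g = u h \<and> (\<forall>z\<in>V \<union> (\<Union>a\<in>A'. ball a (R a / 2)). g z = 0)"
    if "A' \<subseteq> A" for A'
    using finite_subset[OF that A(2)] that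
  proof (induction A')
    case empty
    then show ?case using h V(3) by auto
  next
    case (insert a A')
    then obtain g where g: "test_function g" "u g = u h"
      "\<And>z. z \<in> V \<union> (\<Union>a\<in>A'. ball a (R a / 2)) \<Longrightarrow> g z = 0" by blast
    have aK: "a \<in> ?K" using insert.prems A(1) by blast
    obtain \<chi> where \<chi>: "smooth_on UNIV \<chi>" "\<And>z. z \<in> cball a (R a / 2) \<Longrightarrow> \<chi> z = 1"
      "\<And>z. z \<notin> ball a (R a) \<Longrightarrow> \<chi> z = 0"
      using cutoff_ball[of "R a / 2" "R a" a] RW(1)[OF aK] by auto
    let ?p = "\<lambda>z. g z * \<chi> z" and ?q = "\<lambda>z. g z * (1 - \<chi> z)"
    have t: "test_function ?p" "test_function ?q"
      by (rule test_function_mult[OF g(1) test_function_UNIV], intro smooth_on_minus smooth_on_const \<chi>(1) open_UNIV)+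
    have sub: "closure {z. ?p z \<noteq> 0} \<subseteq> cball a (R a)"
    proof (rule closure_minimal)
      show "{z. ?p z \<noteq> 0} \<subseteq> cball a (R a)" using \<chi>(3) ball_subset_cball by fastforce
    qed simp
    have cc: "compact (closure {z. ?p z \<noteq> 0})"
      using compact_Int_closed[OF compact_cball closed_closure] sub by (metis inf.absorb_iff2)
    have "closure {z. ?p z \<noteq> 0} \<subseteq> W a" using sub RW(2)[OF aK] by blast
    then have "u ?p = 0" using RW(2)[OF aK] t(1) cc unfolding vanishes_on_def by blast
    moreover have "u g = u ?p + u ?q"
      using u_add[OF t] by (simp add: algebra_simps)
    ultimately have "u ?q = u h" using g(2) by simp
    moreover have "?q z = 0" if "z \<in> V \<union> (\<Union>a\<in>insert a A'. ball a (R a / 2))" for z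
      using that g(3) \<chi>(2)[of z] by auto
    ultimately show ?case using t(2) by blast
  qed
  from this[OF order_refl] obtain g where g: "test_function g" "u g = u h"
      "\<And>z. z \<in> V \<union> (\<Union>a\<in>A. ball a (R a / 2)) \<Longrightarrow> g z = 0" by blast
  \<comment> \<open>All derivatives of g vanish on \<open>K\<close>, so the continuity estimate
    applies with the bound 0.\<close>
  have "norm (u g) \<le> C * 0"
  proof (rule K(3)[rule_format, OF g(1)])
    fix a b z assume "z \<in> K"
    then have z: "z \<in> V \<union> (\<Union>a\<in>A. ball a (R a / 2))" using A(3) by blast
    have "(dx ^^ a) ((dy ^^ b) g) z = (dx ^^ a) ((dy ^^ b) (\<lambda>_. 0)) z"
      by (rule dxy_cong_pow[OF _ z]) (use V(1) g(3) in auto)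
    then show "norm ((dx ^^ a) ((dy ^^ b) g) z) \<le> 0" by (simp add: dxy_zero)
  qed simp
  then show ?thesis using g(2) by simp
qed

lemma u_eq:
  assumes "test_function f" "test_function g" "open V" "supp u \<subseteq> V" "\<And>z. z \<in> V \<Longrightarrow> f z = g z"
  shows "u f = u g"
proof -
  have t: "test_function (\<lambda>z. - 1 * g z)"
    by (rule test_function_mult[OF test_function_UNIV[OF smooth_on_const] assms(2)])
  have "u (\<lambda>z. f z + - 1 * g z) = 0"
  proof (rule u_vanish[OF _ assms(3,4)])
    show "test_function (\<lambda>z. f z + - 1 * g z)"
      using assms(1) t unfolding test_function_smooth by (intro smooth_on_add) auto
  qed (use assms(5) in auto)
  then show ?thesis using u_add[OF assms(1) t] u_scale[OF assms(2), of "-1"] by simp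
qed

lemma pairing_eq:
  assumes "test_function f" "open V" "supp u \<subseteq> V" "\<And>z. z \<in> V \<Longrightarrow> f z = h z"
  shows "pairing u h = u f"
proof -
  let ?P = "\<lambda>f. test_function f \<and> (\<exists>V. open V \<and> supp u \<subseteq> V \<and> (\<forall>z\<in>V. f z = h z))"
  have "?P (SOME f. ?P f)" by (rule someI[of ?P f]) (use assms in blast)
  then obtain V' where V': "test_function (SOME f. ?P f)" "open V'" "supp u \<subseteq> V'"
    "\<forall>z\<in>V'. (SOME f. ?P f) z = h z" by blast
  show ?thesis unfolding pairing_def
    by (rule u_eq[OF V'(1) assms(1), of "V \<inter> V'"]) (use V' assms in auto)
qed

text \<open>The cutoff is chosen before h, so that a single one serves a whole family of functions.
  Its product with h is smooth everywhere, since \<open>W\<close> and the complement of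
  \<open>T\<close>, where the product is 0, cover the plane.\<close>

lemma smooth_near_cutoff:
  assumes "open W" "supp u \<subseteq> W"
  obtains \<chi> T V where "smooth_on UNIV \<chi>" "compact T" "T \<subseteq> W" "\<And>z. z \<notin> T \<Longrightarrow> \<chi> z = 0"
    "open V" "supp u \<subseteq> V" "V \<subseteq> W" "\<And>z. z \<in> V \<Longrightarrow> \<chi> z = 1"
    "\<And>h. smooth_on W h \<Longrightarrow> smooth_on UNIV (\<lambda>z. \<chi> z * h z)"
    "\<And>h. smooth_on W h \<Longrightarrow> pairing u h = u (\<lambda>z. \<chi> z * h z)"
proof -
  obtain \<chi> T V where X: "smooth_on UNIV \<chi>" "compact T" "T \<subseteq> W" "\<And>z. z \<notin> T \<Longrightarrow> \<chi> z = 0"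
    "open V" "supp u \<subseteq> V" "\<And>z. z \<in> V \<Longrightarrow> \<chi> z = 1"
    using cutoff_compact[OF compact_supp assms] by metis
  have s: "smooth_on UNIV (\<lambda>z. \<chi> z * h z)" if h: "smooth_on W h" for h
  proof -
    have o: "open (- T)" using X(2) compact_imp_closed by blast
    have "smooth_on W (\<lambda>z. \<chi> z * h z)" using h smooth_on_subset[OF X(1)] assms(1) by (intro smooth_on_mult) auto
    moreover have "smooth_on (- T) (\<lambda>z. \<chi> z * h z)"
      by (rule smooth_on_cong[OF o _ smooth_on_const[of _ 0]]) (use X(4) in auto)
    ultimately have "smooth_on (W \<union> - T) (\<lambda>z. \<chi> z * h z)" by (rule smooth_on_Un)
    moreover have "W \<union> - T = UNIV" using X(3) by auto
    ultimately show ?thesis by simp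
  qed
  show ?thesis
  proof (rule that[OF X(1-4), of "V \<inter> W"])
    show "smooth_on UNIV (\<lambda>z. \<chi> z * h z)" if "smooth_on W h" for h using s[OF that] .
    show "pairing u h = u (\<lambda>z. \<chi> z * h z)" if "smooth_on W h" for h
      by (rule pairing_eq[OF test_function_UNIV[OF s[OF that]] X(5,6)]) (use X(7) in simp)
  qed (use X assms in auto)
qed

lemma smooth_near_test:
  assumes "smooth_near u h"
  obtains f V where "smooth_on UNIV f" "open V" "supp u \<subseteq> V" "\<And>z. z \<in> V \<Longrightarrow> f z = h z"
proof -
  obtain W where W: "open W" "supp u \<subseteq> W" "smooth_on W h" using assms unfolding smooth_near_def by blast
  obtain \<chi> T V where X: "open V" "supp u \<subseteq> V" "\<And>z. z \<in> V \<Longrightarrow> \<chi> z = 1"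
    "\<And>h. smooth_on W h \<Longrightarrow> smooth_on UNIV (\<lambda>z. \<chi> z * h z)"
    using smooth_near_cutoff[OF W(1,2)] by metis
  show ?thesis by (rule that[OF X(4)[OF W(3)] X(1,2)]) (use X(3) in auto)
qed

lemma pairing_add:
  assumes "smooth_near u f" "smooth_near u g"
  shows "pairing u (\<lambda>z. f z + g z) = pairing u f + pairing u g"
proof -
  obtain f' V where f: "smooth_on UNIV f'" "open V" "supp u \<subseteq> V" "\<And>z. z \<in> V \<Longrightarrow> f' z = f z"
    using smooth_near_test[OF assms(1)] by blast
  obtain g' V' where g: "smooth_on UNIV g'" "open V'" "supp u \<subseteq> V'" "\<And>z. z \<in> V' \<Longrightarrow> g' z = g z"
    using smooth_near_test[OF assms(2)] by blast
  have "pairing u (\<lambda>z. f z + g z) = u (\<lambda>z. f' z + g' z)"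
    by (rule pairing_eq[of _ "V \<inter> V'"]) (use f g in \<open>auto intro!: test_function_UNIV smooth_on_add\<close>)
  then show ?thesis
    using u_add[OF f(1)[THEN test_function_UNIV] g(1)[THEN test_function_UNIV]]
      pairing_eq[OF test_function_UNIV[OF f(1)] f(2-4)] pairing_eq[OF test_function_UNIV[OF g(1)] g(2-4)] by simp
qed

lemma pairing_scale:
  assumes "smooth_near u f"
  shows "pairing u (\<lambda>z. c * f z) = c * pairing u f"
proof -
  obtain f' V where f: "smooth_on UNIV f'" "open V" "supp u \<subseteq> V" "\<And>z. z \<in> V \<Longrightarrow> f' z = f z"
    using smooth_near_test[OF assms(1)] by blast
  have "pairing u (\<lambda>z. c * f z) = u (\<lambda>z. c * f' z)"
    by (rule pairing_eq[of _ "V"]) (use f in \<open>auto intro!: test_function_UNIV smooth_on_mult smooth_on_const\<close>)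
  then show ?thesis
    using u_scale[OF f(1)[THEN test_function_UNIV]]
      pairing_eq[OF test_function_UNIV[OF f(1)] f(2-4)] by simp
qed

lemma pairing_minus:
  assumes "smooth_near u f" "smooth_near u g"
  shows "pairing u (\<lambda>z. f z - g z) = pairing u f - pairing u g"
  using pairing_add[OF assms(1) smooth_near_mult[OF smooth_near_const assms(2)], of "-1"]
    pairing_scale[OF assms(2), of "-1"] by simp

lemma pairing_sum:
  assumes "\<And>i. i \<in> A \<Longrightarrow> smooth_near u (f i)"
  shows "pairing u (\<lambda>z. \<Sum>i\<in>A. f i z) = (\<Sum>i\<in>A. pairing u (f i))"
proof -
  have z: "pairing u (\<lambda>z. 0) = 0" using pairing_scale[OF smooth_near_const, of 0 0] by simp
  show ?thesis using assms
    by (induction A rule: infinite_finite_induct) (auto simp: z pairing_add smooth_near_sum)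
qed

section \<open>Differentiation under the pairing\<close>

text \<open>The mixed powers of the kernels at z and z0 are the terms of the remainder in
  \<open>power_remainder\<close>. Their bounds, uniform in z, come from the continuity estimate of
  \<open>u\<close> applied to the family of cut-off kernels.\<close>

lemma kernel_bound:
  assumes h: "smooth_near u h" and z0: "\<And>w. w \<in> supp u \<Longrightarrow> cnj w \<noteq> z0"
  shows "\<exists>e>0. (\<forall>z\<in>ball z0 e. \<forall>w\<in>supp u. cnj w \<noteq> z) \<and> (\<forall>n m. \<exists>B. \<forall>z\<in>ball z0 e.
    norm (pairing u (\<lambda>w. h w * (1 / (z - cnj w)) ^ n * (1 / (z0 - cnj w)) ^ m)) \<le> B)"
proof -
  obtain W0 where W0: "open W0" "supp u \<subseteq> W0" "smooth_on W0 h" using h unfolding smooth_near_def by blast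
  have cont: "continuous_on UNIV cnj" by (intro continuous_intros)
  have nrm: "compact (cnj ` supp u)" using compact_supp
    by (rule compact_continuous_image[OF continuous_on_subset[OF cont subset_UNIV]])
  then have "open (- (cnj ` supp u))" "z0 \<in> - (cnj ` supp u)"
    using z0 compact_imp_closed by (auto simp: open_Compl)
  then obtain e0 where e0: "e0 > 0" "cball z0 e0 \<subseteq> - (cnj ` supp u)"
    by (meson open_contains_cball)
  \<comment> \<open>Conjugates of points of \<open>W\<close> keep a distance of more than e0 from
    z0; letting z move by half of e0 leaves the other half as a lower bound for the
    denominators.\<close>
  define e where "e = e0 / 2"
  have e: "e > 0" using e0 by (simp add: e_def)
  define W where "W = W0 \<inter> cnj -` (- cball z0 e0) \<inter> - {0}"
  have oW: "open W" unfolding W_def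
    using W0(1) cont by (intro open_Int open_vimage) (auto simp: open_Compl)
  have sW: "supp u \<subseteq> W" using W0(2) e0(2) supp_nz unfolding W_def by auto
  have ge: "norm (z - cnj w) \<ge> e" if "z \<in> ball z0 e" "w \<in> W" for z w
  proof -
    have "dist z0 (cnj w) > e0" using that(2) unfolding W_def by auto
    moreover have "dist z0 (cnj w) \<le> dist z0 z + dist z (cnj w)" by (rule dist_triangle)
    ultimately show ?thesis using that(1) unfolding e_def by (auto simp: dist_norm)
  qed
  have nz: "z - cnj w \<noteq> 0" if "z \<in> ball z0 e" "w \<in> W" for z w using ge[OF that] e by auto
  obtain \<chi> T V where X: "smooth_on UNIV \<chi>" "compact T" "T \<subseteq> W" "\<And>z. z \<notin> T \<Longrightarrow> \<chi> z = 0"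
    "\<And>h. smooth_on W h \<Longrightarrow> smooth_on UNIV (\<lambda>z. \<chi> z * h z)"
    "\<And>h. smooth_on W h \<Longrightarrow> pairing u h = u (\<lambda>z. \<chi> z * h z)"
    by (rule smooth_near_cutoff[OF oW sW]) (rule that; assumption)
  obtain K N C where K: "compact K" "0 \<notin> K"
    "\<forall>f B. test_function f \<longrightarrow> 0 \<le> B \<longrightarrow>
       (\<forall>a\<le>N. \<forall>b\<le>N. \<forall>z\<in>K. norm ((dx ^^ a) ((dy ^^ b) f) z) \<le> B) \<longrightarrow> norm (u f) \<le> C * B"
    using u_bound by blast
  interpret smooth_family T W "ball z0 e" using oW X(3) by unfold_locales
  let ?r = "\<lambda>z w. 1 / (z - cnj w)"
  have d: "?r z differentiable (at w) \<and> dx (?r z) w = 1 * (?r z w * ?r z w) \<and> dy (?r z) w = - \<i> * (?r z w * ?r z w)"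
    if "z \<in> ball z0 e" "w \<in> W" for z w
  proof -
    have c: "(cnj has_derivative cnj) (at w)"
      by (rule bounded_linear_imp_has_derivative[OF bounded_linear_cnj])
    have "((\<lambda>w. inverse (z - cnj w)) has_derivative
        (\<lambda>h. - (inverse (z - cnj w) * (0 - cnj h) * inverse (z - cnj w)))) (at w)"
      by (rule Deriv.has_derivative_inverse[OF nz[OF that] has_derivative_diff[OF has_derivative_const c]])
    then have D: "(?r z has_derivative (\<lambda>h. cnj h * (?r z w * ?r z w))) (at w)"
      by (simp add: divide_inverse mult_ac)
    show ?thesis using dx_eq[OF D] D unfolding differentiable_def by auto
  qed
  have cst: "smooth_fam (\<lambda>_ _. c)" for c by (rule smooth_on_const_family[OF oW X(2,3) smooth_on_const])
  have r: "smooth_fam ?r"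
  \<comment> \<open>Both derivatives of the kernel in w are constant multiples of its square, and
    the distance bound gives 1 / e as a uniform bound of the kernel itself.\<close>
  proof (rule smooth_fam_gen[of "{?r}"])
    fix G assume G: "G \<in> {?r}"
    have "norm (?r z w) \<le> 1 / e" if "z \<in> ball z0 e" "w \<in> T" for z w
      using le_imp_inverse_le[OF ge[OF that(1) subsetD[OF X(3) that(2)]] e]
      by (simp add: norm_divide inverse_eq_divide)
    then have b: "bdd_diff G" using d G unfolding bdd_diff_def by blast
    have a: "fam_alg (ball z0 e) W smooth_fam {?r} (\<lambda>z w. c * (?r z w * ?r z w))" for c
      by (intro fam_alg.mult) (auto intro: fam_alg.gen fam_alg.base cst)
    have x: "fam_alg (ball z0 e) W smooth_fam {?r} (fdx G)"
      by (rule fam_alg.cong[OF a[of 1]]) (use d G in \<open>auto simp: fam_eq_def fdx_def\<close>)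
    have y: "fam_alg (ball z0 e) W smooth_fam {?r} (fdy G)"
      by (rule fam_alg.cong[OF a[of "- \<i>"]]) (use d G in \<open>auto simp: fam_eq_def fdy_def\<close>)
    show "bdd_diff G \<and> fam_alg (ball z0 e) W X.iter {?r} (fdx G) \<and> fam_alg (ball z0 e) W smooth_fam {?r} (fdy G)"
    proof (intro conjI b y)
      show "fam_alg (ball z0 e) W X.iter {?r} (fdx G)"
        using x by (rule fam_alg_mono) (rule smooth_fam_X)
    qed
  qed (auto intro: fam_alg.gen)
  have pw: "smooth_fam (\<lambda>p z. F p z ^ n)" if "smooth_fam F" for F n
    by (induction n) (use that cst smooth_fam_mult in auto)
  have hW: "smooth_on W h" using W0(3) unfolding W_def by (auto intro: smooth_on_subset)
  have z0b: "z0 \<in> ball z0 e" using e by simp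
  have r0: "smooth_on W (?r z)" if "z \<in> ball z0 e" for z
    using nz[OF that] oW by (intro smooth_on_divide smooth_on_minus smooth_on_const smooth_on_cnj) auto
  have bd: "\<exists>B. \<forall>z\<in>ball z0 e. norm (pairing u (\<lambda>w. h w * ?r z w ^ n * ?r z0 w ^ m)) \<le> B" for n m
  proof -
    let ?g = "\<lambda>z w. h w * ?r z w ^ n * ?r z0 w ^ m" and ?F = "\<lambda>z w. \<chi> w * (h w * ?r z w ^ n * ?r z0 w ^ m)"
    have "smooth_fam (\<lambda>z w. \<chi> w)" "smooth_fam (\<lambda>z w. h w)" "smooth_fam (\<lambda>z w. ?r z w ^ n)" "smooth_fam (\<lambda>z w. ?r z0 w ^ m)"
      by (rule smooth_on_const_family[OF oW X(2,3) smooth_on_subset[OF X(1) subset_UNIV]],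
          rule smooth_on_const_family[OF oW X(2,3) hW], rule pw[OF r],
          rule smooth_on_const_family[OF oW X(2,3) smooth_on_power[OF oW r0[OF z0b]]])
    then have "smooth_fam ?F" by (intro smooth_fam_mult)
    then have ex: "\<exists>B. \<forall>z\<in>ball z0 e. \<forall>w\<in>T. norm ((dx ^^ a) ((dy ^^ b) (?F z)) w) \<le> B" for a b
    proof -
      have "bdd_diff ((fdx ^^ a) ((fdy ^^ b) ?F))" using \<open>smooth_fam ?F\<close> by (rule smooth_fam_def[THEN iffD1, rule_format])
      then show ?thesis unfolding bdd_diff_def fdx_pow fdy_pow by (rule conjunct2)
    qed
    define Bf where "Bf a b = (SOME B. \<forall>z\<in>ball z0 e. \<forall>w\<in>T. norm ((dx ^^ a) ((dy ^^ b) (?F z)) w) \<le> B)" for a b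
    have Bf: "norm ((dx ^^ a) ((dy ^^ b) (?F z)) w) \<le> Bf a b" if "z \<in> ball z0 e" "w \<in> T" for a b z w
      using bspec[OF bspec[OF someI_ex[OF ex, of a b] that(1)] that(2)] unfolding Bf_def .
    \<comment> \<open>One bound for the finitely many derivatives in the estimate of
      \<open>u\<close>. Off \<open>T\<close> everything vanishes, so bounds on \<open>T\<close>
      suffice although the compact set \<open>K\<close> of \<open>u\<close> need not lie in
      \<open>T\<close>.\<close>
    define B where "B = (\<Sum>a\<le>N. \<Sum>b\<le>N. \<bar>Bf a b\<bar>)"
    have Bnn: "B \<ge> 0" unfolding B_def by (intro sum_nonneg) auto
    have BB: "Bf a b \<le> B" if "a \<le> N" "b \<le> N" for a b
    proof -
      have "\<bar>Bf a b\<bar> \<le> (\<Sum>b\<le>N. \<bar>Bf a b\<bar>)" using that by (intro member_le_sum) auto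
      also have "\<dots> \<le> B" unfolding B_def
        using that by (intro member_le_sum[of a "{..N}" "\<lambda>a. \<Sum>b\<le>N. \<bar>Bf a b\<bar>"] sum_nonneg) auto
      finally show ?thesis by linarith
    qed
    have "norm (pairing u (?g z)) \<le> C * B" if z: "z \<in> ball z0 e" for z
    proof -
      have g: "smooth_on W (?g z)" by (intro smooth_on_mult smooth_on_power hW r0 z z0b oW)
      have "pairing u (?g z) = u (?F z)" by (rule X(6)[OF g])
      moreover have "norm (u (?F z)) \<le> C * B"
      proof (rule K(3)[rule_format, OF test_function_UNIV[OF X(5)[OF g]] Bnn])
        fix a b w assume ab: "a \<le> N" "b \<le> N"
        show "norm ((dx ^^ a) ((dy ^^ b) (?F z)) w) \<le> B"
        proof (cases "w \<in> T")
          case True then show ?thesis using Bf[OF z True] BB[OF ab] by (meson order_trans)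
        next
          case False
          have "open (- T)" using X(2) compact_imp_closed by blast
          then have "(dx ^^ a) ((dy ^^ b) (?F z)) w = (dx ^^ a) ((dy ^^ b) (\<lambda>_. 0)) w"
            by (rule dxy_cong_pow) (use False X(4) in auto)
          then show ?thesis using Bnn by (simp add: dxy_zero)
        qed
      qed
      ultimately show ?thesis by simp
    qed
    then show ?thesis by (intro exI[of _ "C * B"] ballI)
  qed
  have "cnj w \<noteq> z" if "z \<in> ball z0 e" "w \<in> supp u" for z w
    using nz[OF that(1)] sW that(2) by auto
  then show ?thesis by (intro exI[of _ e] conjI allI e bd ballI)
qed

end

context circle_distribution
begin

lemma smooth_near_kernel:
  assumes "\<And>w. w \<in> supp u \<Longrightarrow> cnj w \<noteq> z"
  shows "smooth_near u (\<lambda>w. 1 / (z - cnj w))"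
  using assms by (intro smooth_near_divide smooth_near_diff smooth_near_const smooth_near_cnj) auto

text \<open>Identities between fractions hold where the denominators, collected in \<open>k\<close>,
  do not vanish; as \<open>k\<close> has no zero on the support, this includes a neighbourhood of
  it.\<close>

lemma pairing_cong_supp:
  assumes "smooth_near u f" "smooth_near u g" "\<And>w. w \<in> supp u \<Longrightarrow> k w \<noteq> 0" "smooth_near u k"
    "\<And>w. w \<noteq> 0 \<Longrightarrow> k w \<noteq> 0 \<Longrightarrow> f w = g w"
  shows "pairing u f = pairing u g"
proof -
  obtain W where W: "open W" "supp u \<subseteq> W" "smooth_on W k" using assms(4) unfolding smooth_near_def by blast
  have c: "continuous_on W k"
    using W(3)[unfolded smooth_on_def, rule_format, of _ 0 0]
    by (intro continuous_at_imp_continuous_on ballI differentiable_imp_continuous_within) simp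
  show ?thesis
  proof (rule pairing_cong)
    show "open (W \<inter> k -` (- {0}) \<inter> - {0})"
      by (intro open_Int continuous_open_preimage c W(1)) auto
    show "supp u \<subseteq> W \<inter> k -` (- {0}) \<inter> - {0}" using W(2) assms(3) supp_nz by auto
  qed (use assms(5) in auto)
qed

text \<open>The hypothesis is the resolvent identity for r = 1 / (z - cnj w), r0 = 1 / (z0 - cnj w)
  and d = z - z0. The left side is the first-order Taylor remainder of the n-th power of the kernel
  in z; using the formula for a difference of powers twice brings out the factor d^2
  explicitly.\<close>

lemma power_remainder:
  fixes r r0 d :: complex
  assumes "r - r0 = - d * (r * r0)"
  shows "r ^ n - r0 ^ n + of_nat n * d * r0 ^ (n + 1)
     = d\<^sup>2 * (\<Sum>i<n. \<Sum>j<Suc i. r ^ (j + 1) * r0 ^ (n + 1 - j))"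
proof -
  have *: "r ^ n - r0 ^ n = - d * (\<Sum>i<n. r ^ (i + 1) * r0 ^ (n - i))" for n
  proof -
    have "r ^ n - r0 ^ n = (r - r0) * (\<Sum>i<n. r0 ^ (n - Suc i) * r ^ i)"
      by (rule power_diff_sumr2)
    also have "\<dots> = - d * (\<Sum>i<n. (r * r0) * (r0 ^ (n - Suc i) * r ^ i))"
      unfolding assms by (simp add: sum_distrib_left mult.assoc)
    also have "(\<Sum>i<n. (r * r0) * (r0 ^ (n - Suc i) * r ^ i)) = (\<Sum>i<n. r ^ (i + 1) * r0 ^ (n - i))"
    proof (rule sum.cong)
      fix i assume "i \<in> {..<n}"
      then have "r0 ^ (n - i) = r0 * r0 ^ (n - Suc i)" by (metis Suc_diff_Suc lessThan_iff power_Suc)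
      then show "(r * r0) * (r0 ^ (n - Suc i) * r ^ i) = r ^ (i + 1) * r0 ^ (n - i)" by simp
    qed simp
    finally show ?thesis .
  qed
  have "r ^ n - r0 ^ n + of_nat n * d * r0 ^ (n + 1)
      = - d * (\<Sum>i<n. r ^ (i + 1) * r0 ^ (n - i) - r0 ^ (n + 1))"
    unfolding * by (simp add: sum_subtractf algebra_simps)
  also have "(\<Sum>i<n. r ^ (i + 1) * r0 ^ (n - i) - r0 ^ (n + 1))
      = (\<Sum>i<n. - d * (\<Sum>j<Suc i. r ^ (j + 1) * r0 ^ (n + 1 - j)))"
  proof (rule sum.cong)
    fix i assume i: "i \<in> {..<n}"
    have "r ^ (i + 1) * r0 ^ (n - i) - r0 ^ (n + 1) = r0 ^ (n - i) * (r ^ (i + 1) - r0 ^ (i + 1))"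
      using i by (simp add: right_diff_distrib mult.commute flip: power_add power_Suc)
    also have "\<dots> = - d * (\<Sum>j<Suc i. r0 ^ (n - i) * (r ^ (j + 1) * r0 ^ (Suc i - j)))"
      using *[of "Suc i"] by (simp only: Suc_eq_plus1 sum_distrib_left mult.left_commute[of _ "- d"])
    also have "(\<Sum>j<Suc i. r0 ^ (n - i) * (r ^ (j + 1) * r0 ^ (Suc i - j)))
      = (\<Sum>j<Suc i. r ^ (j + 1) * r0 ^ (n + 1 - j))"
    proof (rule sum.cong)
      fix j assume "j \<in> {..<Suc i}"
      then have "r0 ^ (n + 1 - j) = r0 ^ (n - i) * r0 ^ (Suc i - j)"
        using i by (simp flip: power_add)
      then show "r0 ^ (n - i) * (r ^ (j + 1) * r0 ^ (Suc i - j)) = r ^ (j + 1) * r0 ^ (n + 1 - j)"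
        by simp
    qed simp
    finally show "r ^ (i + 1) * r0 ^ (n - i) - r0 ^ (n + 1)
      = - d * (\<Sum>j<Suc i. r ^ (j + 1) * r0 ^ (n + 1 - j))" .
  qed simp
  finally show ?thesis by (simp add: sum_distrib_left power2_eq_square mult.assoc)
qed

text \<open>By linearity the exact remainder formula passes through the pairing. It leaves (z -
  z0)^2 times a finite sum of pairings that stay bounded near z0.\<close>

lemma pairing_kernel_deriv:
  assumes h: "smooth_near u h" and z0: "\<And>w. w \<in> supp u \<Longrightarrow> cnj w \<noteq> z0"
  shows "((\<lambda>z. pairing u (\<lambda>w. h w * (1 / (z - cnj w)) ^ n)) has_field_derivative
     - of_nat n * pairing u (\<lambda>w. h w * (1 / (z0 - cnj w)) ^ (n + 1))) (at z0)"
proof -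
  from kernel_bound[OF h z0] obtain e where E: "e > 0 \<and> (\<forall>z\<in>ball z0 e. \<forall>w\<in>supp u. cnj w \<noteq> z) \<and>
      (\<forall>n m. \<exists>B. \<forall>z\<in>ball z0 e. norm (pairing u (\<lambda>w. h w * (1 / (z - cnj w)) ^ n * (1 / (z0 - cnj w)) ^ m)) \<le> B)"
    by (rule exE)
  then have e: "e > 0" "\<And>z w. z \<in> ball z0 e \<Longrightarrow> w \<in> supp u \<Longrightarrow> cnj w \<noteq> z" by auto
  have bd: "\<exists>B. \<forall>z\<in>ball z0 e. norm (pairing u (\<lambda>w. h w * (1 / (z - cnj w)) ^ n * (1 / (z0 - cnj w)) ^ m)) \<le> B" for n m
    using E[THEN conjunct2, THEN conjunct2] by (elim allE)
  let ?r = "\<lambda>z w. 1 / (z - cnj w)"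
  let ?P = "\<lambda>n m z. pairing u (\<lambda>w. h w * ?r z w ^ n * ?r z0 w ^ m)"
  define B where "B n m = (SOME B. \<forall>z\<in>ball z0 e. norm (?P n m z) \<le> B)" for n m
  have B: "norm (?P n m z) \<le> B n m" if "z \<in> ball z0 e" for n m z
    using bspec[OF someI_ex[OF bd, of n m] that] unfolding B_def .
  let ?F = "\<lambda>z. pairing u (\<lambda>w. h w * ?r z w ^ n)"
  let ?D = "pairing u (\<lambda>w. h w * ?r z0 w ^ (n + 1))"
  have nk: "smooth_near u (?r z)" if "z \<in> ball z0 e" for z
    by (rule smooth_near_kernel) (use e(2) that in auto)
  have z0b: "z0 \<in> ball z0 e" using e by simp
  have id: "?F z - ?F z0 + of_nat n * (z - z0) * ?D
      = (z - z0)\<^sup>2 * (\<Sum>i<n. \<Sum>j<Suc i. ?P (j + 1) (n + 1 - j) z)" if z: "z \<in> ball z0 e" for z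
  proof -
    let ?d = "z - z0"
    have n1: "smooth_near u (\<lambda>w. h w * ?r z w ^ a * ?r z0 w ^ b)" for a b
      by (intro smooth_near_mult smooth_near_power nk z z0b h)
    have n2: "smooth_near u (\<lambda>w. h w * ?r z w ^ a)" "smooth_near u (\<lambda>w. h w * ?r z0 w ^ a)" for a
      by (intro smooth_near_mult smooth_near_power nk z z0b h)+
    have "(z - z0)\<^sup>2 * (\<Sum>i<n. \<Sum>j<Suc i. ?P (j + 1) (n + 1 - j) z)
       = pairing u (\<lambda>w. (z - z0)\<^sup>2 * (\<Sum>i<n. \<Sum>j<Suc i. h w * ?r z w ^ (j + 1) * ?r z0 w ^ (n + 1 - j)))"
      by (simp only: pairing_sum[OF n1] pairing_sum[OF smooth_near_sum[OF n1]] pairing_scale[OF smooth_near_sum[OF smooth_near_sum[OF n1]]])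
    also have "\<dots> = pairing u (\<lambda>w. h w * ?r z w ^ n - h w * ?r z0 w ^ n + of_nat n * (z - z0) * (h w * ?r z0 w ^ (n + 1)))"
    proof (rule pairing_cong_supp[where k = "\<lambda>w. (z - cnj w) * (z0 - cnj w)"])
      show "smooth_near u (\<lambda>w. (z - z0)\<^sup>2 * (\<Sum>i<n. \<Sum>j<Suc i. h w * ?r z w ^ (j + 1) * ?r z0 w ^ (n + 1 - j)))"
        by (intro smooth_near_mult smooth_near_const smooth_near_sum n1[unfolded mult.assoc] nk smooth_near_power z z0b h)
      show "smooth_near u (\<lambda>w. h w * ?r z w ^ n - h w * ?r z0 w ^ n + of_nat n * (z - z0) * (h w * ?r z0 w ^ (n + 1)))"
        by (intro smooth_near_add smooth_near_diff smooth_near_mult smooth_near_const smooth_near_power nk z z0b h)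
      show "smooth_near u (\<lambda>w. (z - cnj w) * (z0 - cnj w))"
        by (intro smooth_near_mult smooth_near_diff smooth_near_const smooth_near_cnj)
      show "(z - cnj w) * (z0 - cnj w) \<noteq> 0" if "w \<in> supp u" for w
        using e(2)[OF z that] e(2)[OF z0b that] by auto
      fix w assume "(z - cnj w) * (z0 - cnj w) \<noteq> 0"
      then have nz: "z - cnj w \<noteq> 0" "z0 - cnj w \<noteq> 0" by auto
      have "1 / a - 1 / b = - (a - b) * (1 / a * (1 / b))" if "a \<noteq> 0" "b \<noteq> 0" for a b :: complex
        using that by (simp add: field_simps)
      from this[OF nz] have "?r z w - ?r z0 w = - (z - z0) * (?r z w * ?r z0 w)" by simp
      from power_remainder[OF this, of n]
      have "h w * (?r z w ^ n - ?r z0 w ^ n + of_nat n * (z - z0) * ?r z0 w ^ (n + 1))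
         = h w * ((z - z0)\<^sup>2 * (\<Sum>i<n. \<Sum>j<Suc i. ?r z w ^ (j + 1) * ?r z0 w ^ (n + 1 - j)))" by simp
      then show "(z - z0)\<^sup>2 * (\<Sum>i<n. \<Sum>j<Suc i. h w * ?r z w ^ (j + 1) * ?r z0 w ^ (n + 1 - j))
        = h w * ?r z w ^ n - h w * ?r z0 w ^ n + of_nat n * (z - z0) * (h w * ?r z0 w ^ (n + 1))"
        by (simp only: sum_distrib_left algebra_simps)
    qed
    also have "\<dots> = ?F z - ?F z0 + of_nat n * (z - z0) * ?D"
      by (simp only: pairing_add[OF smooth_near_diff[OF n2] smooth_near_mult[OF smooth_near_const n2(2)]]
          pairing_minus[OF n2] pairing_scale[OF n2(2)])
    finally show ?thesis by simp
  qed
  define BB where "BB = (\<Sum>i<n. \<Sum>j<Suc i. B (j + 1) (n + 1 - j))"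
  have "((\<lambda>z. (?F z - ?F z0) / (z - z0) - (- of_nat n * ?D)) \<longlongrightarrow> 0) (at z0)"
  proof (rule Lim_null_comparison)
    have "\<forall>\<^sub>F z in at z0. z \<in> ball z0 e - {z0}"
      using e(1) by (intro eventually_at_in_open) auto
    then show "\<forall>\<^sub>F z in at z0. norm ((?F z - ?F z0) / (z - z0) - (- of_nat n * ?D)) \<le> norm (z - z0) * BB"
    proof eventually_elim
      case (elim z)
      then have z: "z \<in> ball z0 e" "z \<noteq> z0" by auto
        have "(?F z - ?F z0) / (z - z0) - (- of_nat n * ?D)
           = (z - z0) * (\<Sum>i<n. \<Sum>j<Suc i. ?P (j + 1) (n + 1 - j) z)"
          using id[OF z(1)] z(2) by (simp add: field_simps power2_eq_square)
        moreover have "norm (\<Sum>i<n. \<Sum>j<Suc i. ?P (j + 1) (n + 1 - j) z) \<le> BB"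
          unfolding BB_def by (intro sum_norm_le B z(1))
        ultimately show ?case by (simp only: norm_mult mult_left_mono norm_ge_zero)
    qed
    show "((\<lambda>z. norm (z - z0) * BB) \<longlongrightarrow> 0) (at z0)"
      by (auto intro!: tendsto_eq_intros)
  qed
  then show ?thesis unfolding has_field_derivative_iff by (rule LIM_zero_cancel)
qed

lemma open_compl_image: "open (- (cnj ` supp u))"
  using compact_continuous_image[OF continuous_on_cnj[OF continuous_on_id] compact_supp] compact_imp_closed
  by (blast intro: open_Compl)

text \<open>The induction proves the formula on the whole open complement of the conjugated support,
  since the next derivative depends on the formula near the point.\<close>

lemma pairing_kernel_higher_deriv:
  assumes h: "smooth_near u h" and z: "\<And>w. w \<in> supp u \<Longrightarrow> cnj w \<noteq> z"
  shows "(deriv ^^ k) (\<lambda>z. pairing u (\<lambda>w. h w * (1 / (z - cnj w)))) z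
     = (-1) ^ k * fact k * pairing u (\<lambda>w. h w * (1 / (z - cnj w)) ^ (k + 1))"
proof -
  let ?U = "- (cnj ` supp u)"
  have "\<forall>z\<in>?U. (deriv ^^ k) (\<lambda>z. pairing u (\<lambda>w. h w * (1 / (z - cnj w)))) z
     = (-1) ^ k * fact k * pairing u (\<lambda>w. h w * (1 / (z - cnj w)) ^ (k + 1))"
  proof (induction k)
    case (Suc k)
    show ?case
    proof
      fix z assume z: "z \<in> ?U"
      have "((\<lambda>z. (-1) ^ k * fact k * pairing u (\<lambda>w. h w * (1 / (z - cnj w)) ^ (k + 1))) has_field_derivative
          (-1) ^ k * fact k * (- of_nat (k + 1) * pairing u (\<lambda>w. h w * (1 / (z - cnj w)) ^ (k + 1 + 1)))) (at z)"
        by (rule DERIV_cmult[OF pairing_kernel_deriv[OF h]]) (use z in auto)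
      then have "((deriv ^^ k) (\<lambda>z. pairing u (\<lambda>w. h w * (1 / (z - cnj w)))) has_field_derivative
          (-1) ^ k * fact k * (- of_nat (k + 1) * pairing u (\<lambda>w. h w * (1 / (z - cnj w)) ^ (k + 1 + 1)))) (at z)"
        by (rule has_field_derivative_transform_within_open[OF _ open_compl_image z]) (use Suc in simp)
      from DERIV_imp_deriv[OF this]
      show "(deriv ^^ Suc k) (\<lambda>z. pairing u (\<lambda>w. h w * (1 / (z - cnj w)))) z
         = (-1) ^ Suc k * fact (Suc k) * pairing u (\<lambda>w. h w * (1 / (z - cnj w)) ^ (Suc k + 1))"
        by (simp add: algebra_simps)
    qed
  qed simp
  then show ?thesis using z by blast
qed

end

section \<open>The Toeplitz condition as a congruence\<close>

locale toeplitz_distribution = circle_distribution +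
  assumes toeplitz: "toeplitz_functional u"
begin

lemma pairing_cnj_mult:
  assumes "smooth_near u h"
  shows "pairing u (\<lambda>w. cnj w * h w) = pairing u (\<lambda>w. h w / w)"
proof -
  obtain f V where f: "smooth_on UNIV f" "open V" "supp u \<subseteq> V" "\<And>z. z \<in> V \<Longrightarrow> f z = h z"
    using smooth_near_test[OF assms] by blast
  have "pairing u (\<lambda>w. cnj w * h w) = u (\<lambda>w. cnj w * f w)"
    by (rule pairing_eq[OF test_function_UNIV[OF smooth_on_mult[OF open_UNIV smooth_on_cnj f(1)]] f(2,3)]) (use f(4) in auto)
  moreover have "pairing u (\<lambda>w. h w / w) = u (\<lambda>w. f w / w)"
  proof (rule pairing_eq[OF _ f(2,3)])
    show "test_function (\<lambda>w. f w / w)"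
      unfolding test_function_smooth by (intro smooth_on_divide smooth_on_id smooth_on_subset[OF f(1)]) auto
  qed (use f(4) in auto)
  ultimately show ?thesis
    using toeplitz test_function_UNIV[OF f(1)] unfolding toeplitz_functional_def by auto
qed

text \<open>Equality modulo the ideal generated by \<open>cnj w - 1 / w\<close>.\<close>

definition circle_eq :: "(complex \<Rightarrow> complex) \<Rightarrow> (complex \<Rightarrow> complex) \<Rightarrow> bool" where
  "circle_eq a b \<longleftrightarrow> smooth_near u a \<and> smooth_near u b \<and>
     (\<forall>g. smooth_near u g \<longrightarrow> pairing u (\<lambda>w. g w * a w) = pairing u (\<lambda>w. g w * b w))"

lemma circle_eq_near: "circle_eq a b \<Longrightarrow> smooth_near u a" "circle_eq a b \<Longrightarrow> smooth_near u b"
  unfolding circle_eq_def by auto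

lemma ceqD: "circle_eq a b \<Longrightarrow> smooth_near u g \<Longrightarrow> pairing u (\<lambda>w. g w * a w) = pairing u (\<lambda>w. g w * b w)"
  unfolding circle_eq_def by blast

lemma circle_eq_refl: "smooth_near u a \<Longrightarrow> circle_eq a a"
  unfolding circle_eq_def by blast
lemma circle_eq_sym: "circle_eq a b \<Longrightarrow> circle_eq b a"
  unfolding circle_eq_def by metis

text \<open>The arbitrary multiplier in the definition absorbs the other factor, so the two
  replacements can be made one after the other.\<close>

lemma circle_eq_mult:
  assumes "circle_eq a b" "circle_eq c d"
  shows "circle_eq (\<lambda>w. a w * c w) (\<lambda>w. b w * d w)"
  unfolding circle_eq_def
proof (intro conjI allI impI smooth_near_mult circle_eq_near[OF assms(1)] circle_eq_near[OF assms(2)])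
  fix g assume g: "smooth_near u g"
  have "pairing u (\<lambda>w. (g w * c w) * a w) = pairing u (\<lambda>w. (g w * c w) * b w)"
    by (intro ceqD assms smooth_near_mult g circle_eq_near[OF assms(2)])
  moreover have "pairing u (\<lambda>w. (g w * b w) * c w) = pairing u (\<lambda>w. (g w * b w) * d w)"
    by (intro ceqD assms smooth_near_mult g circle_eq_near[OF assms(1)])
  ultimately show "pairing u (\<lambda>w. g w * (a w * c w)) = pairing u (\<lambda>w. g w * (b w * d w))"
    by (simp add: mult_ac)
qed

lemma circle_eq_add:
  assumes "circle_eq a b" "circle_eq c d"
  shows "circle_eq (\<lambda>w. a w + c w) (\<lambda>w. b w + d w)"
  unfolding circle_eq_def
proof (intro conjI allI impI smooth_near_add circle_eq_near[OF assms(1)] circle_eq_near[OF assms(2)])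
  fix g assume g: "smooth_near u g"
  have n: "smooth_near u (\<lambda>w. g w * a w)" "smooth_near u (\<lambda>w. g w * b w)" "smooth_near u (\<lambda>w. g w * c w)" "smooth_near u (\<lambda>w. g w * d w)"
    by (intro smooth_near_mult g circle_eq_near[OF assms(1)] circle_eq_near[OF assms(2)])+
  show "pairing u (\<lambda>w. g w * (a w + c w)) = pairing u (\<lambda>w. g w * (b w + d w))"
    using ceqD[OF assms(1) g] ceqD[OF assms(2) g] pairing_add[OF n(1,3)] pairing_add[OF n(2,4)]
    by (simp add: distrib_left)
qed

lemma circle_eq_const: "circle_eq (\<lambda>_. c) (\<lambda>_. c)"
  by (intro circle_eq_refl smooth_near_const)

lemma circle_eq_sum: "(\<And>i. i \<in> A \<Longrightarrow> circle_eq (f i) (g i)) \<Longrightarrow> circle_eq (\<lambda>w. \<Sum>i\<in>A. f i w) (\<lambda>w. \<Sum>i\<in>A. g i w)"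
  by (induction A rule: infinite_finite_induct) (auto intro: circle_eq_const circle_eq_add)

lemma circle_eq_power: "circle_eq f g \<Longrightarrow> circle_eq (\<lambda>w. f w ^ n) (\<lambda>w. g w ^ n)"
  by (induction n) (auto intro: circle_eq_const circle_eq_mult)

text \<open>Near the support 1 / a equals (1 / a) (1 / b) b; replacing the last factor b by a gives
  1 / b.\<close>

lemma circle_eq_inverse:
  assumes "circle_eq a b" "\<And>w. w \<in> supp u \<Longrightarrow> a w \<noteq> 0" "\<And>w. w \<in> supp u \<Longrightarrow> b w \<noteq> 0"
  shows "circle_eq (\<lambda>w. inverse (a w)) (\<lambda>w. inverse (b w))"
  unfolding circle_eq_def
proof (intro conjI allI impI)
  show n: "smooth_near u (\<lambda>w. inverse (a w))" "smooth_near u (\<lambda>w. inverse (b w))"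
    using assms by (auto intro: smooth_near_inverse circle_eq_near)
  fix g assume g: "smooth_near u g"
  have nn: "smooth_near u (\<lambda>w. g w * inverse (a w) * inverse (b w))" by (intro smooth_near_mult g n)
  have "pairing u (\<lambda>w. g w * inverse (a w)) = pairing u (\<lambda>w. (g w * inverse (a w) * inverse (b w)) * b w)"
    by (rule pairing_cong_supp[of _ _ "\<lambda>w. b w"])
       (use assms n g in \<open>auto intro!: smooth_near_mult circle_eq_near(2)[OF assms(1)]\<close>)
  also have "\<dots> = pairing u (\<lambda>w. (g w * inverse (a w) * inverse (b w)) * a w)"
    by (rule ceqD[OF circle_eq_sym[OF assms(1)] nn])
  also have "\<dots> = pairing u (\<lambda>w. g w * inverse (b w))"
    by (rule pairing_cong_supp[of _ _ "\<lambda>w. a w"])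
       (use assms n g in \<open>auto intro!: smooth_near_mult circle_eq_near(1)[OF assms(1)]\<close>)
  finally show "pairing u (\<lambda>w. g w * inverse (a w)) = pairing u (\<lambda>w. g w * inverse (b w))" .
qed

text \<open>The Toeplitz hypothesis is the congruence of \<open>cnj w\<close> and 1 / w. Inverting
  both sides gives the form in which reciprocal polynomials meet it.\<close>

lemma circle_eq_inv_cnj: "circle_eq (\<lambda>w. inverse (cnj w)) (\<lambda>w. w)"
proof -
  have "circle_eq cnj (\<lambda>w. inverse w)"
    unfolding circle_eq_def
  proof (intro conjI allI impI smooth_near_cnj smooth_near_inverse smooth_near_id supp_nz)
    fix g assume "smooth_near u g"
    from pairing_cnj_mult[OF this]
    show "pairing u (\<lambda>w. g w * cnj w) = pairing u (\<lambda>w. g w * inverse w)"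
      by (simp add: divide_inverse mult.commute)
  qed
  from circle_eq_inverse[OF this] show ?thesis using supp_nz by auto
qed

lemma circle_eq_powi: 
  assumes "circle_eq a b" "\<And>w. w \<in> supp u \<Longrightarrow> a w \<noteq> 0" "\<And>w. w \<in> supp u \<Longrightarrow> b w \<noteq> 0"
  shows "circle_eq (\<lambda>w. a w powi k) (\<lambda>w. b w powi k)"
  unfolding power_int_def
  by (cases "k \<ge> 0") (auto intro!: circle_eq_power circle_eq_inverse[OF assms] assms(1))

end

section \<open>The conjugate distribution\<close>

text \<open>Its zero order form is that of u with the arguments exchanged and the value conjugated,
  so the two biorthogonal families trade places.\<close>

definition conj_functional :: "((complex \<Rightarrow> complex) \<Rightarrow> complex) \<Rightarrow> (complex \<Rightarrow> complex) \<Rightarrow> complex" where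
  "conj_functional u h = cnj (u (\<lambda>z. cnj (h z)))"

lemma conj_functional_conj: "conj_functional (conj_functional u) = u"
  by (auto simp: conj_functional_def)

lemma test_function_cnj: "test_function f \<Longrightarrow> test_function (\<lambda>z. cnj (f z))"
  unfolding test_function_smooth by (rule smooth_on_cnj_comp) auto

lemma vanishes_on_conj: "vanishes_on u V \<Longrightarrow> vanishes_on (conj_functional u) V"
  unfolding vanishes_on_def conj_functional_def
  using test_function_cnj by auto

lemma supp_conj: "supp (conj_functional u) = supp u"
proof -
  have "vanishes_on (conj_functional u) V = vanishes_on u V" for V
    using vanishes_on_conj[of u V] vanishes_on_conj[of "conj_functional u" V]
    by (auto simp: conj_functional_conj)
  then show ?thesis unfolding supp_def by simp
qed

lemma smooth_near_conj_functional: "smooth_near (conj_functional u) = smooth_near u"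
  unfolding smooth_near_def supp_conj ..

lemma circle_distribution_conj:
  assumes "circle_distribution u"
  shows "circle_distribution (conj_functional u)"
proof -
  interpret circle_distribution u by fact
  obtain K n C where K: "compact K" "0 \<notin> K" "\<forall>f B. test_function f \<longrightarrow> 0 \<le> B \<longrightarrow>
           (\<forall>a\<le>n. \<forall>b\<le>n. \<forall>z\<in>K. norm ((dx ^^ a) ((dy ^^ b) f) z) \<le> B) \<longrightarrow>
           norm (u f) \<le> C * B"
    using u_bound by blast
  show ?thesis
  proof
    show "supp (conj_functional u) \<subseteq> sphere 0 1" using supp_circle by (simp add: supp_conj)
    show "compactly_supported_distribution (conj_functional u)"
      unfolding compactly_supported_distribution_def
    proof (intro conjI allI impI)
      fix f g assume "test_function f" "test_function g"
      then show "conj_functional u (\<lambda>z. f z + g z) = conj_functional u f + conj_functional u g"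
        using u_add[OF test_function_cnj test_function_cnj] unfolding conj_functional_def by simp
    next
      fix c f assume "test_function f"
      then show "conj_functional u (\<lambda>z. c * f z) = c * conj_functional u f"
        using u_scale[OF test_function_cnj] unfolding conj_functional_def by simp
    next
      show "\<exists>K n C. compact K \<and> 0 \<notin> K \<and>
        (\<forall>f B. test_function f \<longrightarrow> 0 \<le> B \<longrightarrow>
           (\<forall>a\<le>n. \<forall>b\<le>n. \<forall>z\<in>K. norm ((dx ^^ a) ((dy ^^ b) f) z) \<le> B) \<longrightarrow>
           norm (conj_functional u f) \<le> C * B)"
      proof (intro exI conjI allI impI)
        fix f B assume f: "test_function f" "0 \<le> B" "\<forall>a\<le>n. \<forall>b\<le>n. \<forall>z\<in>K. norm ((dx ^^ a) ((dy ^^ b) f) z) \<le> B"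
        have "\<forall>a\<le>n. \<forall>b\<le>n. \<forall>z\<in>K. norm ((dx ^^ a) ((dy ^^ b) (\<lambda>w. cnj (f w))) z) \<le> B"
        proof (intro allI impI ballI)
          fix a b z assume ab: "a \<le> n" "b \<le> n" "z \<in> K"
          have "z \<in> - {0}" using ab(3) K(2) by auto
          then have "(dx ^^ a) ((dy ^^ b) (\<lambda>w. cnj (f w))) z = cnj ((dx ^^ a) ((dy ^^ b) f) z)"
            by (intro smooth_on_cnj_comp_eq[of "- {0}"] f(1)[unfolded test_function_smooth]) auto
          then show "norm ((dx ^^ a) ((dy ^^ b) (\<lambda>w. cnj (f w))) z) \<le> B" using f(3) ab by simp
        qed
        then have "norm (u (\<lambda>w. cnj (f w))) \<le> C * B"
          using K(3) test_function_cnj[OF f(1)] f(2) by blast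
        then show "norm (conj_functional u f) \<le> C * B" by (simp add: conj_functional_def)
      qed (rule K)+
    qed
  qed
qed

lemma toeplitz_distribution_conj:
  assumes "toeplitz_distribution u"
  shows "toeplitz_distribution (conj_functional u)"
proof -
  interpret toeplitz_distribution u by fact
  interpret c: circle_distribution "conj_functional u"
    by (rule circle_distribution_conj) unfold_locales
  show ?thesis
  proof
    show "toeplitz_functional (conj_functional u)"
      unfolding toeplitz_functional_def
    proof (intro allI impI)
      fix f assume f: "test_function f"
      \<comment> \<open>Chosen so that \<open>cnj z * ?g z\<close> and \<open>?g z / z\<close> are
        the conjugates of \<open>cnj z * f z\<close> and \<open>f z / z\<close>.\<close>
      let ?g = "\<lambda>z. z * cnj (f z) / cnj z"
      have g: "test_function ?g"
        using test_function_cnj[OF f] unfolding test_function_smooth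
        by (intro smooth_on_divide smooth_on_mult smooth_on_id smooth_on_cnj) auto
      have "u (\<lambda>z. cnj z * ?g z) = u (\<lambda>z. ?g z / z)"
        using toeplitz g unfolding toeplitz_functional_def by blast
      moreover have "(\<lambda>z. cnj z * ?g z) = (\<lambda>z. cnj (cnj z * f z))" by (auto simp: fun_eq_iff)
      moreover have "(\<lambda>z. ?g z / z) = (\<lambda>z. cnj (f z / z))" by (auto simp: fun_eq_iff)
      ultimately show "conj_functional u (\<lambda>z. cnj z * f z) = conj_functional u (\<lambda>z. f z / z)"
        unfolding conj_functional_def by simp
    qed
  qed
qed

lemma (in circle_distribution) pairing_conj_functional:
  assumes "smooth_near u h"
  shows "pairing (conj_functional u) h = cnj (pairing u (\<lambda>z. cnj (h z)))"
proof -
  interpret c: circle_distribution "conj_functional u"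
    by (rule circle_distribution_conj) unfold_locales
  obtain f V where f: "smooth_on UNIV f" "open V" "supp u \<subseteq> V" "\<And>z. z \<in> V \<Longrightarrow> f z = h z"
    using smooth_near_test[OF assms] by blast
  have "pairing (conj_functional u) h = conj_functional u f"
    by (rule c.pairing_eq[OF test_function_UNIV[OF f(1)] f(2)]) (use f(3,4) in \<open>auto simp: supp_conj\<close>)
  moreover have "pairing u (\<lambda>z. cnj (h z)) = u (\<lambda>z. cnj (f z))"
    by (rule pairing_eq[OF test_function_UNIV[OF smooth_on_cnj_comp[OF open_UNIV f(1)]] f(2,3)]) (use f(4) in auto)
  ultimately show ?thesis by (simp add: conj_functional_def)
qed

section \<open>Laurent polynomials\<close>

lemma lcoeff_lconj: "lcoeff (lconj L) j = cnj (lcoeff L j)"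
  unfolding lcoeff_def lconj_def by (simp add: Poly_Mapping.map.rep_eq when_def)

lemma lcoeff_lrecip: "lcoeff (lrecip L) j = cnj (lcoeff L (- j))"
  unfolding lcoeff_def lrecip_def
  by (simp add: Poly_Mapping.map_key.rep_eq lcoeff_lconj[unfolded lcoeff_def])

lemma lcoeff_eqI: "(\<And>j. lcoeff L j = lcoeff M j) \<Longrightarrow> L = M"
  unfolding lcoeff_def by (rule poly_mapping_eqI)

lemma keys_lcoeff: "j \<in> Poly_Mapping.keys L \<longleftrightarrow> lcoeff L j \<noteq> 0"
  unfolding lcoeff_def by (simp add: in_keys_iff)

lemma lrecip_lrecip: "lrecip (lrecip L) = L"
  by (rule lcoeff_eqI) (simp add: lcoeff_lrecip)

lemma leval_superset:
  assumes "finite S" "Poly_Mapping.keys L \<subseteq> S"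
  shows "leval L z = (\<Sum>j\<in>S. lcoeff L j * z powi j)"
  unfolding leval_def using assms by (intro sum.mono_neutral_left) (auto simp: keys_lcoeff)

lemma keys_lrecip: "Poly_Mapping.keys (lrecip L) = uminus ` Poly_Mapping.keys L"
proof (rule equalityI; rule subsetI)
  fix j assume "j \<in> Poly_Mapping.keys (lrecip L)"
  then have "- j \<in> Poly_Mapping.keys L" by (simp add: keys_lcoeff lcoeff_lrecip)
  then show "j \<in> uminus ` Poly_Mapping.keys L" by (rule rev_image_eqI) simp
qed (auto simp: keys_lcoeff lcoeff_lrecip)

lemma leval_lconj: "leval (lconj L) z = cnj (leval L (cnj z))"
proof -
  have "Poly_Mapping.keys (lconj L) = Poly_Mapping.keys L"
    by (auto simp: keys_lcoeff lcoeff_lconj)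
  then show ?thesis unfolding leval_def by (simp add: lcoeff_lconj)
qed

lemma leval_lrecip: "leval (lrecip L) z = cnj (leval L (inverse (cnj z)))"
proof -
  have "leval (lrecip L) z = (\<Sum>j\<in>Poly_Mapping.keys L. lcoeff (lrecip L) (- j) * z powi (- j))"
    unfolding leval_def keys_lrecip by (subst sum.reindex) auto
  then show ?thesis unfolding leval_def
    by (simp add: lcoeff_lrecip power_int_minus power_int_inverse)
qed

lemma prepared_lrecip: "prepared N L \<Longrightarrow> prepared N (lrecip L)"
  unfolding prepared_def by (auto simp: keys_lrecip lcoeff_lrecip)

lemma leval_add: "leval (L + M) z = leval L z + leval M z"
proof -
  let ?S = "Poly_Mapping.keys L \<union> Poly_Mapping.keys M"
  have "leval (L + M) z = (\<Sum>j\<in>?S. lcoeff (L + M) j * z powi j)"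
    by (rule leval_superset) (auto simp: keys_add)
  also have "\<dots> = (\<Sum>j\<in>?S. lcoeff L j * z powi j) + (\<Sum>j\<in>?S. lcoeff M j * z powi j)"
    by (simp add: lcoeff_def lookup_add distrib_right sum.distrib)
  also have "\<dots> = leval L z + leval M z"
    by (simp add: leval_superset[of ?S])
  finally show ?thesis .
qed

lemma leval_0: "leval 0 z = 0"
  by (simp add: leval_def)

lemma leval_sum: "leval (\<Sum>i\<in>A. L i) z = (\<Sum>i\<in>A. leval (L i) z)"
  by (induction A rule: infinite_finite_induct) (auto simp: leval_0 leval_add)

lemma leval_single: "leval (Poly_Mapping.single j c) z = c * z powi j"
  by (simp add: leval_superset[of "{j}"] lcoeff_def)

lemma laurent_sum: "L = (\<Sum>j\<in>Poly_Mapping.keys L. Poly_Mapping.single j (lcoeff L j))"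
  by (rule poly_mapping_eqI)
     (auto simp: lookup_sum lookup_single when_def lcoeff_def in_keys_iff sum.delta)

lemma leval_mult:
  assumes "z \<noteq> 0"
  shows "leval (L * M) z = leval L z * leval M z"
proof -
  have "L * M = (\<Sum>i\<in>Poly_Mapping.keys L. \<Sum>j\<in>Poly_Mapping.keys M.
      Poly_Mapping.single (i + j) (lcoeff L i * lcoeff M j))"
    by (subst laurent_sum[of L], subst laurent_sum[of M])
       (simp add: sum_product mult_single)
  then show ?thesis
    using assms
    by (simp add: leval_sum leval_single leval_def[of L] leval_def[of M] sum_product power_int_add mult_ac)
qed

text \<open>The linear factor D = X - a is no unit, since it vanishes at a, and it divides every
  Laurent polynomial that vanishes at a, because it divides each X^j - a^j.\<close>

lemma common_zero_not_lcoprime: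
  assumes "lcoprime L M" "a \<noteq> 0" "leval L a = 0"
  shows "leval M a \<noteq> 0"
proof
  assume M: "leval M a = 0"
  let ?s = "Poly_Mapping.single :: int \<Rightarrow> complex \<Rightarrow> laurent"
  define D where "D = ?s 1 1 - ?s 0 a"
  have pw: "?s 1 1 ^ n = ?s (int n) 1" "?s 0 a ^ n = ?s 0 (a ^ n)" for n
    by (induction n) (auto simp: mult_single single_one)
  have nn: "D dvd ?s (int n) 1 - ?s 0 (a ^ n)" for n
  proof -
    have "D dvd ?s 1 1 ^ n - ?s 0 a ^ n"
      unfolding D_def by (rule dvdI[OF power_diff_sumr2])
    then show ?thesis by (simp only: pw)
  qed
  have d: "D dvd ?s j 1 - ?s 0 (a powi j)" for j
  proof (cases "j \<ge> 0")
    case True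
    then show ?thesis using nn[of "nat j"] by (simp add: power_int_def)
  next
    case False
    then have j: "int (nat (- j)) = - j" by simp
    \<comment> \<open>Negative exponents reduce to positive ones by the unit - a^j X^j.\<close>
    have "?s j 1 - ?s 0 (a powi j) = - (?s j (a powi j)) * (?s (- j) 1 - ?s 0 (a ^ nat (- j)))"
      using False assms(2)
      by (simp add: right_diff_distrib mult_single power_int_def field_simps)
    then show ?thesis using nn[of "nat (- j)"] unfolding j by (metis dvd_mult)
  qed
  have *: "D dvd L" if "leval L a = 0" for L
  proof -
    let ?K = "Poly_Mapping.keys L"
    have "(\<Sum>j\<in>?K. ?s 0 (lcoeff L j) * (?s j 1 - ?s 0 (a powi j)))
        = (\<Sum>j\<in>?K. ?s j (lcoeff L j)) - (\<Sum>j\<in>?K. ?s 0 (lcoeff L j * a powi j))"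
      by (simp add: right_diff_distrib mult_single sum_subtractf)
    also have "(\<Sum>j\<in>?K. ?s 0 (lcoeff L j * a powi j)) = ?s 0 (leval L a)"
    proof -
      have "(\<Sum>j\<in>A. ?s 0 (f j)) = ?s 0 (\<Sum>j\<in>A. f j)" for A :: "int set" and f
        by (induction A rule: infinite_finite_induct) (auto simp: single_add)
      then show ?thesis by (simp add: leval_def)
    qed
    finally have "L = (\<Sum>j\<in>?K. ?s 0 (lcoeff L j) * (?s j 1 - ?s 0 (a powi j)))"
      using that laurent_sum[of L] by simp
    then show ?thesis using d by (metis (no_types, lifting) dvd_mult dvd_sum)
  qed
  have "D dvd 1" using assms(1) *[OF assms(3)] *[OF M] unfolding lcoprime_def by blast
  then obtain E where "1 = D * E" by (rule dvdE)
  then have "leval 1 a = leval D a * leval E a" using leval_mult[OF assms(2)] by metis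
  moreover have "leval D a = 0"
  proof -
    have "D = ?s 1 1 + ?s 0 (- a)" unfolding D_def by (simp add: single_uminus)
    then show ?thesis by (simp add: leval_add leval_single)
  qed
  moreover have "leval 1 a = 1" using leval_single[of 0 1 a] by (simp add: single_one)
  ultimately show False by simp
qed

section \<open>Zeros of a prepared Laurent polynomial\<close>

text \<open>Multiplication by z^N turns both descriptions of L into polynomials that agree off 0,
  hence are equal. Their degrees count the zeros; their constant terms give the lowest coefficient,
  whose conjugate is the leading one of the reciprocal.\<close>

lemma zeros_poly:
  assumes p: "prepared N L" and z: "zeros_with_mult N L zs"
  shows "(\<Sum>i<length zs. snd (zs ! i)) = 2 * N"
    and "lcoeff L (- int N) = lcoeff L (int N) * (\<Prod>i<length zs. (- fst (zs ! i)) ^ snd (zs ! i))"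
proof -
  define P where "P = (\<Sum>i\<le>2 * N. monom (lcoeff L (int i - int N)) i)"
  define Q where "Q = Polynomial.smult (lcoeff L (int N)) (\<Prod>i<length zs. [:- fst (zs ! i), 1:] ^ snd (zs ! i))"
  have cP: "coeff P i = (if i \<le> 2 * N then lcoeff L (int i - int N) else 0)" for i
    unfolding P_def by (simp add: coeff_sum)
  have keys: "Poly_Mapping.keys L \<subseteq> {- int N..int N}" and nz: "lcoeff L (int N) \<noteq> 0"
    using p unfolding prepared_def by auto
  have eq: "poly P z = poly Q z" if "z \<noteq> 0" for z
  proof -
    have "leval L z = (\<Sum>j\<in>{- int N..int N}. lcoeff L j * z powi j)"
      by (rule leval_superset[OF _ keys]) simp
    also have "\<dots> = (\<Sum>i\<le>2 * N. lcoeff L (int i - int N) * z powi (int i - int N))"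
      by (rule sum.reindex_bij_witness[of _ "\<lambda>i. int i - int N" "\<lambda>j. nat (j + int N)"]) auto
    also have "\<dots> = z powi (- int N) * poly P z"
      unfolding P_def using that
      by (simp add: poly_sum poly_monom sum_distrib_left power_int_diff power_int_minus field_simps)
    finally have "leval L z = z powi (- int N) * poly P z" .
    moreover have "leval L z = z powi (- int N) * poly Q z"
      using z that unfolding zeros_with_mult_def Q_def by (simp add: poly_prod algebra_simps)
    ultimately show ?thesis using that by simp
  qed
  have "P = Q"
  proof (rule ccontr)
    assume "P \<noteq> Q"
    then have "finite {z. poly (P - Q) z = 0}" by (intro poly_roots_finite) simp
    moreover have "- {0} \<subseteq> {z. poly (P - Q) z = 0}" using eq by auto
    ultimately have "finite (- {0 :: complex})" by (rule rev_finite_subset)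
    then show False by (simp add: finite_compl infinite_UNIV_char_0)
  qed
  have "degree P = 2 * N"
    by (rule antisym; (rule degree_le | rule le_degree)) (use nz in \<open>auto simp: cP\<close>)
  moreover have "degree Q = (\<Sum>i<length zs. snd (zs ! i))"
    unfolding Q_def using nz by (simp add: degree_prod_eq_sum_degree degree_power_eq)
  ultimately show "(\<Sum>i<length zs. snd (zs ! i)) = 2 * N" using \<open>P = Q\<close> by simp
  have "coeff P 0 = lcoeff L (- int N)" by (simp add: cP)
  moreover have "coeff Q 0 = lcoeff L (int N) * (\<Prod>i<length zs. (- fst (zs ! i)) ^ snd (zs ! i))"
    unfolding Q_def by (simp add: poly_prod flip: poly_0_coeff_0)
  ultimately show "lcoeff L (- int N) = lcoeff L (int N) * (\<Prod>i<length zs. (- fst (zs ! i)) ^ snd (zs ! i))"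
    using \<open>P = Q\<close> by simp
qed

lemma map_zeros_simps:
  "length (map_zeros h zs) = length zs"
  "i < length zs \<Longrightarrow> map_zeros h zs ! i = (h (fst (zs ! i)), snd (zs ! i))"
  "jet_index (map_zeros h zs) = jet_index zs"
  unfolding map_zeros_def jet_index_def
  by (auto simp: split_beta intro!: arg_cong[where f = concat] map_cong)

text \<open>Each factor 1 / w - cnj a is rewritten with the zero 1 / cnj a. By
  \<open>zeros_poly\<close> the constants pulled out combine with the leading coefficient to the
  lowest one, and the powers of w to w^(- 2 N).\<close>

lemma zeros_lrecip:
  assumes p: "prepared N L" and z: "zeros_with_mult N L zs"
  shows "zeros_with_mult N (lrecip L) (map_zeros (\<lambda>a. inverse (cnj a)) zs)"
  unfolding zeros_with_mult_def
proof (intro conjI allI impI)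
  have d: "distinct (map fst zs)" "\<forall>(a, m)\<in>set zs. a \<noteq> 0 \<and> m \<ge> 1"
    and ev: "\<And>z. z \<noteq> 0 \<Longrightarrow> leval L z =
        lcoeff L (int N) * z powi (- int N) * (\<Prod>i<length zs. (z - fst (zs ! i)) ^ snd (zs ! i))"
    using z unfolding zeros_with_mult_def by blast+
  have "map fst (map_zeros (\<lambda>a. inverse (cnj a)) zs) = map (\<lambda>a. inverse (cnj a)) (map fst zs)"
    by (auto simp: map_zeros_def)
  moreover have "inj_on (\<lambda>a. inverse (cnj a)) (set (map fst zs))" by (auto simp: inj_on_def)
  ultimately show "distinct (map fst (map_zeros (\<lambda>a. inverse (cnj a)) zs))"
    using d(1) by (simp only: distinct_map)
  show "\<forall>(a, m)\<in>set (map_zeros (\<lambda>a. inverse (cnj a)) zs). a \<noteq> 0 \<and> 1 \<le> m"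
    using d(2) by (auto simp: map_zeros_def)
  fix w :: complex assume w: "w \<noteq> 0"
  let ?n = "length zs" and ?a = "\<lambda>i. fst (zs ! i)" and ?m = "\<lambda>i. snd (zs ! i)"
  have a0: "?a i \<noteq> 0" if "i < ?n" for i using d(2) nth_mem[OF that] by auto
  have "leval (lrecip L) w = cnj (lcoeff L (int N)) * w powi int N * (\<Prod>i<?n. (inverse w - cnj (?a i)) ^ ?m i)"
    using ev[of "inverse (cnj w)"] w
    by (simp add: leval_lrecip power_int_minus power_int_inverse power_inverse)
  also have "(\<Prod>i<?n. (inverse w - cnj (?a i)) ^ ?m i)
     = (\<Prod>i<?n. inverse w ^ ?m i * ((- cnj (?a i)) ^ ?m i * (w - inverse (cnj (?a i))) ^ ?m i))"
  proof (rule prod.cong)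
    fix i assume "i \<in> {..<?n}"
    then have "inverse w - cnj (?a i) = inverse w * ((- cnj (?a i)) * (w - inverse (cnj (?a i))))"
      using w a0[of i] by (simp add: field_simps)
    then show "(inverse w - cnj (?a i)) ^ ?m i
      = inverse w ^ ?m i * ((- cnj (?a i)) ^ ?m i * (w - inverse (cnj (?a i))) ^ ?m i)"
      by (simp only: power_mult_distrib)
  qed simp
  also have "\<dots> = inverse w ^ (2 * N) * ((\<Prod>i<?n. (- cnj (?a i)) ^ ?m i) * (\<Prod>i<?n. (w - inverse (cnj (?a i))) ^ ?m i))"
    by (simp only: prod.distrib power_sum[symmetric] zeros_poly(1)[OF p z])
  also have "cnj (lcoeff L (int N)) * w powi int N * \<dots>
     = cnj (lcoeff L (int N) * (\<Prod>i<?n. (- ?a i) ^ ?m i)) * (w powi int N * inverse w ^ (2 * N))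
        * (\<Prod>i<?n. (w - inverse (cnj (?a i))) ^ ?m i)"
    by simp
  also have "lcoeff L (int N) * (\<Prod>i<?n. (- ?a i) ^ ?m i) = lcoeff L (- int N)"
    using zeros_poly(2)[OF p z] by simp
  also have "w powi int N * inverse w ^ (2 * N) = w powi (- int N)"
  proof -
    have "w ^ N * inverse w ^ N = 1" using w by (simp flip: power_mult_distrib)
    then have "w ^ N * (inverse w ^ N * inverse w ^ N) = inverse w ^ N"
      by (metis mult.assoc mult_1)
    then show ?thesis by (simp add: power_int_minus power_inverse mult_2 power_add)
  qed
  finally show "leval (lrecip L) w = lcoeff (lrecip L) (int N) * w powi (- int N) *
      (\<Prod>i<length (map_zeros (\<lambda>a. inverse (cnj a)) zs). (w - fst (map_zeros (\<lambda>a. inverse (cnj a)) zs ! i)) ^ snd (map_zeros (\<lambda>a. inverse (cnj a)) zs ! i))"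
    by (simp add: lcoeff_lrecip map_zeros_simps)
qed

lemma leval_lbracket:
  assumes "zeros_with_mult N L zs" "i < length zs" "z \<noteq> 0"
  shows "leval L z = lbracket L N zs i z * (z - fst (zs ! i)) ^ snd (zs ! i)"
proof -
  have "(\<Prod>i<length zs. (z - fst (zs ! i)) ^ snd (zs ! i))
      = (z - fst (zs ! i)) ^ snd (zs ! i) * (\<Prod>i\<in>{..<length zs} - {i}. (z - fst (zs ! i)) ^ snd (zs ! i))"
    using assms(2) by (intro prod.remove) auto
  then show ?thesis using assms(1,3) unfolding zeros_with_mult_def lbracket_def by simp
qed

lemma zeros_nth:
  assumes "zeros_with_mult N L zs" "i < length zs"
  shows "fst (zs ! i) \<noteq> 0" "snd (zs ! i) \<ge> 1" "leval L (fst (zs ! i)) = 0"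
proof -
  show a: "fst (zs ! i) \<noteq> 0" "snd (zs ! i) \<ge> 1"
    using assms(1) nth_mem[OF assms(2)] unfolding zeros_with_mult_def by auto
  then show "leval L (fst (zs ! i)) = 0"
    using leval_lbracket[OF assms, of "fst (zs ! i)"] by simp
qed

lemma leval_zero_imp:
  assumes "prepared N L" "zeros_with_mult N L zs" "z \<noteq> 0" "leval L z = 0"
  shows "z \<in> fst ` set zs"
proof -
  have "lcoeff L (int N) \<noteq> 0" using assms(1) unfolding prepared_def by auto
  then have "(\<Prod>i<length zs. (z - fst (zs ! i)) ^ snd (zs ! i)) = 0"
    using assms(2-4) unfolding zeros_with_mult_def by auto
  then obtain i where "i < length zs" "z = fst (zs ! i)" by auto
  then show ?thesis by auto
qed

section \<open>Spans of the CMV basis\<close>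

text \<open>The position of z^e in the order 1, 1 / z, z, 1 / z^2, ... of the basis;
  \<open>cmv_exp\<close> goes back to the exponent.\<close>

definition cmv_idx :: "int \<Rightarrow> nat" where
  "cmv_idx e = (if e \<ge> 0 then nat (2 * e) else nat (- 2 * e - 1))"

definition cmv_exp :: "nat \<Rightarrow> int" where
  "cmv_exp k = (if even k then int (k div 2) else - int (k div 2) - 1)"

lemma cmv_eq_powi: "cmv k = (\<lambda>z. z powi cmv_exp k)"
  by (auto simp: cmv_def cmv_exp_def)

lemma cmv_exp_cidx: "cmv_exp (cmv_idx e) = e"
  unfolding cmv_exp_def cmv_idx_def by (auto simp: even_nat_iff)

lemma cmv_cmv_idx: "cmv (cmv_idx e) = (\<lambda>z. z powi e)"
  by (simp add: cmv_eq_powi cmv_exp_cidx)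

text \<open>Values at 0 are disregarded, since negative powers have no meaningful value
  there.\<close>

definition in_span :: "nat \<Rightarrow> (complex \<Rightarrow> complex) \<Rightarrow> bool" where
  "in_span n f \<longleftrightarrow> (\<exists>c. \<forall>z. z \<noteq> 0 \<longrightarrow> f z = (\<Sum>i<n. c i * cmv i z))"

lemma in_span_cong: "in_span n f \<Longrightarrow> (\<And>z. z \<noteq> 0 \<Longrightarrow> f z = g z) \<Longrightarrow> in_span n g"
  unfolding in_span_def by metis

lemma in_span_cmv: "i < n \<Longrightarrow> in_span n (cmv i)"
  unfolding in_span_def
  by (rule exI[of _ "\<lambda>j. if j = i then 1 else 0"]) (simp add: if_distrib[of "\<lambda>x. x * _"] cong: if_cong)

lemma in_span_0: "in_span n (\<lambda>_. 0)"
  unfolding in_span_def by (rule exI[of _ "\<lambda>_. 0"]) simp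

lemma in_span_add: "in_span n f \<Longrightarrow> in_span n g \<Longrightarrow> in_span n (\<lambda>z. f z + g z)"
proof -
  assume "in_span n f" "in_span n g"
  then obtain c d where "\<forall>z. z \<noteq> 0 \<longrightarrow> f z = (\<Sum>i<n. c i * cmv i z)" "\<forall>z. z \<noteq> 0 \<longrightarrow> g z = (\<Sum>i<n. d i * cmv i z)"
    unfolding in_span_def by blast
  then show ?thesis unfolding in_span_def
    by (intro exI[of _ "\<lambda>i. c i + d i"]) (simp add: distrib_right sum.distrib)
qed

lemma in_span_scale: "in_span n f \<Longrightarrow> in_span n (\<lambda>z. a * f z)"
proof -
  assume "in_span n f"
  then obtain c where "\<forall>z. z \<noteq> 0 \<longrightarrow> f z = (\<Sum>i<n. c i * cmv i z)"
    unfolding in_span_def by blast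
  then show ?thesis unfolding in_span_def
    by (intro exI[of _ "\<lambda>i. a * c i"]) (simp add: sum_distrib_left mult.assoc)
qed

lemma in_span_diff: "in_span n f \<Longrightarrow> in_span n g \<Longrightarrow> in_span n (\<lambda>z. f z - g z)"
  using in_span_add[of n f "\<lambda>z. (-1) * g z"] in_span_scale[of n g "-1"] by simp

lemma in_span_sum: "(\<And>i. i \<in> A \<Longrightarrow> in_span n (f i)) \<Longrightarrow> in_span n (\<lambda>z. \<Sum>i\<in>A. f i z)"
  by (induction A rule: infinite_finite_induct) (auto intro: in_span_0 in_span_add)

lemma in_span_mono: "in_span n f \<Longrightarrow> n \<le> m \<Longrightarrow> in_span m f"
proof -
  assume a: "in_span n f" "n \<le> m"
  then obtain c where c: "\<And>z. z \<noteq> 0 \<Longrightarrow> f z = (\<Sum>i<n. c i * cmv i z)" unfolding in_span_def by blast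
  show ?thesis
    by (rule in_span_cong[OF in_span_sum[of "{..<n}" m "\<lambda>i z. c i * cmv i z"]])
       (use a(2) c in \<open>auto intro!: in_span_scale in_span_cmv\<close>)
qed

lemma in_span_powi: "cmv_idx e < n \<Longrightarrow> in_span n (\<lambda>z. z powi e)"
  using in_span_cmv[of "cmv_idx e" n] by (simp add: cmv_cmv_idx)

text \<open>Basis functions of even index are nonnegative powers, those of odd index negative ones.
  The outermost term of the product therefore comes from the exponent N of L when n is even and - N
  when n is odd; all other terms stand earlier in the basis.\<close>

lemma leval_cmv:
  assumes "prepared N L"
  shows "in_span (n + 2 * N) (\<lambda>z. leval L z * cmv n z - lcoeff L ((-1) ^ n * int N) * cmv (n + 2 * N) z)"
proof -
  let ?K = "{- int N..int N}" and ?t = "(-1) ^ n * int N"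
  have t: "?t \<in> ?K" by (cases "even n") auto
  have top: "cmv_exp (n + 2 * N) = cmv_exp n + ?t"
    unfolding cmv_exp_def by (auto simp: power_minus_odd)
  have lt: "cmv_idx (j + cmv_exp n) < n + 2 * N" if "j \<in> ?K - {?t}" for j
  proof (cases "even n")
    case True
    then obtain k where n: "n = 2 * k" by (elim evenE)
    have "cmv_exp n = int k" "j < int N" "j \<ge> - int N" using that by (auto simp: n cmv_exp_def)
    then show ?thesis unfolding cmv_idx_def n by (cases "j + cmv_exp n \<ge> 0") (simp_all add: n)
  next
    case False
    then obtain k where n: "n = 2 * k + 1" by (elim oddE)
    have "cmv_exp n = - int k - 1" "j \<le> int N" "j > - int N" using that by (auto simp: n cmv_exp_def)
    then show ?thesis unfolding cmv_idx_def n by (cases "j + cmv_exp n \<ge> 0") (simp_all add: n)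
  qed
  have "in_span (n + 2 * N) (\<lambda>z. \<Sum>j\<in>?K - {?t}. lcoeff L j * z powi (j + cmv_exp n))"
    by (intro in_span_sum in_span_scale in_span_powi lt)
  then show ?thesis
  proof (rule in_span_cong)
    fix z :: complex assume z: "z \<noteq> 0"
    have "leval L z * cmv n z = (\<Sum>j\<in>?K. lcoeff L j * z powi (j + cmv_exp n))"
      using assms z unfolding prepared_def
      by (subst leval_superset[of ?K]) (auto simp: cmv_eq_powi sum_distrib_right power_int_add mult.assoc)
    also have "\<dots> = lcoeff L ?t * z powi (?t + cmv_exp n) + (\<Sum>j\<in>?K - {?t}. lcoeff L j * z powi (j + cmv_exp n))"
      by (rule sum.remove) (use t in auto)
    finally show "(\<Sum>j\<in>?K - {?t}. lcoeff L j * z powi (j + cmv_exp n))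
      = leval L z * cmv n z - lcoeff L ?t * cmv (n + 2 * N) z"
      by (simp add: cmv_eq_powi top add.commute)
  qed
qed

lemma in_span_leval:
  assumes "prepared N L" "in_span n f"
  shows "in_span (n + 2 * N) (\<lambda>z. leval L z * f z)"
proof -
  obtain c where c: "\<And>z. z \<noteq> 0 \<Longrightarrow> f z = (\<Sum>i<n. c i * cmv i z)" using assms(2) unfolding in_span_def by blast
  have "in_span (n + 2 * N) (\<lambda>z. leval L z * cmv i z)" if "i < n" for i
  proof -
    have "in_span (n + 2 * N) (\<lambda>z. (leval L z * cmv i z - lcoeff L ((-1) ^ i * int N) * cmv (i + 2 * N) z)
        + lcoeff L ((-1) ^ i * int N) * cmv (i + 2 * N) z)"
      using that by (intro in_span_add in_span_scale in_span_cmv in_span_mono[OF leval_cmv[OF assms(1)]]) auto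
    then show ?thesis by simp
  qed
  then have "in_span (n + 2 * N) (\<lambda>z. \<Sum>i<n. c i * (leval L z * cmv i z))"
    by (intro in_span_sum in_span_scale) auto
  then show ?thesis
    by (rule in_span_cong) (simp add: c sum_distrib_left mult.left_commute)
qed

lemma in_span_leval_top:
  assumes "prepared N L" "in_span n (\<lambda>z. f z - a * cmv n z)"
  shows "in_span (n + 2 * N) (\<lambda>z. leval L z * f z - a * lcoeff L ((-1) ^ n * int N) * cmv (n + 2 * N) z)"
proof -
  have "in_span (n + 2 * N) (\<lambda>z. leval L z * (f z - a * cmv n z)
     + a * (leval L z * cmv n z - lcoeff L ((-1) ^ n * int N) * cmv (n + 2 * N) z))"
    by (intro in_span_add in_span_scale in_span_leval leval_cmv assms)
  then show ?thesis by (simp add: algebra_simps)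
qed

text \<open>The exponents - N, ..., N - 1 are exactly those of the first 2 N basis
  functions.\<close>

lemma in_span_poly:
  assumes "degree p < 2 * N"
  shows "in_span (2 * N) (\<lambda>z. z powi (- int N) * poly p z)"
proof -
  have "in_span (2 * N) (\<lambda>z. \<Sum>i\<le>degree p. coeff p i * z powi (int i - int N))"
    by (intro in_span_sum in_span_scale in_span_powi) (use assms in \<open>auto simp: cmv_idx_def\<close>)
  then show ?thesis
    by (rule in_span_cong)
       (simp add: poly_altdef sum_distrib_left power_int_diff power_int_minus divide_inverse mult_ac)
qed

section \<open>Biorthogonal Laurent polynomials\<close>

definition laurent_fun :: "(complex \<Rightarrow> complex) \<Rightarrow> bool" where
  "laurent_fun f \<longleftrightarrow> (\<exists>n. in_span n f)"

lemma LauI: "in_span n f \<Longrightarrow> laurent_fun f"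
  unfolding laurent_fun_def by blast

lemma laurent_fun_add: "laurent_fun f \<Longrightarrow> laurent_fun g \<Longrightarrow> laurent_fun (\<lambda>z. f z + g z)"
proof -
  assume "laurent_fun f" "laurent_fun g"
  then obtain n m where "in_span n f" "in_span m g" unfolding laurent_fun_def by blast
  then have "in_span (max n m) (\<lambda>z. f z + g z)"
    by (intro in_span_add[OF in_span_mono in_span_mono]) (assumption | simp)+
  then show ?thesis by (rule LauI)
qed

lemma laurent_fun_scale: "laurent_fun f \<Longrightarrow> laurent_fun (\<lambda>z. a * f z)"
  unfolding laurent_fun_def using in_span_scale by blast

lemma laurent_fun_sum: "(\<And>i. i \<in> A \<Longrightarrow> laurent_fun (f i)) \<Longrightarrow> laurent_fun (\<lambda>z. \<Sum>i\<in>A. f i z)"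
  by (induction A rule: infinite_finite_induct) (auto intro: laurent_fun_add LauI[OF in_span_0[of 0]])

lemma laurent_fun_cmv: "laurent_fun (cmv k)"
  by (rule LauI[OF in_span_cmv[of k "Suc k"]]) simp

text \<open>Linearity is restricted to Laurent polynomials, because \<open>pairing\<close> rests on
  a choice and \<open>deriv\<close> is additive only for differentiable functions. The first clause
  disregards values at 0.\<close>

definition sesquilinear_form :: "sesqform \<Rightarrow> bool" where
  "sesquilinear_form F \<longleftrightarrow>
     (\<forall>f f' g g'. laurent_fun f \<longrightarrow> laurent_fun g \<longrightarrow> (\<forall>z. z \<noteq> 0 \<longrightarrow> f z = f' z) \<longrightarrow> (\<forall>z. z \<noteq> 0 \<longrightarrow> g z = g' z) \<longrightarrow> F f g = F f' g') \<and>
     (\<forall>f f' g. laurent_fun f \<longrightarrow> laurent_fun f' \<longrightarrow> laurent_fun g \<longrightarrow> F (\<lambda>z. f z + f' z) g = F f g + F f' g) \<and>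
     (\<forall>f g g'. laurent_fun f \<longrightarrow> laurent_fun g \<longrightarrow> laurent_fun g' \<longrightarrow> F f (\<lambda>z. g z + g' z) = F f g + F f g') \<and>
     (\<forall>a f g. laurent_fun f \<longrightarrow> laurent_fun g \<longrightarrow> F (\<lambda>z. a * f z) g = a * F f g) \<and>
     (\<forall>a f g. laurent_fun f \<longrightarrow> laurent_fun g \<longrightarrow> F f (\<lambda>z. a * g z) = cnj a * F f g)"

locale gauss_borel_form =
  fixes F :: sesqform and S1 S2 :: "nat \<Rightarrow> nat \<Rightarrow> complex" and H :: "nat \<Rightarrow> complex"
  assumes sesq: "sesquilinear_form F"
    and gb: "gauss_borel (gram F) S1 H S2"
begin

lemma F_cong: "laurent_fun f \<Longrightarrow> laurent_fun g \<Longrightarrow> (\<And>z. z \<noteq> 0 \<Longrightarrow> f z = f' z) \<Longrightarrow> (\<And>z. z \<noteq> 0 \<Longrightarrow> g z = g' z) \<Longrightarrow> F f g = F f' g'"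
  and F_add1: "laurent_fun f \<Longrightarrow> laurent_fun f' \<Longrightarrow> laurent_fun g \<Longrightarrow> F (\<lambda>z. f z + f' z) g = F f g + F f' g"
  and F_add2: "laurent_fun f \<Longrightarrow> laurent_fun g \<Longrightarrow> laurent_fun g' \<Longrightarrow> F f (\<lambda>z. g z + g' z) = F f g + F f g'"
  and F_scale1: "laurent_fun f \<Longrightarrow> laurent_fun g \<Longrightarrow> F (\<lambda>z. a * f z) g = a * F f g"
  and F_scale2: "laurent_fun f \<Longrightarrow> laurent_fun g \<Longrightarrow> F f (\<lambda>z. a * g z) = cnj a * F f g"
  using sesq unfolding sesquilinear_form_def by blast+

lemma F_sum1: "laurent_fun g \<Longrightarrow> (\<And>i. i \<in> A \<Longrightarrow> laurent_fun (f i)) \<Longrightarrow> F (\<lambda>z. \<Sum>i\<in>A. c i * f i z) g = (\<Sum>i\<in>A. c i * F (f i) g)"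
proof (induction A rule: infinite_finite_induct)
  case (insert x A)
  then show ?case by (simp add: F_add1[OF laurent_fun_scale laurent_fun_sum[OF laurent_fun_scale]] F_scale1)
qed (use F_scale1[of "cmv 0" g 0] laurent_fun_cmv in auto)

lemma F_sum2: "laurent_fun f \<Longrightarrow> (\<And>i. i \<in> A \<Longrightarrow> laurent_fun (g i)) \<Longrightarrow> F f (\<lambda>z. \<Sum>i\<in>A. c i * g i z) = (\<Sum>i\<in>A. cnj (c i) * F f (g i))"
proof (induction A rule: infinite_finite_induct)
  case (insert x A)
  then show ?case by (simp add: F_add2[OF _ laurent_fun_scale laurent_fun_sum[OF laurent_fun_scale]] F_scale2)
qed (use F_scale2[of f "cmv 0" 0] laurent_fun_cmv in auto)

abbreviation "phi1 \<equiv> biorth S1"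
abbreviation "phi2 \<equiv> biorth S2"

lemma inv_ex: "\<exists>T1 T2. lower_inverses S1 T1 \<and> lower_inverses S2 T2 \<and>
        (\<forall>k l. gram F k l = (\<Sum>i\<le>min k l. T1 k i * H i * cnj (T2 l i)))"
  using gb unfolding gauss_borel_def .

end

lemma biorth_in_span: "k < n \<Longrightarrow> in_span n (biorth S k)"
  unfolding biorth_def[abs_def] by (intro in_span_sum in_span_scale in_span_cmv) auto

lemma laurent_fun_biorth: "laurent_fun (biorth S k)"
  by (rule LauI[OF biorth_in_span[of k "Suc k"]]) simp

lemma biorth_top:
  assumes "lower_unitriangular S"
  shows "in_span n (\<lambda>z. biorth S n z - 1 * cmv n z)"
proof -
  have "in_span n (\<lambda>z. \<Sum>i<n. S n i * cmv i z)" by (intro in_span_sum in_span_scale in_span_cmv) auto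
  moreover have "biorth S n z - 1 * cmv n z = (\<Sum>i<n. S n i * cmv i z)" for z
    using assms unfolding biorth_def lower_unitriangular_def by (simp add: lessThan_Suc_atMost[symmetric])
  ultimately show ?thesis by simp
qed

lemma cmv_biorth:
  assumes "lower_inverses S T"
  shows "cmv k z = (\<Sum>i\<le>k. T k i * biorth S i z)"
proof -
  have low: "S i j = 0" if "i < j" for i j
    using assms that unfolding lower_inverses_def lower_unitriangular_def by blast
  have "(\<Sum>i\<le>k. T k i * biorth S i z) = (\<Sum>i\<le>k. \<Sum>j\<le>k. T k i * S i j * cmv j z)"
  proof (rule sum.cong)
    fix i assume "i \<in> {..k}"
    then have "biorth S i z = (\<Sum>j\<le>k. S i j * cmv j z)"
      unfolding biorth_def by (intro sum.mono_neutral_left) (auto simp: low)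
    then show "T k i * biorth S i z = (\<Sum>j\<le>k. T k i * S i j * cmv j z)"
      by (simp add: sum_distrib_left mult.assoc)
  qed simp
  also have "\<dots> = (\<Sum>j\<le>k. lower_mult T S k j * cmv j z)"
    unfolding lower_mult_def by (subst sum.swap) (simp add: sum_distrib_right)
  also have "\<dots> = (\<Sum>j\<le>k. (if k = j then 1 else 0) * cmv j z)"
    using assms unfolding lower_inverses_def by simp
  also have "\<dots> = cmv k z" by (simp add: if_distrib[of "\<lambda>x. x * _"] cong: if_cong)
  finally show ?thesis by simp
qed

lemma in_span_biorth:
  assumes "lower_inverses S T" "in_span n f"
  shows "\<exists>a. \<forall>z. z \<noteq> 0 \<longrightarrow> f z = (\<Sum>i<n. a i * biorth S i z)"
proof -
  obtain c where c: "\<And>z. z \<noteq> 0 \<Longrightarrow> f z = (\<Sum>i<n. c i * cmv i z)" using assms(2) unfolding in_span_def by blast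
  have low: "T i j = 0" if "i < j" for i j
    using assms(1) that unfolding lower_inverses_def lower_unitriangular_def by blast
  have "f z = (\<Sum>j<n. (\<Sum>i<n. c i * T i j) * biorth S j z)" if "z \<noteq> 0" for z
  proof -
    have "f z = (\<Sum>i<n. \<Sum>j<n. c i * T i j * biorth S j z)"
      unfolding c[OF that]
    proof (rule sum.cong)
      fix i assume "i \<in> {..<n}"
      then have "cmv i z = (\<Sum>j<n. T i j * biorth S j z)"
        unfolding cmv_biorth[OF assms(1)] by (intro sum.mono_neutral_left) (auto simp: low)
      then show "c i * cmv i z = (\<Sum>j<n. c i * T i j * biorth S j z)"
        by (simp add: sum_distrib_left mult.assoc)
    qed simp
    then show ?thesis by (subst (asm) sum.swap) (simp add: sum_distrib_right)
  qed
  then show ?thesis by (intro exI[of _ "\<lambda>j. \<Sum>i<n. c i * T i j"]) blast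
qed

context gauss_borel_form
begin

lemma S_inverses: "\<exists>T. lower_inverses S1 T" "\<exists>T. lower_inverses S2 T"
  using inv_ex by blast+

lemma S_unitri: "lower_unitriangular S1" "lower_unitriangular S2"
  using S_inverses unfolding lower_inverses_def by blast+

text \<open>In matrix form, \<open>S1\<close> times the Gram matrix is H times the conjugate
  transpose of \<open>T2\<close>, which is upper triangular.\<close>

lemma phi1_cmv:
  assumes "lower_inverses S1 T1" "\<And>k l. gram F k l = (\<Sum>i\<le>min k l. T1 k i * H i * cnj (T2 l i))"
  shows "F (phi1 k) (cmv j) = (if k \<le> j then H k * cnj (T2 j k) else 0)"
proof -
  have lowT: "T1 i j = 0" if "i < j" for i j
    using assms(1) that unfolding lower_inverses_def lower_unitriangular_def by blast
  have "F (phi1 k) (cmv j) = (\<Sum>i\<le>k. S1 k i * gram F i j)"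
    unfolding biorth_def[abs_def] gram_def by (rule F_sum1) (auto intro: laurent_fun_cmv)
  also have "\<dots> = (\<Sum>i\<le>k. \<Sum>m\<le>j. S1 k i * (T1 i m * H m * cnj (T2 j m)))"
  proof (rule sum.cong)
    fix i assume "i \<in> {..k}"
    have "gram F i j = (\<Sum>m\<le>j. T1 i m * H m * cnj (T2 j m))"
      unfolding assms(2) by (intro sum.mono_neutral_left) (auto simp: lowT)
    then show "S1 k i * gram F i j = (\<Sum>m\<le>j. S1 k i * (T1 i m * H m * cnj (T2 j m)))"
      by (simp add: sum_distrib_left)
  qed simp
  also have "\<dots> = (\<Sum>m\<le>j. lower_mult S1 T1 k m * (H m * cnj (T2 j m)))"
    unfolding lower_mult_def by (subst sum.swap) (simp add: sum_distrib_right mult.assoc)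
  also have "\<dots> = (\<Sum>m\<le>j. (if k = m then 1 else 0) * (H m * cnj (T2 j m)))"
    using assms(1) unfolding lower_inverses_def by simp
  also have "\<dots> = (if k \<le> j then H k * cnj (T2 j k) else 0)"
    by (simp add: if_distrib[of "\<lambda>x. x * _"] cong: if_cong)
  finally show ?thesis .
qed

lemma biorthogonality: "F (phi1 k) (phi2 l) = (if k = l then H k else 0)"
proof -
  obtain T1 T2 where T: "lower_inverses S1 T1" "lower_inverses S2 T2"
    "\<And>k l. gram F k l = (\<Sum>i\<le>min k l. T1 k i * H i * cnj (T2 l i))" using inv_ex by blast
  have lowT: "T2 i j = 0" if "i < j" for i j
    using T(2) that unfolding lower_inverses_def lower_unitriangular_def by blast
  have "F (phi1 k) (phi2 l) = (\<Sum>j\<le>l. cnj (S2 l j) * F (phi1 k) (cmv j))"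
    unfolding biorth_def[of S2, abs_def] by (rule F_sum2) (auto intro: laurent_fun_cmv laurent_fun_biorth)
  also have "\<dots> = (\<Sum>j\<le>l. cnj (S2 l j) * (H k * cnj (T2 j k)))"
    by (intro sum.cong) (auto simp: phi1_cmv[OF T(1,3)] lowT)
  also have "\<dots> = H k * cnj (lower_mult S2 T2 l k)"
    unfolding lower_mult_def by (simp add: sum_distrib_left mult_ac)
  also have "\<dots> = (if k = l then H k else 0)"
    using T(2) unfolding lower_inverses_def by simp
  finally show ?thesis .
qed

text \<open>If H k were 0, row k of \<open>S1\<close> would annihilate the leading block of order k
  + 1 of the Gram matrix from the left, although the last entry of this row is 1.\<close>

lemma quasidefinite_nonzero:
  assumes qd: "quasidefinite (gram F)"
  shows "H k \<noteq> 0"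
proof
  assume H: "H k = 0"
  obtain T1 T2 where T: "lower_inverses S1 T1" "lower_inverses S2 T2"
    "\<And>k l. gram F k l = (\<Sum>i\<le>min k l. T1 k i * H i * cnj (T2 l i))" using inv_ex by blast
  let ?n = "Suc k"
  let ?G = "Matrix.mat ?n ?n (\<lambda>(i, j). gram F i j)"
  let ?v = "Matrix.vec ?n (\<lambda>i. S1 k i)"
  have "transpose_mat ?G *\<^sub>v ?v = 0\<^sub>v ?n"
  proof (rule eq_vecI)
    fix j assume "j < dim_vec (0\<^sub>v ?n)"
    then have j: "j \<le> k" by simp
    have "vec_index (transpose_mat ?G *\<^sub>v ?v) j = (\<Sum>i\<le>k. gram F i j * S1 k i)"
      using j by (simp add: scalar_prod_def lessThan_Suc_atMost[symmetric] atLeast0LessThan del: sum.lessThan_Suc)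
    also have "\<dots> = F (phi1 k) (cmv j)"
      unfolding biorth_def[abs_def] gram_def by (subst F_sum1) (auto intro: laurent_fun_cmv simp: mult.commute)
    also have "\<dots> = 0" using H phi1_cmv[OF T(1,3)] by simp
    finally show "vec_index (transpose_mat ?G *\<^sub>v ?v) j = vec_index (0\<^sub>v ?n) j" using j by simp
  qed simp
  moreover have "?v \<noteq> 0\<^sub>v ?n"
  proof
    assume "?v = 0\<^sub>v ?n"
    then have "vec_index ?v k = 0" by simp
    then show False using S_unitri(1) unfolding lower_unitriangular_def by simp
  qed
  moreover have G: "?G \<in> carrier_mat ?n ?n" by simp
  ultimately have "det (transpose_mat ?G) = 0"
    by (subst det_0_iff_vec_prod_zero[of _ ?n]) (auto intro!: exI[of _ ?v])
  then show False using qd det_transpose[OF G] unfolding quasidefinite_def by metis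
qed

end

locale biorthogonal = gauss_borel_form +
  assumes H_nonzero: "H k \<noteq> 0"
begin

lemma expand1:
  assumes "in_span n f" "z \<noteq> 0"
  shows "f z = (\<Sum>k<n. F f (phi2 k) / H k * phi1 k z)"
proof -
  obtain T where "lower_inverses S1 T" using S_inverses by blast
  then obtain a where a: "\<And>z. z \<noteq> 0 \<Longrightarrow> f z = (\<Sum>i<n. a i * phi1 i z)"
    using in_span_biorth assms(1) by meson
  have "F f (phi2 k) = a k * H k" if "k < n" for k
  proof -
    have "F f (phi2 k) = F (\<lambda>z. \<Sum>i<n. a i * phi1 i z) (phi2 k)"
      by (rule F_cong) (auto intro: LauI[OF assms(1)] laurent_fun_biorth a)
    also have "\<dots> = (\<Sum>i<n. a i * F (phi1 i) (phi2 k))" by (rule F_sum1) (auto intro: laurent_fun_biorth)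
    also have "\<dots> = a k * H k"
      using that by (simp add: biorthogonality if_distrib[of "\<lambda>x. _ * x"] cong: if_cong)
    finally show ?thesis .
  qed
  then show ?thesis using a[OF assms(2)] H_nonzero by simp
qed

text \<open>This is the reproducing property of the Christoffel-Darboux kernel of order n.\<close>

lemma expand2:
  assumes "in_span n g" "z \<noteq> 0"
  shows "cnj (g z) = (\<Sum>k<n. F (phi1 k) g / H k * cnj (phi2 k z))"
proof -
  obtain T where "lower_inverses S2 T" using S_inverses by blast
  then obtain a where a: "\<And>z. z \<noteq> 0 \<Longrightarrow> g z = (\<Sum>i<n. a i * phi2 i z)"
    using in_span_biorth assms(1) by meson
  have "F (phi1 k) g = cnj (a k) * H k" if "k < n" for k
  proof -
    have "F (phi1 k) g = F (phi1 k) (\<lambda>z. \<Sum>i<n. a i * phi2 i z)"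
      by (rule F_cong) (auto intro: LauI[OF assms(1)] laurent_fun_biorth a)
    also have "\<dots> = (\<Sum>i<n. cnj (a i) * F (phi1 k) (phi2 i))" by (rule F_sum2) (auto intro: laurent_fun_biorth)
    also have "\<dots> = cnj (a k) * H k"
      using that by (simp add: biorthogonality if_distrib[of "\<lambda>x. _ * x"] cong: if_cong)
    finally show ?thesis .
  qed
  then show ?thesis using a[OF assms(2)] H_nonzero by simp
qed

lemma orth1:
  assumes "in_span k g" 
  shows "F (phi1 k) g = 0"
proof -
  obtain T where "lower_inverses S2 T" using S_inverses by blast
  then obtain a where a: "\<And>z. z \<noteq> 0 \<Longrightarrow> g z = (\<Sum>i<k. a i * phi2 i z)"
    using in_span_biorth assms(1) by meson
  have "F (phi1 k) g = F (phi1 k) (\<lambda>z. \<Sum>i<k. a i * phi2 i z)"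
    by (rule F_cong) (auto intro: LauI[OF assms(1)] laurent_fun_biorth a)
  also have "\<dots> = (\<Sum>i<k. cnj (a i) * F (phi1 k) (phi2 i))" by (rule F_sum2) (auto intro: laurent_fun_biorth)
  also have "\<dots> = 0" by (intro sum.neutral) (auto simp: biorthogonality)
  finally show ?thesis .
qed

lemma orth2:
  assumes "in_span k f" 
  shows "F f (phi2 k) = 0"
proof -
  obtain T where "lower_inverses S1 T" using S_inverses by blast
  then obtain a where a: "\<And>z. z \<noteq> 0 \<Longrightarrow> f z = (\<Sum>i<k. a i * phi1 i z)"
    using in_span_biorth assms(1) by meson
  have "F f (phi2 k) = F (\<lambda>z. \<Sum>i<k. a i * phi1 i z) (phi2 k)"
    by (rule F_cong) (auto intro: LauI[OF assms(1)] laurent_fun_biorth a)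
  also have "\<dots> = (\<Sum>i<k. a i * F (phi1 i) (phi2 k))" by (rule F_sum1) (auto intro: laurent_fun_biorth)
  also have "\<dots> = 0" by (intro sum.neutral) (auto simp: biorthogonality)
  finally show ?thesis .
qed

text \<open>As \<open>S2\<close> is unitriangular, a is also the coefficient of
  \<open>phi2 k\<close> in g, and the rest is orthogonal to \<open>phi1 k\<close>. The conjugate
  appears because the form is antilinear in its second argument.\<close>

lemma orth_top1:
  assumes "in_span k (\<lambda>z. g z - a * cmv k z)"
  shows "F (phi1 k) g = cnj a * H k"
proof -
  have "in_span k (\<lambda>z. (g z - a * cmv k z) - a * (phi2 k z - 1 * cmv k z))"
    by (intro in_span_diff in_span_scale biorth_top[OF S_unitri(2)] assms)
  then have v: "in_span k (\<lambda>z. g z - a * phi2 k z)" by (rule in_span_cong) (simp add: algebra_simps)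
  have "F (phi1 k) (\<lambda>z. (g z - a * phi2 k z) + a * phi2 k z) = 0 + cnj a * H k"
    by (subst F_add2) (auto intro!: laurent_fun_biorth laurent_fun_scale LauI[OF v] simp: F_scale2 laurent_fun_biorth orth1[OF v] biorthogonality)
  then show ?thesis by simp
qed

lemma orth_top2:
  assumes "in_span k (\<lambda>z. f z - a * cmv k z)"
  shows "F f (phi2 k) = a * H k"
proof -
  have "in_span k (\<lambda>z. (f z - a * cmv k z) - a * (phi1 k z - 1 * cmv k z))"
    by (intro in_span_diff in_span_scale biorth_top[OF S_unitri(1)] assms)
  then have v: "in_span k (\<lambda>z. f z - a * phi1 k z)" by (rule in_span_cong) (simp add: algebra_simps)
  have "F (\<lambda>z. (f z - a * phi1 k z) + a * phi1 k z) (phi2 k) = 0 + a * H k"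
    by (subst F_add1) (auto intro!: laurent_fun_biorth laurent_fun_scale LauI[OF v] simp: F_scale1 laurent_fun_biorth orth2[OF v] biorthogonality)
  then show ?thesis by simp
qed

end

section \<open>Determinants of lists of rows\<close>

text \<open>The minors do not depend on whether b stands last or first. Both expansions share the
  same numbers, which makes the sign of the rotation and the linearity in b immediate.\<close>

lemma det_rows_laplace:
  assumes b: "dim_vec b = Suc (length rs)"
  defines "M \<equiv> \<lambda>j. mat (length rs) (length rs) (\<lambda>(i', j'). vec_index (rs ! i') (if j' < j then j' else Suc j'))"
  shows "det_rows (rs @ [b]) = (\<Sum>j<Suc (length rs). vec_index b j * ((-1) ^ (length rs + j) * det (M j)))"
    and "det_rows (b # rs) = (\<Sum>j<Suc (length rs). vec_index b j * ((-1) ^ j * det (M j)))"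
proof -
  let ?n = "length rs"
  let ?L = "mat_of_rows (Suc ?n) (rs @ [b])" and ?F = "mat_of_rows (Suc ?n) (b # rs)"
  have L: "?L \<in> carrier_mat (Suc ?n) (Suc ?n)" and F: "?F \<in> carrier_mat (Suc ?n) (Suc ?n)"
    by (auto simp: mat_of_rows_def)
  have "mat_delete ?L ?n j = M j" if "j < Suc ?n" for j
    unfolding mat_delete_def M_def mat_of_rows_def
    by (rule eq_matI) (use that in \<open>auto simp: nth_append\<close>)
  then have 1: "cofactor ?L ?n j = (-1) ^ (?n + j) * det (M j)" if "j < Suc ?n" for j
    using that unfolding cofactor_def by simp
  have "mat_delete ?F 0 j = M j" if "j < Suc ?n" for j
    unfolding mat_delete_def M_def mat_of_rows_def
    by (rule eq_matI) (use that in auto)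
  then have 2: "cofactor ?F 0 j = (-1) ^ j * det (M j)" if "j < Suc ?n" for j
    using that unfolding cofactor_def by simp
  have "det ?L = (\<Sum>j<Suc ?n. ?L $$ (?n, j) * cofactor ?L ?n j)"
    by (rule laplace_expansion_row[OF L]) simp
  then show "det_rows (rs @ [b]) = (\<Sum>j<Suc ?n. vec_index b j * ((-1) ^ (?n + j) * det (M j)))"
    unfolding det_rows_def using 1 by (simp add: mat_of_rows_def)
  have "det ?F = (\<Sum>j<Suc ?n. ?F $$ (0, j) * cofactor ?F 0 j)"
    by (rule laplace_expansion_row[OF F]) simp
  then show "det_rows (b # rs) = (\<Sum>j<Suc ?n. vec_index b j * ((-1) ^ j * det (M j)))"
    unfolding det_rows_def using 2 by (simp add: mat_of_rows_def)
qed

lemma det_rows_rotate: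
  assumes "dim_vec b = Suc (length rs)"
  shows "det_rows (rs @ [b]) = (-1) ^ length rs * det_rows (b # rs)"
  unfolding det_rows_laplace[OF assms] by (simp add: sum_distrib_left power_add mult_ac del: sum.lessThan_Suc)

text \<open>The factor s avoids a division where only a multiple of b is known as a combination of
  rows.\<close>

lemma det_rows_linear:
  assumes "finite I" "dim_vec b = Suc (length rs)" "\<And>i. i \<in> I \<Longrightarrow> dim_vec (v i) = Suc (length rs)"
    and "\<And>p. p < Suc (length rs) \<Longrightarrow> s * vec_index b p = (\<Sum>i\<in>I. c i * vec_index (v i) p)"
  shows "s * det_rows (rs @ [b]) = (\<Sum>i\<in>I. c i * det_rows (rs @ [v i]))"
proof -
  define C where "C j = (-1) ^ (length rs + j) *
    det (mat (length rs) (length rs) (\<lambda>(i', j'). vec_index (rs ! i') (if j' < j then j' else Suc j')))" for j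
  have "s * det_rows (rs @ [b]) = (\<Sum>j<Suc (length rs). s * vec_index b j * C j)"
    unfolding C_def det_rows_laplace(1)[OF assms(2)] by (simp add: sum_distrib_left mult.assoc del: sum.lessThan_Suc)
  also have "\<dots> = (\<Sum>j<Suc (length rs). \<Sum>i\<in>I. c i * (vec_index (v i) j * C j))"
    by (intro sum.cong) (auto simp: assms(4) sum_distrib_right mult.assoc simp del: sum.lessThan_Suc)
  also have "\<dots> = (\<Sum>i\<in>I. c i * (\<Sum>j<Suc (length rs). vec_index (v i) j * C j))"
    by (subst sum.swap) (simp add: sum_distrib_left del: sum.lessThan_Suc)
  also have "\<dots> = (\<Sum>i\<in>I. c i * det_rows (rs @ [v i]))"
    using assms(3) unfolding C_def by (simp add: det_rows_laplace(1) del: sum.lessThan_Suc)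
  finally show ?thesis .
qed

lemma det_rows_repeat:
  assumes "b \<in> set rs" "\<And>r. r \<in> set rs \<Longrightarrow> dim_vec r = Suc (length rs)"
  shows "det_rows (rs @ [b]) = 0"
proof -
  obtain i where i: "i < length rs" "rs ! i = b" using assms(1) by (meson in_set_conv_nth)
  let ?A = "mat_of_rows (Suc (length rs)) (rs @ [b])"
  have A: "?A \<in> carrier_mat (Suc (length rs)) (Suc (length rs))" by (auto simp: mat_of_rows_def)
  have "row ?A i = row ?A (length rs)"
    using i by (intro eq_vecI) (auto simp: mat_of_rows_def nth_append)
  then have "det ?A = 0"
    using i by (intro det_identical_rows[OF A, of i "length rs"]) auto
  then show ?thesis unfolding det_rows_def by simp
qed

lemma det_rows_unit_last:
  assumes "dim_vec b = Suc (length rs)" "\<And>p. p < length rs \<Longrightarrow> vec_index b p = 0"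
    and "\<And>r. r \<in> set rs \<Longrightarrow> dim_vec r = length rs"
    and "length cs = length rs"
  shows "det_rows (map (\<lambda>(r, c). r @\<^sub>v vec_of_list [c]) (zip rs cs) @ [b]) = vec_index b (length rs) * det_rows rs"
proof -
  let ?rs = "map (\<lambda>(r, c). r @\<^sub>v vec_of_list [c]) (zip rs cs)"
  have len: "length ?rs = length rs" using assms(4) by simp
  have m: "mat (length rs) (length rs) (\<lambda>(i', j'). vec_index (?rs ! i') j') = mat_of_rows (length rs) rs"
    by (rule eq_matI) (use assms(3,4) in \<open>auto simp: mat_of_rows_def\<close>)
  have "det_rows (?rs @ [b]) = (\<Sum>j<Suc (length rs). vec_index b j * ((-1) ^ (length rs + j) *
      det (mat (length rs) (length rs) (\<lambda>(i', j'). vec_index (?rs ! i') (if j' < j then j' else Suc j')))))"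
    using det_rows_laplace(1)[of b ?rs] assms(1) len by (simp del: sum.lessThan_Suc)
  also have "\<dots> = vec_index b (length rs) * ((-1) ^ (length rs + length rs) *
      det (mat (length rs) (length rs) (\<lambda>(i', j'). vec_index (?rs ! i') (if j' < length rs then j' else Suc j'))))"
    using assms(2) by simp
  also have "mat (length rs) (length rs) (\<lambda>(i', j'). vec_index (?rs ! i') (if j' < length rs then j' else Suc j'))
     = mat_of_rows (length rs) rs"
    unfolding m[symmetric] by (rule eq_matI) auto
  finally show ?thesis unfolding det_rows_def by (simp flip: mult_2)
qed

text \<open>The bound on l makes the natural subtraction l - 2 NG exact, and NG \<ge> 1 separates
  the first row index from the last.\<close>

locale row_system =
  fixes A :: "nat \<Rightarrow> complex Matrix.vec" and NG NC l :: nat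
  assumes dimA: "\<And>k. dim_vec (A k) = 2 * NG + 2 * NC" and N: "NG \<ge> 1" and l: "l \<ge> 2 * NG"
begin

abbreviation "lo \<equiv> l - 2 * NG"
abbreviation "hi \<equiv> l + 2 * NC"

lemma upts: "[lo..<hi] = lo # [lo + 1..<hi]" "[lo..<hi + 1] = [lo..<hi] @ [hi]"
  "[l + 1 - 2 * NG..<l + 1 + 2 * NC] = [lo + 1..<hi] @ [hi]"
  using N l by (auto simp: upt_conv_Cons Suc_diff_le)

lemma lens: "length [lo..<hi] = 2 * NG + 2 * NC" "Suc (length [lo + 1..<hi]) = 2 * NG + 2 * NC"
  using N l by auto

lemma sum_split:
  "(\<Sum>k\<in>{lo..hi}. f k) = f lo + (\<Sum>k\<in>{lo<..<hi}. f k) + (f hi :: complex)"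
proof -
  have "{lo..hi} = insert lo (insert hi {lo<..<hi})" "lo \<noteq> hi" using N l by auto
  then show ?thesis by simp
qed

text \<open>Modulo the rows strictly between, which the determinant already contains, s b is a
  multiple of the row at \<open>lo\<close>; moving that row to the top completes the block of
  \<open>tau\<close>.\<close>

lemma border_row:
  assumes "dim_vec b = 2 * NG + 2 * NC"
    and "\<And>p. p < 2 * NG + 2 * NC \<Longrightarrow> s * vec_index b p = \<beta> * vec_index (A lo) p + (\<Sum>k\<in>{lo<..<hi}. d k * vec_index (A k) p)"
  shows "s * det_border_row A b NG NC l = - \<beta> * tau A NG NC l"
proof -
  let ?rs = "map A [lo + 1..<hi]"
  have len: "Suc (length ?rs) = 2 * NG + 2 * NC" using lens by simp
  have z: "det_rows (?rs @ [A k]) = 0" if "k \<in> {lo<..<hi}" for k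
    by (rule det_rows_repeat) (use that len dimA in auto)
  \<comment> \<open>The row moves past 2 NG + 2 NC - 1 others, an odd number, whence the minus
    sign.\<close>
  have odd: "odd (length ?rs)" using len by (metis even_Suc even_add even_mult_iff even_numeral)
  have "s * det_rows (?rs @ [b]) = (\<Sum>k\<in>insert lo {lo<..<hi}. (if k = lo then \<beta> else d k) * det_rows (?rs @ [A k]))"
    by (rule det_rows_linear) (use assms len dimA in auto)
  also have "\<dots> = \<beta> * det_rows (?rs @ [A lo])" using z by simp
  also have "det_rows (?rs @ [A lo]) = - det_rows (A lo # ?rs)"
    using det_rows_rotate[of "A lo" ?rs] odd len dimA by simp
  also have "det_rows (A lo # ?rs) = tau A NG NC l"
    unfolding tau_def upts(1) by simp
  finally show ?thesis unfolding det_border_row_def by simp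
qed

context
  fixes \<omega> :: "nat \<Rightarrow> complex"
  assumes \<omega>: "\<And>p. p < 2 * NG + 2 * NC \<Longrightarrow> (\<Sum>k\<in>{lo..hi}. \<omega> k * vec_index (A k) p) = 0"
begin

text \<open>Cramer's rule: replacing the last row by the combination of all rows with coefficients
  \<omega> multiplies the determinant by \<omega> at \<open>hi\<close>, and the new row is 0 except
  in the last column.\<close>

lemma border_col:
  "\<omega> hi * det_border_col A c NG NC l = tau A NG NC l * (\<Sum>k\<in>{lo..hi}. \<omega> k * c k)"
proof -
  let ?n = "2 * NG + 2 * NC"
  let ?R = "\<lambda>k. A k @\<^sub>v vec_of_list [c k]" and ?rs = "map A [lo..<hi]" and ?cs = "map c [lo..<hi]"
  let ?b = "Matrix.vec (Suc ?n) (\<lambda>p. \<Sum>k\<in>{lo..hi}. \<omega> k * vec_index (?R k) p)"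
  have R: "map ?R [lo..<hi] = map (\<lambda>(r, c). r @\<^sub>v vec_of_list [c]) (zip ?rs ?cs)"
    by (simp add: zip_map_map zip_same_conv_map)
  have len: "length (map ?R [lo..<hi]) = ?n" "length ?rs = ?n" using lens by simp_all
  have dR: "dim_vec (?R k) = Suc ?n" for k using dimA by simp
  have "1 * det_rows (map ?R [lo..<hi] @ [?b]) = (\<Sum>k\<in>{lo..hi}. \<omega> k * det_rows (map ?R [lo..<hi] @ [?R k]))"
    by (rule det_rows_linear) (use len dR in auto)
  also have "\<dots> = \<omega> hi * det_rows (map ?R [lo..<hi] @ [?R hi])"
  proof -
    have "det_rows (map ?R [lo..<hi] @ [?R k]) = 0" if "k \<in> {lo..<hi}" for k
      by (rule det_rows_repeat) (use that len dR in auto)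
    then have "(\<Sum>k\<in>{lo..<hi}. \<omega> k * det_rows (map ?R [lo..<hi] @ [?R k])) = 0" by (intro sum.neutral) simp
    moreover have "{lo..hi} = insert hi {lo..<hi}" using N l by auto
    ultimately show ?thesis by simp
  qed
  also have "map ?R [lo..<hi] @ [?R hi] = map ?R [lo..<hi + 1]" unfolding upts(2) by simp
  finally have 1: "det_rows (map ?R [lo..<hi] @ [?b]) = \<omega> hi * det_border_col A c NG NC l"
    unfolding det_border_col_def by simp
  have "det_rows (map ?R [lo..<hi] @ [?b]) = vec_index ?b (length ?rs) * det_rows ?rs"
    unfolding R
  proof (rule det_rows_unit_last)
    show "vec_index ?b p = 0" if "p < length ?rs" for p
      using that \<omega>[of p] len dimA by simp
  qed (use len dimA in auto)
  also have "vec_index ?b (length ?rs) = (\<Sum>k\<in>{lo..hi}. \<omega> k * c k)"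
    using len dimA by simp
  finally show ?thesis using 1 unfolding tau_def by (simp add: mult.commute)
qed

text \<open>The linear relation expresses the row at \<open>hi\<close> through the row at
  \<open>lo\<close> and those between, so the window of rows can be advanced by one.\<close>

lemma tau_step: "\<omega> hi * tau A NG NC (l + 1) = \<omega> lo * tau A NG NC l"
proof -
  have "\<omega> hi * det_border_row A (A hi) NG NC l = - (- \<omega> lo) * tau A NG NC l"
  proof (rule border_row[where d = "\<lambda>k. - \<omega> k"])
    fix p assume "p < 2 * NG + 2 * NC"
    from \<omega>[OF this, unfolded sum_split]
    have "\<omega> hi * vec_index (A hi) p = - (\<omega> lo * vec_index (A lo) p + (\<Sum>k\<in>{lo<..<hi}. \<omega> k * vec_index (A k) p))"
      by (simp only: eq_neg_iff_add_eq_0 add_ac)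
    then show "\<omega> hi * vec_index (A hi) p = - \<omega> lo * vec_index (A lo) p + (\<Sum>k\<in>{lo<..<hi}. - \<omega> k * vec_index (A k) p)"
      by (simp add: sum_negf)
  qed (rule dimA)
  moreover have "det_border_row A (A hi) NG NC l = tau A NG NC (l + 1)"
    unfolding det_border_row_def tau_def upts(3) by simp
  ultimately show ?thesis by simp
qed

end

end

section \<open>Taylor coefficients and jets\<close>

definition tcoeff :: "(complex \<Rightarrow> complex) \<Rightarrow> complex \<Rightarrow> nat \<Rightarrow> complex" where
  "tcoeff f a q = (deriv ^^ q) f a / fact q"

lemma tcoeff_fps:
  assumes "(\<lambda>x. f (a + x)) has_fps_expansion F"
  shows "tcoeff f a q = fps_nth F q"
proof -
  have "(deriv ^^ q) f a = (deriv ^^ q) (\<lambda>x. f (a + x)) 0"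
    using higher_deriv_shift_0[of q f a] by (simp add: o_def)
  then show ?thesis using fps_nth_fps_expansion[OF assms, of q] by (simp add: tcoeff_def)
qed

lemma tcoeff_expansion:
  "f analytic_on {a} \<Longrightarrow> (\<lambda>x. f (a + x)) has_fps_expansion fps_expansion f a"
  by (rule analytic_at_imp_has_fps_expansion)

lemma tcoeff_cong:
  assumes "open S" "a \<in> S" "\<And>w. w \<in> S \<Longrightarrow> f w = g w"
  shows "tcoeff f a q = tcoeff g a q"
proof -
  have "\<forall>\<^sub>F w in nhds a. f w = g w"
    using assms by (auto simp: eventually_nhds)
  then show ?thesis unfolding tcoeff_def by (simp add: higher_deriv_cong_ev[of f g a a q])
qed

lemma tcoeff_add:
  assumes "f analytic_on {a}" "g analytic_on {a}"
  shows "tcoeff (\<lambda>w. f w + g w) a q = tcoeff f a q + tcoeff g a q"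
  using tcoeff_fps[OF has_fps_expansion_add[OF assms[THEN tcoeff_expansion]], of q]
    tcoeff_fps[OF tcoeff_expansion[OF assms(1)], of q] tcoeff_fps[OF tcoeff_expansion[OF assms(2)], of q]
  by simp

lemma tcoeff_cmult:
  assumes "f analytic_on {a}"
  shows "tcoeff (\<lambda>w. c * f w) a q = c * tcoeff f a q"
  using tcoeff_fps[OF has_fps_expansion_cmult_left[OF tcoeff_expansion[OF assms], of c], of q]
    tcoeff_fps[OF tcoeff_expansion[OF assms], of q]
  by simp

lemma tcoeff_diff:
  assumes "f analytic_on {a}" "g analytic_on {a}"
  shows "tcoeff (\<lambda>w. f w - g w) a q = tcoeff f a q - tcoeff g a q"
  using tcoeff_fps[OF has_fps_expansion_diff[OF assms[THEN tcoeff_expansion]], of q]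
    tcoeff_fps[OF tcoeff_expansion[OF assms(1)], of q] tcoeff_fps[OF tcoeff_expansion[OF assms(2)], of q]
  by simp

text \<open>The vanishing of jets at the zeros of a factor and the triangular shape of the blocks of
  \<open>ell_matrix\<close> both come from this shift of coefficients.\<close>

lemma tcoeff_shift:
  assumes "g analytic_on {a}"
  shows "tcoeff (\<lambda>w. (w - a) ^ s * g w) a q = (if q < s then 0 else tcoeff g a (q - s))"
proof -
  have "(\<lambda>x. (a + x - a) ^ s * g (a + x)) has_fps_expansion fps_X ^ s * fps_expansion g a"
    by (intro has_fps_expansion_mult tcoeff_expansion assms) (simp add: has_fps_expansion_fps_X_power)
  from tcoeff_fps[OF this, of q] show ?thesis
    using tcoeff_fps[OF tcoeff_expansion[OF assms], of "q - s"] by (simp add: fps_X_power_mult_nth)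
qed

text \<open>The geometric series in (w - a) / (c - a), obtained from the derivatives at all points
  other than c.\<close>

lemma tcoeff_inverse_linear:
  assumes "c \<noteq> a"
  shows "tcoeff (\<lambda>w. 1 / (c - w)) a q = 1 / (c - a) ^ (q + 1)"
proof -
  have "\<forall>w\<in>- {c}. (deriv ^^ q) (\<lambda>w. 1 / (c - w)) w = fact q / (c - w) ^ (q + 1)"
  proof (induction q)
    case (Suc q)
    show ?case
    proof
      fix w assume w: "w \<in> - {c}"
      have "((\<lambda>w. fact q * inverse (c - w) ^ Suc q) has_field_derivative
          fact q * ((1 + of_nat q) * (- (inverse (c - w) * (0 - 1) * inverse (c - w)) * inverse (c - w) ^ q))) (at w)"
        using w by (intro DERIV_cmult DERIV_power_Suc DERIV_inverse' DERIV_diff DERIV_const DERIV_ident) auto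
      moreover have "fact q * ((1 + of_nat q) * (- (inverse (c - w) * (0 - 1) * inverse (c - w)) * inverse (c - w) ^ q))
         = fact (Suc q) / (c - w) ^ (Suc q + 1)"
      proof -
        define r where "r = inverse (c - w)"
        have "fact (Suc q) / (c - w) ^ (Suc q + 1) = fact (Suc q) * r ^ (Suc q + 1)"
          unfolding r_def by (simp only: divide_inverse power_inverse)
        then show ?thesis unfolding r_def[symmetric] by (simp add: algebra_simps)
      qed
      ultimately have "((\<lambda>w. fact q * inverse (c - w) ^ Suc q) has_field_derivative fact (Suc q) / (c - w) ^ (Suc q + 1)) (at w)"
        by simp
      then have "((deriv ^^ q) (\<lambda>w. 1 / (c - w)) has_field_derivative fact (Suc q) / (c - w) ^ (Suc q + 1)) (at w)"
        by (rule has_field_derivative_transform_within_open[of _ _ _ "- {c}"])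
           (use w Suc in \<open>auto simp: divide_inverse power_inverse\<close>)
      from DERIV_imp_deriv[OF this]
      show "(deriv ^^ Suc q) (\<lambda>w. 1 / (c - w)) w = fact (Suc q) / (c - w) ^ (Suc q + 1)" by simp
    qed
  qed simp
  then show ?thesis using assms unfolding tcoeff_def by simp
qed

lemma tcoeff_cnj:
  assumes "open S" "f holomorphic_on S" "a \<in> S"
  shows "tcoeff (\<lambda>z. cnj (f (cnj z))) (cnj a) q = cnj (tcoeff f a q)"
proof -
  have "\<forall>a\<in>S. (deriv ^^ q) (\<lambda>z. cnj (f (cnj z))) (cnj a) = cnj ((deriv ^^ q) f a)"
  proof (induction q)
    case (Suc q)
    show ?case
    proof
      fix a assume a: "a \<in> S"
      have o: "open (cnj -` S)" by (intro continuous_open_vimage assms(1) continuous_intros)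
      have "((deriv ^^ q) f has_field_derivative deriv ((deriv ^^ q) f) a) (at a)"
        by (rule holomorphic_derivI[OF holomorphic_higher_deriv[OF assms(2,1)] assms(1) a])
      then have "((cnj \<circ> (deriv ^^ q) f \<circ> cnj) has_field_derivative cnj (deriv ((deriv ^^ q) f) a)) (at (cnj a))"
        by (intro has_field_derivative_cnj_cnj) simp
      then have "((deriv ^^ q) (\<lambda>z. cnj (f (cnj z))) has_field_derivative cnj (deriv ((deriv ^^ q) f) a)) (at (cnj a))"
        by (rule has_field_derivative_transform_within_open[OF _ o])
           (use a Suc in \<open>auto dest: bspec[of _ _ "cnj _"]\<close>)
      from DERIV_imp_deriv[OF this]
      show "(deriv ^^ Suc q) (\<lambda>z. cnj (f (cnj z))) (cnj a) = cnj ((deriv ^^ Suc q) f a)" by simp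
    qed
  qed simp
  then show ?thesis using assms(3) unfolding tcoeff_def by simp
qed

lemma cmv_holomorphic: "cmv k holomorphic_on - {0}"
  unfolding cmv_eq_powi by (intro holomorphic_intros) auto

lemma laurent_fun_holomorphic:
  assumes "laurent_fun f"
  shows "f holomorphic_on - {0}"
proof -
  obtain n c where c: "\<And>z. z \<noteq> 0 \<Longrightarrow> f z = (\<Sum>i<n. c i * cmv i z)"
    using assms unfolding laurent_fun_def in_span_def by blast
  have "(\<lambda>z. \<Sum>i<n. c i * cmv i z) holomorphic_on - {0}"
    by (intro holomorphic_intros cmv_holomorphic)
  then show ?thesis by (rule holomorphic_transform) (use c in auto)
qed

lemma holomorphic_analytic_at: "f holomorphic_on S \<Longrightarrow> open S \<Longrightarrow> a \<in> S \<Longrightarrow> f analytic_on {a}"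
  using analytic_at by blast

lemma laurent_fun_analytic: "laurent_fun f \<Longrightarrow> a \<noteq> 0 \<Longrightarrow> f analytic_on {a}"
  by (rule holomorphic_analytic_at[OF laurent_fun_holomorphic]) auto

lemma leval_holomorphic: "leval L holomorphic_on - {0}"
  unfolding leval_def[abs_def] by (intro holomorphic_intros) auto

lemma lbracket_holomorphic: "lbracket L N zs j holomorphic_on - {0}"
  unfolding lbracket_def[abs_def] by (intro holomorphic_intros) auto

lemma tcoeff_sum:
  assumes "\<And>i. i \<in> A \<Longrightarrow> f i analytic_on {a}"
  shows "tcoeff (\<lambda>w. \<Sum>i\<in>A. c i * f i w) a q = (\<Sum>i\<in>A. c i * tcoeff (f i) a q)"
  using assms
proof (induction A rule: infinite_finite_induct)
  case (insert x A)
  have "tcoeff (\<lambda>w. c x * f x w + (\<Sum>i\<in>A. c i * f i w)) a q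
      = tcoeff (\<lambda>w. c x * f x w) a q + tcoeff (\<lambda>w. \<Sum>i\<in>A. c i * f i w) a q"
    using insert.prems by (intro tcoeff_add analytic_on_sum analytic_on_mult analytic_on_const) auto
  then show ?case using insert by (simp add: tcoeff_cmult)
qed (simp_all add: tcoeff_def)

lemma set_jet_index: "set (jet_index zs) = (SIGMA i:{..<length zs}. {..<snd (zs ! i)})"
  unfolding jet_index_def by auto

lemma jet_index_nth:
  assumes "p < length (jet_index zs)"
  shows "fst (jet_index zs ! p) < length zs" "snd (jet_index zs ! p) < snd (zs ! fst (jet_index zs ! p))"
  using nth_mem[OF assms] unfolding set_jet_index by auto

lemma sum_jet_index:
  "(\<Sum>p<length (jet_index zs). f (jet_index zs ! p)) = (\<Sum>i<length zs. \<Sum>k<snd (zs ! i). (f (i, k) :: complex))"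
proof -
  have c: "sum_list (map f (concat xss)) = sum_list (map (\<lambda>xs. sum_list (map f xs)) xss)" for xss
    by (induction xss) auto
  have "(\<Sum>p<length (jet_index zs). f (jet_index zs ! p)) = sum_list (map f (jet_index zs))"
    by (simp add: sum_list_sum_nth atLeast0LessThan)
  also have "\<dots> = (\<Sum>i<length zs. \<Sum>k<snd (zs ! i). f (i, k))"
    unfolding jet_index_def c by (simp add: o_def interv_sum_list_conv_sum_set_nat atLeast0LessThan)
  finally show ?thesis .
qed

lemma length_jet_index: "length (jet_index zs) = (\<Sum>i<length zs. snd (zs ! i))"
  unfolding jet_index_def
  by (simp add: length_concat o_def interv_sum_list_conv_sum_set_nat atLeast0LessThan)

lemma dim_jet: "dim_vec (jet f zs) = length (jet_index zs)"
  unfolding jet_def by simp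

lemma jet_nth:
  assumes "p < length (jet_index zs)"
  shows "vec_index (jet f zs) p = tcoeff f (fst (zs ! fst (jet_index zs ! p))) (snd (jet_index zs ! p))"
  using assms unfolding jet_def tcoeff_def by (simp add: vec_of_list_index split_beta)

text \<open>The list \<open>J\<close> names the flattened positions by block label and inner index.
  An arbitrary list of labels lets the induction go through; distinctness keeps the first block
  apart from the rest.\<close>

lemma diag_block_mat_index:
  fixes B :: "nat \<Rightarrow> complex mat"
  assumes "\<And>i. i \<in> set is \<Longrightarrow> B i \<in> carrier_mat (m i) (m i)" "distinct is"
  defines "J \<equiv> concat (map (\<lambda>i. map (Pair i) [0..<m i]) is)"
  shows "diag_block_mat (map B is) \<in> carrier_mat (length J) (length J) \<and>
    (\<forall>p<length J. \<forall>p'<length J. diag_block_mat (map B is) $$ (p, p') =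
       (if fst (J ! p) = fst (J ! p') then B (fst (J ! p)) $$ (snd (J ! p), snd (J ! p')) else 0))"
  unfolding J_def using assms(1,2)
proof (induction "is")
  case (Cons i "is")
  define Jr where "Jr = concat (map (\<lambda>i. map (Pair i) [0..<m i]) is)"
  let ?D = "diag_block_mat (map B is)"
  have D: "?D \<in> carrier_mat (length Jr) (length Jr)"
    and E: "\<And>p p'. p < length Jr \<Longrightarrow> p' < length Jr \<Longrightarrow> ?D $$ (p, p') =
       (if fst (Jr ! p) = fst (Jr ! p') then B (fst (Jr ! p)) $$ (snd (Jr ! p), snd (Jr ! p')) else 0)"
    using Cons unfolding Jr_def by auto
  have Bi: "B i \<in> carrier_mat (m i) (m i)" using Cons by auto
  have ne: "fst (Jr ! p) \<noteq> i" if "p < length Jr" for p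
  proof -
    have "Jr ! p \<in> set Jr" using that by (rule nth_mem)
    then show ?thesis using Cons.prems(2) by (auto simp: Jr_def)
  qed
  have eq: "diag_block_mat (map B (i # is)) = four_block_mat (B i) (0\<^sub>m (m i) (length Jr)) (0\<^sub>m (length Jr) (m i)) ?D"
    using Bi D by (simp add: Let_def)
  have K: "concat (map (\<lambda>i. map (Pair i) [0..<m i]) (i # is)) = map (Pair i) [0..<m i] @ Jr"
    by (simp add: Jr_def)
  show ?case
    unfolding eq K
  proof (intro conjI allI impI)
    let ?K = "map (Pair i) [0..<m i] @ Jr"
    show "four_block_mat (B i) (0\<^sub>m (m i) (length Jr)) (0\<^sub>m (length Jr) (m i)) ?D \<in> carrier_mat (length ?K) (length ?K)"
      using Bi D by auto
    fix p p' assume "p < length ?K" "p' < length ?K"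
    then have p: "p < m i + length Jr" "p' < m i + length Jr" by auto
    have K: "?K ! p = (if p < m i then (i, p) else Jr ! (p - m i))" for p
      by (auto simp: nth_append)
    show "four_block_mat (B i) (0\<^sub>m (m i) (length Jr)) (0\<^sub>m (length Jr) (m i)) ?D $$ (p, p') =
       (if fst (?K ! p) = fst (?K ! p') then B (fst (?K ! p)) $$ (snd (?K ! p), snd (?K ! p')) else 0)"
    proof -
      have lt: "\<not> p < m i \<Longrightarrow> p - m i < length Jr" "\<not> p' < m i \<Longrightarrow> p' - m i < length Jr"
        using p by auto
      show ?thesis
        unfolding K using p Bi D lt ne[OF lt(1)] ne[OF lt(2)] E[OF lt]
        by (cases "p < m i"; cases "p' < m i") auto
    qed
  qed
qed auto

lemma ell_block_diag:
  "ell_matrix L N zs \<in> carrier_mat (length (jet_index zs)) (length (jet_index zs)) \<and>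
    (\<forall>p<length (jet_index zs). \<forall>p'<length (jet_index zs). ell_matrix L N zs $$ (p, p') =
     (if fst (jet_index zs ! p) = fst (jet_index zs ! p')
      then ell_block L N zs (fst (jet_index zs ! p)) $$ (snd (jet_index zs ! p), snd (jet_index zs ! p')) else 0))"
proof -
  have B: "ell_block L N zs i \<in> carrier_mat (snd (zs ! i)) (snd (zs ! i))" for i
    unfolding ell_block_def Let_def by simp
  have J: "jet_index zs = concat (map (\<lambda>i. map (Pair i) [0..<snd (zs ! i)]) [0..<length zs])"
    unfolding jet_index_def ..
  show ?thesis
    using diag_block_mat_index[of "[0..<length zs]" "ell_block L N zs" "\<lambda>i. snd (zs ! i)", OF B distinct_upt, folded J]
    unfolding ell_matrix_def .
qed

lemma ell_matrix_carrier: "ell_matrix L N zs \<in> carrier_mat (length (jet_index zs)) (length (jet_index zs))"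
  using ell_block_diag by (rule conjunct1)

lemma ell_matrix_index:
  assumes "p < length (jet_index zs)" "p' < length (jet_index zs)"
  shows "ell_matrix L N zs $$ (p, p') =
    (let (j, k) = jet_index zs ! p; (i, q) = jet_index zs ! p' in
      if j = i \<and> k + q \<ge> snd (zs ! i) - 1 then ell L N zs i (k + q - (snd (zs ! i) - 1)) else 0)"
  using ell_block_diag[of L N zs] assms jet_index_nth[OF assms(1)] jet_index_nth[OF assms(2)]
  unfolding ell_block_def by (auto simp: Let_def split_beta)

lemma row_mult_index:
  assumes "M \<in> carrier_mat n n'" "dim_vec v = n" "p < n'"
  shows "vec_index (row_mult v M) p = (\<Sum>j<n. vec_index v j * M $$ (j, p))"
  using assms unfolding row_mult_def
  by (simp add: scalar_prod_def atLeast0LessThan mult.commute)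

lemma dim_row_mult: "M \<in> carrier_mat n n' \<Longrightarrow> dim_vec (row_mult v M) = n'"
  unfolding row_mult_def by simp

section \<open>The perturbed form\<close>

text \<open>The mass terms as a sesquilinear expression in jets, with positions standing for pairs
  of zero and order. In this shape they can be compared with the products of a jet with Xi and
  \<open>ell_matrix\<close>.\<close>

definition mass_form :: "(complex \<times> nat) list \<Rightarrow> (nat \<Rightarrow> nat \<Rightarrow> nat \<Rightarrow> nat \<Rightarrow> complex) \<Rightarrow> sesqform" where
  "mass_form zs X f g =
    (\<Sum>p<length (jet_index zs). \<Sum>p'<length (jet_index zs). mass_matrix zs X $$ (p, p') *
       tcoeff f (fst (zs ! fst (jet_index zs ! p))) (snd (jet_index zs ! p)) *
       cnj (tcoeff g (inverse (cnj (fst (zs ! fst (jet_index zs ! p'))))) (snd (jet_index zs ! p'))))"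

lemma perturbed_form_eq:
  "perturbed_form u LC LG zs X f g =
     pairing u (\<lambda>z. leval LC z / leval LG z * (f z * cnj (g z))) + mass_form zs X f g"
proof -
  let ?J = "jet_index zs" and ?a = "\<lambda>i. fst (zs ! i)"
  let ?t = "\<lambda>i k j l. X i k j l * tcoeff f (?a i) k * cnj (tcoeff g (inverse (cnj (?a j))) l)"
  have "mass_form zs X f g = (\<Sum>p<length ?J. \<Sum>p'<length ?J. ?t (fst (?J ! p)) (snd (?J ! p)) (fst (?J ! p')) (snd (?J ! p')))"
    unfolding mass_form_def mass_matrix_def by (intro sum.cong) auto
  also have "\<dots> = (\<Sum>p<length ?J. \<Sum>j<length zs. \<Sum>l<snd (zs ! j). ?t (fst (?J ! p)) (snd (?J ! p)) j l)"
  proof (rule sum.cong[OF refl])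
    fix p
    show "(\<Sum>p'<length ?J. ?t (fst (?J ! p)) (snd (?J ! p)) (fst (?J ! p')) (snd (?J ! p')))
      = (\<Sum>j<length zs. \<Sum>l<snd (zs ! j). ?t (fst (?J ! p)) (snd (?J ! p)) j l)"
      using sum_jet_index[where zs = zs and f = "\<lambda>x. ?t (fst (?J ! p)) (snd (?J ! p)) (fst x) (snd x)"] by simp
  qed
  also have "\<dots> = (\<Sum>i<length zs. \<Sum>k<snd (zs ! i). \<Sum>j<length zs. \<Sum>l<snd (zs ! j). ?t i k j l)"
    using sum_jet_index[where zs = zs and f = "\<lambda>x. \<Sum>j<length zs. \<Sum>l<snd (zs ! j). ?t (fst x) (snd x) j l"] by simp
  also have "\<dots> = (\<Sum>i<length zs. \<Sum>j<length zs. \<Sum>k<snd (zs ! i). \<Sum>l<snd (zs ! j). ?t i k j l)"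
    by (intro sum.cong refl sum.swap)
  also have "\<dots> = (\<Sum>i<length zs. \<Sum>j<length zs. \<Sum>k<snd (zs ! i). \<Sum>l<snd (zs ! j).
        1 / (fact k * fact l) * X i k j l * (deriv ^^ k) f (fst (zs ! i)) *
        cnj ((deriv ^^ l) g (inverse (cnj (fst (zs ! j))))))"
    unfolding tcoeff_def by (intro sum.cong refl) (simp add: field_simps)
  finally show ?thesis unfolding perturbed_form_def by simp
qed

lemma sesquilinear_form_add:
  assumes "sesquilinear_form F" "sesquilinear_form G"
  shows "sesquilinear_form (\<lambda>f g. F f g + G f g)"
proof -
  have c: "F f g + G f g = F f' g' + G f' g'" if "laurent_fun f" "laurent_fun g" "\<forall>z. z \<noteq> 0 \<longrightarrow> f z = f' z" "\<forall>z. z \<noteq> 0 \<longrightarrow> g z = g' z" for f f' g g'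
  proof -
    have "F f g = F f' g'" using assms(1) that unfolding sesquilinear_form_def by blast
    moreover have "G f g = G f' g'" using assms(2) that unfolding sesquilinear_form_def by blast
    ultimately show ?thesis by simp
  qed
  show ?thesis
    using assms c unfolding sesquilinear_form_def by (auto simp: algebra_simps)
qed

lemma tcoeff_laurent_fun_cong:
  "a \<noteq> 0 \<Longrightarrow> (\<And>z. z \<noteq> 0 \<Longrightarrow> f z = g z) \<Longrightarrow> tcoeff f a q = tcoeff g a q"
  by (rule tcoeff_cong[of "- {0}"]) auto

lemma sesquilinear_form_sum:
  "(\<And>i. i \<in> A \<Longrightarrow> sesquilinear_form (B i)) \<Longrightarrow> sesquilinear_form (\<lambda>f g. \<Sum>i\<in>A. B i f g)"
  by (induction A rule: infinite_finite_induct)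
     (auto intro: sesquilinear_form_add, auto simp: sesquilinear_form_def)

lemma sesquilinear_tcoeff:
  assumes "a \<noteq> 0" "b \<noteq> 0"
  shows "sesquilinear_form (\<lambda>f g. c * tcoeff f a q * cnj (tcoeff g b q'))"
  unfolding sesquilinear_form_def
proof (intro conjI allI impI)
  fix f f' g g' :: "complex \<Rightarrow> complex" assume "\<forall>z. z \<noteq> 0 \<longrightarrow> f z = f' z" "\<forall>z. z \<noteq> 0 \<longrightarrow> g z = g' z"
  then show "c * tcoeff f a q * cnj (tcoeff g b q') = c * tcoeff f' a q * cnj (tcoeff g' b q')"
    using tcoeff_laurent_fun_cong[OF assms(1), of f f'] tcoeff_laurent_fun_cong[OF assms(2), of g g'] by simp
qed (simp_all add: tcoeff_add tcoeff_cmult laurent_fun_analytic assms algebra_simps)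

lemma sesquilinear_mass_form:
  assumes "\<And>i. i < length zs \<Longrightarrow> fst (zs ! i) \<noteq> 0"
  shows "sesquilinear_form (mass_form zs X)"
  unfolding mass_form_def[abs_def] using assms[OF jet_index_nth(1)]
  by (intro sesquilinear_form_sum sesquilinear_tcoeff) auto

context circle_distribution
begin

lemma smooth_near_powi: "smooth_near u (\<lambda>w. w powi k)"
  unfolding power_int_def
  by (cases "k \<ge> 0") (auto intro!: smooth_near_power smooth_near_id smooth_near_inverse dest: supp_nz)

lemma smooth_near_leval: "smooth_near u (leval L)"
  unfolding leval_def[abs_def] by (intro smooth_near_sum smooth_near_mult smooth_near_const smooth_near_powi)

lemma supp_sub: "supp u \<subseteq> - {0}"
  using supp_nz by auto

lemma smooth_near_Lau: "laurent_fun f \<Longrightarrow> smooth_near u f"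
proof -
  assume "laurent_fun f"
  then obtain n c where c: "\<And>z. z \<noteq> 0 \<Longrightarrow> f z = (\<Sum>i<n. c i * cmv i z)"
    unfolding laurent_fun_def in_span_def by blast
  have "smooth_near u (\<lambda>z. \<Sum>i<n. c i * cmv i z)"
    unfolding cmv_eq_powi by (intro smooth_near_sum smooth_near_mult smooth_near_const smooth_near_powi)
  then show ?thesis
    by (rule smooth_near_cong[OF _ _ supp_sub]) (use c in auto)
qed

lemma pairing_cong0:
  assumes "\<And>z. z \<noteq> 0 \<Longrightarrow> f z = g z"
  shows "pairing u f = pairing u g"
  by (rule pairing_cong[OF _ supp_sub]) (use assms in auto)

lemma sesquilinear_pairing:
  assumes r: "smooth_near u r"
  shows "sesquilinear_form (\<lambda>f g. pairing u (\<lambda>z. r z * (f z * cnj (g z))))"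
  unfolding sesquilinear_form_def
proof (intro conjI allI impI)
  have n: "smooth_near u (\<lambda>z. r z * (f z * cnj (g z)))" if "laurent_fun f" "laurent_fun g" for f g
    using that by (intro smooth_near_mult r smooth_near_Lau smooth_near_cnj_comp)
  show "pairing u (\<lambda>z. r z * (f z * cnj (g z))) = pairing u (\<lambda>z. r z * (f' z * cnj (g' z)))"
    if "\<forall>z. z \<noteq> 0 \<longrightarrow> f z = f' z" "\<forall>z. z \<noteq> 0 \<longrightarrow> g z = g' z" for f f' g g'
    by (rule pairing_cong0) (use that in auto)
  show "pairing u (\<lambda>z. r z * ((f z + f' z) * cnj (g z)))
      = pairing u (\<lambda>z. r z * (f z * cnj (g z))) + pairing u (\<lambda>z. r z * (f' z * cnj (g z)))"
    if "laurent_fun f" "laurent_fun f'" "laurent_fun g" for f f' g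
    using pairing_add[OF n[OF that(1,3)] n[OF that(2,3)]] by (simp add: algebra_simps)
  show "pairing u (\<lambda>z. r z * (f z * cnj (g z + g' z)))
      = pairing u (\<lambda>z. r z * (f z * cnj (g z))) + pairing u (\<lambda>z. r z * (f z * cnj (g' z)))"
    if "laurent_fun f" "laurent_fun g" "laurent_fun g'" for f g g'
    using pairing_add[OF n[OF that(1,2)] n[OF that(1,3)]] by (simp add: algebra_simps)
  show "pairing u (\<lambda>z. r z * (a * f z * cnj (g z))) = a * pairing u (\<lambda>z. r z * (f z * cnj (g z)))"
    if "laurent_fun f" "laurent_fun g" for a f g
    using pairing_scale[OF n[OF that], of a] by (simp add: mult_ac)
  show "pairing u (\<lambda>z. r z * (f z * cnj (a * g z))) = cnj a * pairing u (\<lambda>z. r z * (f z * cnj (g z)))"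
    if "laurent_fun f" "laurent_fun g" for a f g
    using pairing_scale[OF n[OF that], of "cnj a"] by (simp add: mult_ac)
qed

lemma sesquilinear_zero_order: "sesquilinear_form (zero_order_form u)"
  using sesquilinear_pairing[OF smooth_near_const[of _ 1]] unfolding zero_order_form_def[abs_def] by simp

end

lemma (in toeplitz_distribution) circle_eq_leval: "circle_eq (\<lambda>w. leval L (inverse (cnj w))) (leval L)"
proof -
  have "circle_eq (\<lambda>w. \<Sum>j\<in>Poly_Mapping.keys L. lcoeff L j * inverse (cnj w) powi j)
      (\<lambda>w. \<Sum>j\<in>Poly_Mapping.keys L. lcoeff L j * w powi j)"
    by (intro circle_eq_sum circle_eq_mult circle_eq_const circle_eq_powi circle_eq_inv_cnj) (use supp_nz in auto)
  then show ?thesis by (simp add: leval_def[abs_def])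
qed

text \<open>Coprimality is recorded as \<open>no_common\<close>, a condition that passes directly to
  the reciprocals. Below, a position p stands for a zero \<open>zeta p\<close> of LG with a
  derivative order \<open>ord p\<close>, and \<open>alpha p\<close> is the corresponding zero of
  LGs.\<close>

locale geronimus_uvarov = toeplitz_distribution u
  for u :: "(complex \<Rightarrow> complex) \<Rightarrow> complex" +
  fixes LC LG :: laurent and NC NG :: nat and zC zG :: "(complex \<times> nat) list"
    and X :: "nat \<Rightarrow> nat \<Rightarrow> nat \<Rightarrow> nat \<Rightarrow> complex"
  assumes prepC: "prepared NC LC" and prepG: "prepared NG LG"
    and zerosC: "zeros_with_mult NC LC zC" and zerosG: "zeros_with_mult NG LG zG"
    and off_supp: "\<forall>a\<in>fst ` set zG. a \<notin> supp u"
    and no_common: "\<forall>a\<in>fst ` set zG. leval LC a \<noteq> 0"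
begin

abbreviation "LGs \<equiv> lrecip LG"
abbreviation "zGs \<equiv> map_zeros (\<lambda>a. inverse (cnj a)) zG"
abbreviation "J \<equiv> jet_index zG"
abbreviation "idx p \<equiv> fst (J ! p)"
abbreviation "ord p \<equiv> snd (J ! p)"
abbreviation "zeta p \<equiv> fst (zG ! idx p)"
abbreviation "alpha p \<equiv> inverse (cnj (zeta p))"
abbreviation "F \<equiv> zero_order_form u"
abbreviation "F' \<equiv> perturbed_form u LC LG zG X"
abbreviation "Xi \<equiv> mass_matrix zG X"
abbreviation "ellm \<equiv> ell_matrix LGs NG zGs"
abbreviation "rho z \<equiv> leval LC z / leval LG z"

lemma lenJ: "length J = 2 * NG" "length (jet_index zC) = 2 * NC"
  using zeros_poly(1)[OF prepG zerosG] zeros_poly(1)[OF prepC zerosC] by (simp_all add: length_jet_index)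

lemma zeta_facts:
  assumes "p < 2 * NG"
  shows "idx p < length zG" "ord p < snd (zG ! idx p)" "zeta p \<noteq> 0" "zeta p \<notin> supp u" "leval LC (zeta p) \<noteq> 0"
proof -
  show i: "idx p < length zG" "ord p < snd (zG ! idx p)"
    using jet_index_nth[of p zG] assms lenJ by auto
  then have "zeta p \<in> fst ` set zG" by auto
  then show "zeta p \<notin> supp u" "leval LC (zeta p) \<noteq> 0" using off_supp no_common by auto
  show "zeta p \<noteq> 0" by (rule zeros_nth(1)[OF zerosG i(1)])
qed

lemma LG_supp: "w \<in> supp u \<Longrightarrow> leval LG w \<noteq> 0"
  using leval_zero_imp[OF prepG zerosG] off_supp supp_nz by blast

lemma smooth_near_rho: "smooth_near u (\<lambda>z. rho z)"
  by (intro smooth_near_divide smooth_near_leval LG_supp)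

lemma sesquilinear_perturbed: "sesquilinear_form F'"
  unfolding perturbed_form_eq[abs_def]
  by (intro sesquilinear_form_add sesquilinear_pairing smooth_near_rho sesquilinear_mass_form zeros_nth(1)[OF zerosG])

lemma prepGs: "prepared NG LGs" and zerosGs: "zeros_with_mult NG LGs zGs"
  by (rule prepared_lrecip[OF prepG], rule zeros_lrecip[OF prepG zerosG])

text \<open>On the circle \<open>cnj w\<close> is 1 / w, so a coincidence would put
  \<open>zeta p\<close> into the support.\<close>

lemma supp_alpha:
  assumes "p < 2 * NG" "w \<in> supp u"
  shows "cnj w \<noteq> inverse (zeta p)" "w \<noteq> alpha p"
proof -
  have "w * cnj w = 1" using supp_cnj[OF assms(2)] by (simp add: mult.commute)
  then have "cnj w = inverse w" by (metis inverse_unique)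
  then show c: "cnj w \<noteq> inverse (zeta p)" using zeta_facts(4)[OF assms(1)] assms(2) by auto
  then show "w \<noteq> alpha p" by auto
qed

lemma zGs_nth:
  assumes "p < 2 * NG"
  shows "fst (zGs ! idx p) = alpha p" "snd (zGs ! idx p) = snd (zG ! idx p)"
  using zeta_facts(1)[OF assms] by (simp_all add: map_zeros_simps)

text \<open>The conjugate of LGs at w is LG at 1 / cnj w. Under the pairing this may be replaced by
  LG at w, which cancels the denominator.\<close>

lemma pairing_LGs:
  assumes "smooth_near u h"
  shows "pairing u (\<lambda>w. rho w * (h w * cnj (leval LGs w))) = pairing u (\<lambda>w. leval LC w * h w)"
proof -
  note c = circle_eq_leval[of LG]
  have n: "smooth_near u (\<lambda>w. rho w * h w)" by (intro smooth_near_mult smooth_near_rho assms)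
  have "pairing u (\<lambda>w. rho w * (h w * cnj (leval LGs w)))
     = pairing u (\<lambda>w. (rho w * h w) * leval LG (inverse (cnj w)))"
    by (simp add: leval_lrecip mult.assoc)
  also have "\<dots> = pairing u (\<lambda>w. (rho w * h w) * leval LG w)" by (rule ceqD[OF c n])
  also have "\<dots> = pairing u (\<lambda>w. leval LC w * h w)"
  proof (rule pairing_cong_supp[of _ _ "leval LG"])
    show "smooth_near u (\<lambda>w. (rho w * h w) * leval LG w)" by (intro smooth_near_mult n smooth_near_leval)
    show "smooth_near u (\<lambda>w. leval LC w * h w)" by (intro smooth_near_mult assms smooth_near_leval)
  qed (auto simp: LG_supp smooth_near_leval)
  finally show ?thesis .
qed

lemma tcoeff_LGs:
  assumes "p < 2 * NG" "laurent_fun g"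
  shows "tcoeff (\<lambda>z. leval LGs z * g z) (alpha p) (ord p) = 0"
proof -
  have a: "alpha p \<noteq> 0" using zeta_facts(3)[OF assms(1)] by simp
  have i: "idx p < length zGs" using zeta_facts(1)[OF assms(1)] by (simp add: map_zeros_simps)
  have "tcoeff (\<lambda>z. leval LGs z * g z) (alpha p) (ord p)
     = tcoeff (\<lambda>z. (z - alpha p) ^ snd (zG ! idx p) * (lbracket LGs NG zGs (idx p) z * g z)) (alpha p) (ord p)"
    by (rule tcoeff_laurent_fun_cong[OF a]) (simp add: leval_lbracket[OF zerosGs i] zGs_nth[OF assms(1)])
  also have "\<dots> = 0"
    using zeta_facts(2)[OF assms(1)] a
    by (subst tcoeff_shift) (auto intro!: analytic_on_mult laurent_fun_analytic[OF assms(2)] holomorphic_analytic_at[OF lbracket_holomorphic])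
  finally show ?thesis .
qed

lemma perturbed_LGs:
  assumes "laurent_fun f" "laurent_fun g"
  shows "F' f (\<lambda>z. leval LGs z * g z) = F (\<lambda>z. leval LC z * f z) g"
proof -
  have "mass_form zG X f (\<lambda>z. leval LGs z * g z) = 0"
    unfolding mass_form_def using tcoeff_LGs[OF _ assms(2)] lenJ by (intro sum.neutral ballI) simp
  moreover have "pairing u (\<lambda>w. rho w * (f w * cnj (leval LGs w * g w)))
      = pairing u (\<lambda>w. leval LC w * (f w * cnj (g w)))"
    using pairing_LGs[of "\<lambda>w. f w * cnj (g w)"] assms
    by (simp add: smooth_near_mult smooth_near_Lau smooth_near_cnj_comp mult_ac)
  ultimately show ?thesis
    unfolding perturbed_form_eq zero_order_form_def by (simp add: mult.assoc)
qed

section \<open>The test functions behind the rows\<close>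

text \<open>The quotient of LGs by (z - alpha p)^(ord p + 1), with the division carried out so that
  the formula makes sense at \<open>alpha p\<close> itself.\<close>

definition gtest :: "nat \<Rightarrow> complex \<Rightarrow> complex" where
  "gtest p z = lbracket LGs NG zGs (idx p) z * (z - alpha p) ^ (snd (zG ! idx p) - 1 - ord p)"

lemma gtest_mult:
  assumes "p < 2 * NG" "z \<noteq> 0"
  shows "leval LGs z = gtest p z * (z - alpha p) ^ (ord p + 1)"
proof -
  have i: "idx p < length zGs" using zeta_facts(1)[OF assms(1)] by (simp add: map_zeros_simps)
  have "snd (zG ! idx p) = (snd (zG ! idx p) - 1 - ord p) + (ord p + 1)"
    using zeta_facts(2)[OF assms(1)] by simp
  then have "(z - alpha p) ^ snd (zG ! idx p) = (z - alpha p) ^ (snd (zG ! idx p) - 1 - ord p) * (z - alpha p) ^ (ord p + 1)"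
    by (metis power_add)
  then show ?thesis
    unfolding gtest_def leval_lbracket[OF zerosGs i assms(2)] zGs_nth[OF assms(1)] by simp
qed

text \<open>After multiplication by z^NG the total degree is at most 2 NG - (ord p + 1), hence less
  than 2 NG, as \<open>in_span_poly\<close> requires.\<close>

lemma in_span_gtest:
  assumes "p < 2 * NG"
  shows "in_span (2 * NG) (gtest p)"
proof -
  let ?P = "Polynomial.smult (lcoeff LGs (int NG)) ((\<Prod>i\<in>{..<length zGs} - {idx p}. [:- fst (zGs ! i), 1:] ^ snd (zGs ! i))
     * [:- alpha p, 1:] ^ (snd (zG ! idx p) - 1 - ord p))"
  have i: "idx p < length zGs" using zeta_facts(1)[OF assms] by (simp add: map_zeros_simps)
  have eq: "z powi (- int NG) * poly ?P z = gtest p z" for z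
    unfolding gtest_def lbracket_def by (simp add: poly_prod mult_ac)
  have "(\<Sum>i<length zGs. snd (zGs ! i)) = snd (zGs ! idx p) + (\<Sum>i\<in>{..<length zGs} - {idx p}. snd (zGs ! i))"
    using i by (intro sum.remove) auto
  then have "(\<Sum>i\<in>{..<length zGs} - {idx p}. snd (zGs ! i)) + (snd (zG ! idx p) - 1 - ord p) < 2 * NG"
    using zeros_poly(1)[OF prepGs zerosGs] zGs_nth(2)[OF assms] zeta_facts(2)[OF assms] by simp
  moreover have "degree ?P \<le> (\<Sum>i\<in>{..<length zGs} - {idx p}. snd (zGs ! i)) + (snd (zG ! idx p) - 1 - ord p)"
    by (rule order_trans[OF degree_smult_le], rule order_trans[OF degree_mult_le], rule add_mono)
       (auto simp: degree_prod_eq_sum_degree degree_power_eq)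
  ultimately have "degree ?P < 2 * NG" by linarith
  from in_span_poly[OF this] show ?thesis unfolding eq .
qed

text \<open>At its own zero, of multiplicity m, the factor (z - alpha p)^(m - 1 - ord p) shifts the
  Taylor coefficients of \<open>lbracket\<close>, which gives the diagonal blocks. At any other zero
  the full multiplicity is still present, which gives the zero blocks.\<close>

lemma tcoeff_gtest:
  assumes "p < 2 * NG" "p' < 2 * NG"
  shows "cnj (tcoeff (gtest p) (alpha p') (ord p')) = ellm $$ (p', p)"
proof -
  have a: "alpha p' \<noteq> 0" "alpha p \<noteq> 0" using zeta_facts(3)[OF assms(1)] zeta_facts(3)[OF assms(2)] by simp_all
  note i = zeta_facts(1,2)[OF assms(1)] and i' = zeta_facts(1,2)[OF assms(2)]
  have o: "open (- {0 :: complex})" by auto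
  have J': "jet_index zGs = J" by (rule map_zeros_simps)
  have E: "ellm $$ (p', p) = (if idx p' = idx p \<and> ord p' + ord p \<ge> snd (zG ! idx p) - 1
      then ell LGs NG zGs (idx p) (ord p' + ord p - (snd (zG ! idx p) - 1)) else 0)"
    using ell_matrix_index[where p = p' and p' = p and zs = zGs and L = LGs and N = NG] assms lenJ zGs_nth(2)[OF assms(1)]
    unfolding J' by (auto simp: Let_def split_beta)
  have ell: "ell LGs NG zGs (idx p) k = cnj (tcoeff (lbracket LGs NG zGs (idx p)) (alpha p) k)" for k
    using tcoeff_cnj[OF o lbracket_holomorphic[of LGs NG zGs "idx p"], of "alpha p" k] a
    unfolding ell_def tcoeff_def zGs_nth(1)[OF assms(1)] by simp
  have lb: "lbracket LGs NG zGs (idx p) analytic_on {alpha p'}" 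
    by (rule holomorphic_analytic_at[OF lbracket_holomorphic o]) (use a in auto)
  show ?thesis
  proof (cases "idx p' = idx p")
    case True
    then have al: "alpha p' = alpha p" by simp
    have "tcoeff (gtest p) (alpha p') (ord p')
       = tcoeff (\<lambda>z. (z - alpha p') ^ (snd (zG ! idx p) - 1 - ord p) * lbracket LGs NG zGs (idx p) z) (alpha p') (ord p')"
      unfolding gtest_def[abs_def] al by (simp add: mult.commute)
    also have "\<dots> = (if ord p' < snd (zG ! idx p) - 1 - ord p then 0
        else tcoeff (lbracket LGs NG zGs (idx p)) (alpha p') (ord p' - (snd (zG ! idx p) - 1 - ord p)))"
      by (rule tcoeff_shift[OF lb])
    also have "cnj \<dots> = ellm $$ (p', p)"
    proof -
      have "(ord p' < snd (zG ! idx p) - 1 - ord p) = (\<not> ord p' + ord p \<ge> snd (zG ! idx p) - 1)"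
        "ord p' - (snd (zG ! idx p) - 1 - ord p) = ord p' + ord p - (snd (zG ! idx p) - 1)"
        using i(2) by auto
      then show ?thesis unfolding E ell using True by simp
    qed
    finally show ?thesis .
  next
    case False
    let ?K = "{..<length zGs} - {idx p}"
    have K: "idx p' \<in> ?K" "finite ?K" using False i' by (auto simp: map_zeros_simps)
    let ?h = "\<lambda>z. lcoeff LGs (int NG) * z powi (- int NG) * (\<Prod>i\<in>?K - {idx p'}. (z - fst (zGs ! i)) ^ snd (zGs ! i))
        * (z - alpha p) ^ (snd (zG ! idx p) - 1 - ord p)"
    have "gtest p z = (z - alpha p') ^ snd (zG ! idx p') * ?h z" for z
      unfolding gtest_def lbracket_def prod.remove[OF K(2,1)] zGs_nth[OF assms(2)] by simp
    then have "tcoeff (gtest p) (alpha p') (ord p') = tcoeff (\<lambda>z. (z - alpha p') ^ snd (zG ! idx p') * ?h z) (alpha p') (ord p')"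
      by presburger
    also have "\<dots> = 0"
    proof (subst tcoeff_shift)
      show "?h analytic_on {alpha p'}"
        by (rule holomorphic_analytic_at[of _ "- {0}"]) (use a in \<open>auto intro!: holomorphic_intros\<close>)
    qed (use i' in auto)
    finally show ?thesis unfolding E using False by simp
  qed
qed

text \<open>An entry of the row as a functional of an arbitrary f, with the derivatives of the
  second kind function already carried out under the pairing. It can thus be applied to LC times a
  perturbed function, which is not a member of the original family.\<close>

definition row_entry :: "nat \<Rightarrow> (complex \<Rightarrow> complex) \<Rightarrow> complex" where
  "row_entry p f = (if p < 2 * NG then
      (-1) ^ ord p * pairing u (\<lambda>w. f w * (1 / (inverse (zeta p) - cnj w)) ^ (ord p + 1))
      - (\<Sum>j<2 * NG. (\<Sum>i<2 * NG. tcoeff (\<lambda>z. f z / leval LC z) (zeta i) (ord i) * Xi $$ (i, j)) * ellm $$ (j, p))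
    else tcoeff f (fst (zC ! fst (jet_index zC ! (p - 2 * NG)))) (snd (jet_index zC ! (p - 2 * NG))))"

lemma zC_facts:
  assumes "p < 2 * NC"
  shows "fst (jet_index zC ! p) < length zC" "snd (jet_index zC ! p) < snd (zC ! fst (jet_index zC ! p))"
    "fst (zC ! fst (jet_index zC ! p)) \<noteq> 0"
proof -
  show i: "fst (jet_index zC ! p) < length zC" "snd (jet_index zC ! p) < snd (zC ! fst (jet_index zC ! p))"
    using jet_index_nth[of p zC] assms lenJ by auto
  show "fst (zC ! fst (jet_index zC ! p)) \<noteq> 0" by (rule zeros_nth(1)[OF zerosC i(1)])
qed

lemma smooth_near_ker: "p < 2 * NG \<Longrightarrow> smooth_near u (\<lambda>w. 1 / (inverse (zeta p) - cnj w))"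
  using supp_alpha(1) by (intro smooth_near_kernel) auto

lemma open_LC: "open {z. z \<noteq> 0 \<and> leval LC z \<noteq> 0}"
proof -
  have "open (- {0} \<inter> leval LC -` (- {0}))"
    by (rule continuous_open_preimage[OF holomorphic_on_imp_continuous_on[OF leval_holomorphic]]) auto
  moreover have "- {0} \<inter> leval LC -` (- {0}) = {z. z \<noteq> 0 \<and> leval LC z \<noteq> 0}" by auto
  ultimately show ?thesis by simp
qed

lemma quot_analytic:
  assumes "p < 2 * NG" "laurent_fun f"
  shows "(\<lambda>z. f z / leval LC z) analytic_on {zeta p}"
proof (rule holomorphic_analytic_at[OF _ open_LC])
  have "{z. z \<noteq> 0 \<and> leval LC z \<noteq> 0} \<subseteq> - {0}" by auto
  then show "(\<lambda>z. f z / leval LC z) holomorphic_on {z. z \<noteq> 0 \<and> leval LC z \<noteq> 0}"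
    by (intro holomorphic_on_divide holomorphic_on_subset[OF laurent_fun_holomorphic[OF assms(2)]]
        holomorphic_on_subset[OF leval_holomorphic]) auto
qed (use zeta_facts[OF assms(1)] in auto)

lemma row_entry_sum:
  assumes p: "p < 2 * NG + 2 * NC" and L: "\<And>k. k \<in> A \<Longrightarrow> laurent_fun (g k)"
    and f: "\<And>z. z \<noteq> 0 \<Longrightarrow> f z = (\<Sum>k\<in>A. c k * g k z)"
  shows "row_entry p f = (\<Sum>k\<in>A. c k * row_entry p (g k))"
proof (cases "p < 2 * NG")
  case True
  let ?r = "\<lambda>w. (1 / (inverse (zeta p) - cnj w)) ^ (ord p + 1)"
  have n: "smooth_near u (\<lambda>w. g k w * ?r w)" if "k \<in> A" for k
    by (intro smooth_near_mult smooth_near_power smooth_near_ker smooth_near_Lau L that True)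
  have "pairing u (\<lambda>w. f w * ?r w) = pairing u (\<lambda>w. \<Sum>k\<in>A. c k * (g k w * ?r w))"
    by (rule pairing_cong0, subst f, assumption) (simp only: sum_distrib_right mult.assoc)
  also have "\<dots> = (\<Sum>k\<in>A. pairing u (\<lambda>w. c k * (g k w * ?r w)))"
    by (intro pairing_sum smooth_near_mult smooth_near_const n)
  also have "\<dots> = (\<Sum>k\<in>A. c k * pairing u (\<lambda>w. g k w * ?r w))"
    by (intro sum.cong refl pairing_scale n)
  finally have 1: "pairing u (\<lambda>w. f w * ?r w) = (\<Sum>k\<in>A. c k * pairing u (\<lambda>w. g k w * ?r w))" .
  have 2: "tcoeff (\<lambda>z. f z / leval LC z) (zeta i) (ord i) = (\<Sum>k\<in>A. c k * tcoeff (\<lambda>z. g k z / leval LC z) (zeta i) (ord i))"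
    if i: "i < 2 * NG" for i
  proof -
    have "tcoeff (\<lambda>z. f z / leval LC z) (zeta i) (ord i) = tcoeff (\<lambda>z. \<Sum>k\<in>A. c k * (g k z / leval LC z)) (zeta i) (ord i)"
      by (rule tcoeff_laurent_fun_cong[OF zeta_facts(3)[OF i]]) (simp add: f sum_divide_distrib)
    also have "\<dots> = (\<Sum>k\<in>A. c k * tcoeff (\<lambda>z. g k z / leval LC z) (zeta i) (ord i))"
      by (rule tcoeff_sum) (intro quot_analytic i L)
    finally show ?thesis .
  qed
  have "(\<Sum>j<2 * NG. (\<Sum>i<2 * NG. tcoeff (\<lambda>z. f z / leval LC z) (zeta i) (ord i) * Xi $$ (i, j)) * ellm $$ (j, p))
     = (\<Sum>j<2 * NG. \<Sum>i<2 * NG. \<Sum>k\<in>A. c k * (tcoeff (\<lambda>z. g k z / leval LC z) (zeta i) (ord i) * Xi $$ (i, j) * ellm $$ (j, p)))"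
    by (simp add: 2 sum_distrib_right mult.assoc)
  also have "\<dots> = (\<Sum>k\<in>A. \<Sum>j<2 * NG. \<Sum>i<2 * NG. c k * (tcoeff (\<lambda>z. g k z / leval LC z) (zeta i) (ord i) * Xi $$ (i, j) * ellm $$ (j, p)))"
    by (simp only: sum.swap[of _ A])
  also have "\<dots> = (\<Sum>k\<in>A. c k * (\<Sum>j<2 * NG. (\<Sum>i<2 * NG. tcoeff (\<lambda>z. g k z / leval LC z) (zeta i) (ord i) * Xi $$ (i, j)) * ellm $$ (j, p)))"
    by (simp add: sum_distrib_left sum_distrib_right mult.assoc)
  finally show ?thesis
    unfolding row_entry_def 1 using True
    by (simp add: right_diff_distrib sum_subtractf sum_distrib_left mult.left_commute)
next
  case False
  then have q: "p - 2 * NG < 2 * NC" using p by simp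
  note z = zC_facts(3)[OF q]
  show ?thesis
    unfolding row_entry_def using False tcoeff_laurent_fun_cong[OF z f] tcoeff_sum[OF laurent_fun_analytic[OF L z]] by simp
qed

text \<open>LC cancels in the jet of the quotient by LC, and \<open>tcoeff_gtest\<close> turns the
  matrix product into the mass part of the form. Near the support the conjugate of
  \<open>gtest p\<close> is, up to sign, that of LGs times a power of the Cauchy kernel, so
  \<open>pairing_LGs\<close> removes the denominator LG.\<close>

lemma row_entry_LC1:
  assumes p: "p < 2 * NG" and f: "laurent_fun f"
  shows "row_entry p (\<lambda>z. leval LC z * f z) = - F' f (gtest p)"
proof -
  let ?r = "\<lambda>w. 1 / (inverse (zeta p) - cnj w)" and ?q = "ord p"
  have g: "laurent_fun (gtest p)" by (rule LauI[OF in_span_gtest[OF p]])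
  have ns: "smooth_near u (\<lambda>w. cnj w - inverse (zeta p))" by (intro smooth_near_diff smooth_near_cnj smooth_near_const)
  have nr: "smooth_near u (\<lambda>w. f w * ((-1) ^ (?q + 1) * ?r w ^ (?q + 1)))"
    by (intro smooth_near_mult smooth_near_const smooth_near_power smooth_near_ker smooth_near_Lau f p)
  \<comment> \<open>The kernel is minus the reciprocal of cnj w - 1 / zeta, hence the sign (-1)^(q +
    1).\<close>
  have "pairing u (\<lambda>w. rho w * (f w * cnj (gtest p w)))
     = pairing u (\<lambda>w. rho w * ((f w * ((-1) ^ (?q + 1) * ?r w ^ (?q + 1))) * cnj (leval LGs w)))"
  proof (rule pairing_cong_supp[OF _ _ _ ns])
    show "cnj w - inverse (zeta p) \<noteq> 0" if "w \<in> supp u" for w using supp_alpha(1)[OF p that] by simp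
    fix w assume w: "w \<noteq> 0" "cnj w - inverse (zeta p) \<noteq> 0"
    have "cnj (leval LGs w) = cnj (gtest p w) * (cnj w - inverse (zeta p)) ^ (?q + 1)"
      unfolding gtest_mult[OF p w(1)] by simp
    moreover have "((-1) ^ (?q + 1) * ?r w ^ (?q + 1)) * (cnj w - inverse (zeta p)) ^ (?q + 1) = 1"
    proof -
      have "inverse (zeta p) - cnj w \<noteq> 0" using w(2) by simp
      then have "(-1) * ?r w * (cnj w - inverse (zeta p)) = 1" by (simp add: divide_simps)
      then show ?thesis by (simp only: power_mult_distrib[symmetric] power_one)
    qed
    moreover have "rho w * (f w * g) = rho w * ((f w * s) * t)" if "t = g * k" "s * k = 1" for g s t k
    proof -
      have "(f w * s) * (g * k) = f w * g * (s * k)" by (simp only: mult_ac)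
      then show ?thesis using that by simp
    qed
    ultimately show "rho w * (f w * cnj (gtest p w)) = rho w * ((f w * ((-1) ^ (?q + 1) * ?r w ^ (?q + 1))) * cnj (leval LGs w))"
      by blast
  qed (intro smooth_near_mult smooth_near_rho smooth_near_Lau f smooth_near_cnj_comp g nr smooth_near_leval)+
  also have "\<dots> = pairing u (\<lambda>w. leval LC w * (f w * ((-1) ^ (?q + 1) * ?r w ^ (?q + 1))))"
    by (rule pairing_LGs[OF nr])
  also have "\<dots> = pairing u (\<lambda>w. (-1) ^ (?q + 1) * (leval LC w * f w * ?r w ^ (?q + 1)))"
    by (simp only: mult_ac)
  also have "\<dots> = (-1) ^ (?q + 1) * pairing u (\<lambda>w. leval LC w * f w * ?r w ^ (?q + 1))"
    by (intro pairing_scale smooth_near_mult smooth_near_leval smooth_near_Lau f smooth_near_power smooth_near_ker p)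
  finally have 1: "pairing u (\<lambda>w. rho w * (f w * cnj (gtest p w)))
     = - ((-1) ^ ?q * pairing u (\<lambda>w. leval LC w * f w * ?r w ^ (?q + 1)))" by simp
  have t: "tcoeff (\<lambda>z. leval LC z * f z / leval LC z) (zeta i) (ord i) = tcoeff f (zeta i) (ord i)" if i: "i < 2 * NG" for i
    by (rule tcoeff_cong[OF open_LC]) (use zeta_facts[OF i] in auto)
  have "mass_form zG X f (gtest p)
     = (\<Sum>i<2 * NG. \<Sum>j<2 * NG. Xi $$ (i, j) * tcoeff f (zeta i) (ord i) * ellm $$ (j, p))"
    unfolding mass_form_def lenJ by (intro sum.cong refl) (simp add: tcoeff_gtest[OF p])
  also have "\<dots> = (\<Sum>j<2 * NG. (\<Sum>i<2 * NG. tcoeff f (zeta i) (ord i) * Xi $$ (i, j)) * ellm $$ (j, p))"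
    by (subst sum.swap) (simp only: sum_distrib_right sum_distrib_left mult_ac)
  finally have 2: "mass_form zG X f (gtest p)
     = (\<Sum>j<2 * NG. (\<Sum>i<2 * NG. tcoeff f (zeta i) (ord i) * Xi $$ (i, j)) * ellm $$ (j, p))" .
  have "row_entry p (\<lambda>z. leval LC z * f z) = (-1) ^ ?q * pairing u (\<lambda>w. leval LC w * f w * ?r w ^ (?q + 1))
     - (\<Sum>j<2 * NG. (\<Sum>i<2 * NG. tcoeff f (zeta i) (ord i) * Xi $$ (i, j)) * ellm $$ (j, p))"
    unfolding row_entry_def using p t by simp
  then show ?thesis unfolding perturbed_form_eq 1 2 by simp
qed

lemma row_entry_LC2:
  assumes p: "\<not> p < 2 * NG" "p < 2 * NG + 2 * NC" and f: "laurent_fun f"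
  shows "row_entry p (\<lambda>z. leval LC z * f z) = 0"
proof -
  have q: "p - 2 * NG < 2 * NC" using p by simp
  let ?i = "fst (jet_index zC ! (p - 2 * NG))" and ?k = "snd (jet_index zC ! (p - 2 * NG))"
  let ?a = "fst (zC ! ?i)"
  note z = zC_facts[OF q]
  have "tcoeff (\<lambda>z. leval LC z * f z) ?a ?k
     = tcoeff (\<lambda>z. (z - ?a) ^ snd (zC ! ?i) * (lbracket LC NC zC ?i z * f z)) ?a ?k"
    by (rule tcoeff_laurent_fun_cong[OF z(3)]) (simp add: leval_lbracket[OF zerosC z(1)])
  also have "\<dots> = 0"
    using z(2,3)
    by (subst tcoeff_shift) (auto intro!: analytic_on_mult laurent_fun_analytic[OF f] holomorphic_analytic_at[OF lbracket_holomorphic])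
  finally show ?thesis using p by (simp add: row_entry_def)
qed

text \<open>The normalisation of the jet removes the factorial from the derivative of the Cauchy
  kernel and leaves only the sign.\<close>

lemma second_kind_jet:
  assumes "p < 2 * NG" "laurent_fun f"
  shows "vec_index (jet (second_kind1 u f) (map_zeros inverse zG)) p
     = (-1) ^ ord p * pairing u (\<lambda>w. f w * (1 / (inverse (zeta p) - cnj w)) ^ (ord p + 1))"
proof -
  have s: "second_kind1 u f = (\<lambda>z. pairing u (\<lambda>w. f w * (1 / (z - cnj w))))"
    by (simp add: second_kind1_def zero_order_form_def fun_eq_iff)
  have "vec_index (jet (second_kind1 u f) (map_zeros inverse zG)) p = tcoeff (second_kind1 u f) (inverse (zeta p)) (ord p)"
    using assms(1) lenJ zeta_facts(1)[OF assms(1)] by (subst jet_nth) (simp_all add: map_zeros_simps)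
  then show ?thesis
    using pairing_kernel_higher_deriv[OF smooth_near_Lau[OF assms(2)], of "inverse (zeta p)" "ord p"] supp_alpha(1)[OF assms(1)]
    unfolding tcoeff_def s by simp
qed

abbreviation "R21 \<equiv> A21 u LC zC LG NG zG Xi"

lemma Xi_carrier: "Xi \<in> carrier_mat (2 * NG) (2 * NG)"
  unfolding mass_matrix_def lenJ by simp

lemma ellm_carrier: "ellm \<in> carrier_mat (2 * NG) (2 * NG)"
  using ell_matrix_carrier[where zs = zGs and L = LGs and N = NG] by (simp add: map_zeros_simps lenJ)

lemma dim_R21: "dim_vec (R21 phi k) = 2 * NG + 2 * NC"
  unfolding A21_def using dim_row_mult[OF ellm_carrier] by (simp add: dim_jet lenJ map_zeros_simps)

lemma double_row_mult:
  assumes "dim_vec v = 2 * NG" "p < 2 * NG"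
  shows "vec_index (row_mult (row_mult v Xi) ellm) p = (\<Sum>j<2 * NG. (\<Sum>i<2 * NG. vec_index v i * Xi $$ (i, j)) * ellm $$ (j, p))"
  using assms
  by (simp add: row_mult_index[OF ellm_carrier dim_row_mult[OF Xi_carrier]] row_mult_index[OF Xi_carrier])

lemma R21_index:
  assumes "p < 2 * NG + 2 * NC" "laurent_fun (phi k)"
  shows "vec_index (R21 phi k) p = row_entry p (phi k)"
proof (cases "p < 2 * NG")
  case True
  have "vec_index (R21 phi k) p = vec_index (jet (second_kind1 u (phi k)) (map_zeros inverse zG)) p
     - vec_index (row_mult (row_mult (jet (\<lambda>z. phi k z / leval LC z) zG) Xi) ellm) p"
    unfolding A21_def using True dim_row_mult[OF ellm_carrier] by (simp add: dim_jet lenJ map_zeros_simps)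
  then show ?thesis
    using True by (simp add: row_entry_def second_kind_jet[OF True assms(2)] double_row_mult dim_jet lenJ jet_nth)
next
  case False
  then have "vec_index (R21 phi k) p = vec_index (jet (phi k) zC) (p - 2 * NG)"
    unfolding A21_def using assms(1) dim_row_mult[OF ellm_carrier] by (simp add: dim_jet lenJ map_zeros_simps)
  then show ?thesis
    using False assms(1) by (simp add: row_entry_def jet_nth lenJ)
qed

text \<open>The difference quotient is split in two. The part containing the polynomial at the jet
  variable has a zero of full multiplicity and drops out; the other part is a constant times a
  geometric series, whose coefficient is conjugate to the quotient defining
  \<open>gtest p\<close>.\<close>

lemma delta_jet:
  assumes p: "p < 2 * NG" and z: "z \<noteq> 0" "leval LGs z \<noteq> 0"
  shows "vec_index (jet (\<lambda>w. ldelta (lconj LGs) (cnj z) w) (map_zeros inverse zG)) p = cnj (gtest p z)"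
proof -
  let ?b = "inverse (zeta p)" and ?c = "cnj z" and ?q = "ord p" and ?M = "leval (lconj LGs)"
  have i: "idx p < length zGs" using zeta_facts(1)[OF p] by (simp add: map_zeros_simps)
  have Mc: "?M ?c = cnj (leval LGs z)" by (simp add: leval_lconj)
  have cb: "?c \<noteq> ?b"
  proof
    assume "?c = ?b"
    then have "z = alpha p" by (metis complex_cnj_cnj complex_cnj_inverse)
    then show False using z gtest_mult[OF p z(1)] by simp
  qed
  have b0: "?b \<noteq> 0" using zeta_facts(3)[OF p] by simp
  let ?h = "\<lambda>w. cnj (lbracket LGs NG zGs (idx p) (cnj w)) * (1 / (?c - w))"
  have M: "?M w = (w - ?b) ^ snd (zG ! idx p) * cnj (lbracket LGs NG zGs (idx p) (cnj w))" if "w \<noteq> 0" for w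
    using that by (simp add: leval_lconj leval_lbracket[OF zerosGs i] zGs_nth[OF p])
  have o: "open (- {0, ?c})" by auto
  have hol: "(\<lambda>w. cnj (lbracket LGs NG zGs (idx p) (cnj w))) holomorphic_on - {0}"
  proof -
    have "(\<lambda>w. cnj (lbracket LGs NG zGs (idx p) (cnj w)))
       = (\<lambda>w. cnj (lcoeff LGs (int NG)) * w powi (- int NG) * (\<Prod>i\<in>{..<length zGs} - {idx p}. (w - cnj (fst (zGs ! i))) ^ snd (zGs ! i)))"
      by (simp add: lbracket_def fun_eq_iff)
    then show ?thesis by (auto intro!: holomorphic_intros)
  qed
  have ha: "?h analytic_on {?b}"
    by (rule holomorphic_analytic_at[OF _ o])
       (use b0 cb in \<open>auto intro!: holomorphic_intros holomorphic_on_subset[OF hol]\<close>)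
  have ka: "(\<lambda>w. 1 / (?c - w)) analytic_on {?b}"
    by (rule holomorphic_analytic_at[OF _ o]) (use b0 cb in \<open>auto intro!: holomorphic_intros\<close>)
  have "vec_index (jet (\<lambda>w. ldelta (lconj LGs) ?c w) (map_zeros inverse zG)) p
     = tcoeff (\<lambda>w. ldelta (lconj LGs) ?c w) ?b ?q"
    using p lenJ zeta_facts(1)[OF p] by (subst jet_nth) (simp_all add: map_zeros_simps)
  also have "\<dots> = tcoeff (\<lambda>w. ?M ?c * (1 / (?c - w)) - (w - ?b) ^ snd (zG ! idx p) * ?h w) ?b ?q"
    by (rule tcoeff_cong[OF o]) (use b0 cb M in \<open>auto simp: ldelta_def diff_divide_distrib\<close>)
  also have "\<dots> = tcoeff (\<lambda>w. ?M ?c * (1 / (?c - w))) ?b ?q - tcoeff (\<lambda>w. (w - ?b) ^ snd (zG ! idx p) * ?h w) ?b ?q"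
    by (intro tcoeff_diff analytic_on_mult[OF _ ka] analytic_on_mult[OF _ ha] analytic_on_power analytic_on_diff
        analytic_on_const analytic_on_ident)
  also have "tcoeff (\<lambda>w. ?M ?c * (1 / (?c - w))) ?b ?q = ?M ?c * (1 / (?c - ?b) ^ (?q + 1))"
    by (simp only: tcoeff_cmult[OF ka] tcoeff_inverse_linear[OF cb])
  also have "tcoeff (\<lambda>w. (w - ?b) ^ snd (zG ! idx p) * ?h w) ?b ?q = 0"
    by (simp only: tcoeff_shift[OF ha] zeta_facts(2)[OF p] if_True)
  also have "?M ?c * (1 / (?c - ?b) ^ (?q + 1)) - 0 = cnj (gtest p z)"
  proof -
    have "cnj (leval LGs z) = cnj (gtest p z) * (?c - ?b) ^ (?q + 1)"
      unfolding gtest_mult[OF p z(1)] by simp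
    then show ?thesis unfolding Mc using cb by simp
  qed
  finally show ?thesis .
qed

lemma dim_B21: "dim_vec (B21 u LC zC LG NG zG Xi phi1 H phi2 l z) = 2 * NG + 2 * NC"
  unfolding B21_def Let_def kernel_jet_def using dim_row_mult[OF ellm_carrier]
  by (simp add: dim_jet lenJ map_zeros_simps)

text \<open>Jets and matrix products are linear, so the kernel terms become a combination of the
  rows \<open>A21\<close>. The single correction left over comes from \<open>ldelta\<close>; it is
  cancelled in \<open>determinantal_formulas\<close>.\<close>

lemma B21_index:
  assumes p: "p < 2 * NG + 2 * NC" and L: "\<And>k. laurent_fun (phi1 k)" and z: "z \<noteq> 0" "leval LGs z \<noteq> 0"
  shows "vec_index (B21 u LC zC LG NG zG Xi phi1 H phi2 l z) p
    = (\<Sum>k<l - 2 * NG + 1. cnj (phi2 k z) * inverse (H k) * row_entry p (phi1 k))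
      + (if p < 2 * NG then cnj (gtest p z) / cnj (leval LGs z) else 0)"
proof (cases "p < 2 * NG")
  case True
  let ?c = "\<lambda>k. cnj (phi2 k z) * inverse (H k)" and ?I = "{..<l - 2 * NG + 1}"
  let ?t = "\<lambda>k i. tcoeff (\<lambda>w. phi1 k w / leval LC w) (zeta i) (ord i)"
  let ?K = "kernel_jet (l - 2 * NG + 1) (\<lambda>k. cnj (phi2 k z)) H"
  have "vec_index (B21 u LC zC LG NG zG Xi phi1 H phi2 l z) p =
     vec_index (?K (\<lambda>k. jet (second_kind1 u (phi1 k)) (map_zeros inverse zG))) p
     - vec_index (row_mult (row_mult (?K (\<lambda>k. jet (\<lambda>w. phi1 k w / leval LC w) zG)) Xi) ellm) p
     + 1 / cnj (leval LGs z) * vec_index (jet (\<lambda>w. ldelta (lconj LGs) (cnj z) w) (map_zeros inverse zG)) p"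
    unfolding B21_def Let_def using True dim_row_mult[OF ellm_carrier]
    by (simp add: dim_jet lenJ map_zeros_simps kernel_jet_def)
  also have "vec_index (?K (\<lambda>k. jet (second_kind1 u (phi1 k)) (map_zeros inverse zG))) p
     = (\<Sum>k\<in>?I. ?c k * ((-1) ^ ord p * pairing u (\<lambda>w. phi1 k w * (1 / (inverse (zeta p) - cnj w)) ^ (ord p + 1))))"
    unfolding kernel_jet_def using True
    by (simp add: dim_jet lenJ map_zeros_simps second_kind_jet[OF True L] del: sum.lessThan_Suc)
  also have "vec_index (row_mult (row_mult (?K (\<lambda>k. jet (\<lambda>w. phi1 k w / leval LC w) zG)) Xi) ellm) p
     = (\<Sum>j<2 * NG. (\<Sum>i<2 * NG. (\<Sum>k\<in>?I. ?c k * ?t k i) * Xi $$ (i, j)) * ellm $$ (j, p))"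
    by (subst double_row_mult) (use True in \<open>simp_all add: kernel_jet_def dim_jet lenJ jet_nth del: sum.lessThan_Suc\<close>)
  also have "\<dots> = (\<Sum>j<2 * NG. \<Sum>i<2 * NG. \<Sum>k\<in>?I. ?c k * (?t k i * Xi $$ (i, j) * ellm $$ (j, p)))"
    by (simp only: sum_distrib_right mult.assoc)
  also have "\<dots> = (\<Sum>k\<in>?I. \<Sum>j<2 * NG. \<Sum>i<2 * NG. ?c k * (?t k i * Xi $$ (i, j) * ellm $$ (j, p)))"
    by (simp only: sum.swap[of _ ?I])
  also have "\<dots> = (\<Sum>k\<in>?I. ?c k * (\<Sum>j<2 * NG. (\<Sum>i<2 * NG. ?t k i * Xi $$ (i, j)) * ellm $$ (j, p)))"
    by (simp only: sum_distrib_left sum_distrib_right mult.assoc)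
  finally show ?thesis
    using True by (simp add: row_entry_def delta_jet[OF True z] right_diff_distrib sum_subtractf del: sum.lessThan_Suc)
next
  case False
  then have "vec_index (B21 u LC zC LG NG zG Xi phi1 H phi2 l z) p =
     vec_index (kernel_jet (l - 2 * NG + 1) (\<lambda>k. cnj (phi2 k z)) H (\<lambda>k. jet (phi1 k) zC)) (p - 2 * NG)"
    unfolding B21_def Let_def using p dim_row_mult[OF ellm_carrier]
    by (simp add: dim_jet lenJ map_zeros_simps kernel_jet_def)
  then show ?thesis
    using False p by (simp add: kernel_jet_def dim_jet lenJ jet_nth row_entry_def del: sum.lessThan_Suc)
qed

end

section \<open>Connection coefficients and the formulas for the rows of type (2,1)\<close>

context geronimus_uvarov
begin

theorem determinantal_formulas:
  assumes "biorthogonal F S1 S2 H" and "biorthogonal F' S1' S2' H'"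
    and l: "l \<ge> 2 * NG" and tau0: "tau (R21 (biorth S1)) NG NC l \<noteq> 0"
  defines "t \<equiv> tau (R21 (biorth S1)) NG NC"
  shows "z \<noteq> 0 \<Longrightarrow> leval LC z \<noteq> 0 \<Longrightarrow>
       biorth S1' l z = lcoeff LC ((-1) ^ l * int NC) / leval LC z * (1 / t l) *
         det_border_col (R21 (biorth S1)) (\<lambda>k. biorth S1 k z) NG NC l"
    and "H' l = lcoeff LC ((-1) ^ l * int NC) / lcoeff LG ((-1) ^ (l + 1) * int NG) *
           H (l - 2 * NG) * (t (l + 1) / t l)"
    and "z \<noteq> 0 \<Longrightarrow> leval LGs z \<noteq> 0 \<Longrightarrow>
       cnj (biorth S2' l z) = - (cnj (leval LGs z) / lcoeff LG ((-1) ^ (l + 1) * int NG)) *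
         (H (l - 2 * NG) / t l) *
         det_border_row (R21 (biorth S1)) (B21 u LC zC LG NG zG Xi (biorth S1) H (biorth S2) l z) NG NC l"
proof -
  interpret P: biorthogonal F S1 S2 H by fact
  interpret Q: biorthogonal F' S1' S2' H' by fact
  let ?A = "R21 (biorth S1)"
  let ?f = "\<lambda>j z. leval LC z * Q.phi1 j z"
  have NG: "NG \<ge> 1" "lcoeff LG (int NG) \<noteq> 0" "lcoeff LG (- int NG) \<noteq> 0"
    using prepG unfolding prepared_def by auto
  interpret R: row_system ?A NG NC l
    by unfold_locales (use dim_R21 NG l in auto)
  \<comment> \<open>The connection coefficients. The upper edge of the band is read off from this
    definition, the lower edge from the perturbed form by means of \<open>w_F'\<close>.\<close>
  define w where "w j k = F (?f j) (P.phi2 k) / H k" for j k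
  have w_expand: "?f j z = (\<Sum>k<n. w j k * P.phi1 k z)" if "j + 2 * NC < n" "z \<noteq> 0" for j n z
  proof -
    have "in_span (Suc j + 2 * NC) (?f j)" by (rule in_span_leval[OF prepC biorth_in_span]) simp
    then have "in_span n (?f j)" by (rule in_span_mono) (use that in simp)
    from P.expand1[OF this that(2)] show ?thesis unfolding w_def .
  qed
  have w_top: "w j (j + 2 * NC) = lcoeff LC ((-1) ^ j * int NC)" for j
    using P.orth_top2[OF in_span_leval_top[OF prepC biorth_top[OF Q.S_unitri(1)]], of j] P.H_nonzero
    unfolding w_def by simp
  have w_F': "w j k * H k = F' (Q.phi1 j) (\<lambda>z. leval LGs z * P.phi2 k z)" for j k
    unfolding w_def using P.H_nonzero by (simp add: perturbed_LGs laurent_fun_biorth)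
  have inVk: "in_span n (\<lambda>z. leval LGs z * P.phi2 k z)" if "k + 2 * NG < n" for k n
  proof -
    have "in_span (Suc k + 2 * NG) (\<lambda>z. leval LGs z * P.phi2 k z)" by (rule in_span_leval[OF prepGs biorth_in_span]) simp
    then show ?thesis by (rule in_span_mono) (use that in simp)
  qed
  have w_low: "w j k = 0" if "k + 2 * NG < j" for j k
    using w_F'[of j k] Q.orth1[OF inVk[OF that]] P.H_nonzero[of k] by simp
  let ?LG = "lcoeff LG ((-1) ^ (l + 1) * int NG)"
  have LG0: "?LG \<noteq> 0" using NG by (cases "even l") auto
  have w_bot: "w l R.lo * H R.lo = H' l * ?LG"
  proof -
    have lo: "R.lo + 2 * NG = l" using l by simp
    \<comment> \<open>The indices lo and l have the same parity; passing to the reciprocal negates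
      the index of the coefficient, hence the exponent l + 1.\<close>
    have "(-1 :: int) ^ R.lo = (-1) ^ l" using l by (simp add: minus_one_power_iff)
    then have s: "- ((-1) ^ R.lo * int NG) = (-1) ^ (l + 1) * int NG" by simp
    have "F' (Q.phi1 l) (\<lambda>z. leval LGs z * P.phi2 R.lo z) = cnj (1 * lcoeff LGs ((-1) ^ R.lo * int NG)) * H' l"
      by (rule Q.orth_top1)
         (use in_span_leval_top[OF prepGs biorth_top[OF P.S_unitri(2)], of R.lo, unfolded lo] in simp)
    then show ?thesis unfolding w_F' lcoeff_lrecip s by simp
  qed
  have entry: "(\<Sum>k<n. w j k * vec_index (?A k) p) = row_entry p (?f j)"
    if "j + 2 * NC < n" "p < 2 * NG + 2 * NC" for j n p
  proof -
    have "row_entry p (?f j) = (\<Sum>k<n. w j k * row_entry p (P.phi1 k))"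
      by (rule row_entry_sum[OF that(2)]) (auto simp: laurent_fun_biorth w_expand[OF that(1)])
    then show ?thesis by (simp add: R21_index[OF that(2)] laurent_fun_biorth)
  qed
  \<comment> \<open>Below the band the coefficients vanish, so the sum over the window is a full
    initial sum.\<close>
  have w_range: "(\<Sum>k\<in>{R.lo..R.hi}. w l k * c k) = (\<Sum>k<Suc R.hi. w l k * c k)" for c :: "nat \<Rightarrow> complex"
    by (rule sum.mono_neutral_left) (auto intro!: w_low simp: not_le)
  have \<omega>: "(\<Sum>k\<in>{R.lo..R.hi}. w l k * vec_index (?A k) p) = 0" if p: "p < 2 * NG + 2 * NC" for p
  proof -
    have "(\<Sum>k\<in>{R.lo..R.hi}. w l k * vec_index (?A k) p) = row_entry p (?f l)"
      unfolding w_range by (rule entry[OF _ p]) simp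
    also have "\<dots> = 0"
    proof (cases "p < 2 * NG")
      case True
      then show ?thesis
        using Q.orth1[OF in_span_mono[OF in_span_gtest[OF True] l]] by (simp add: row_entry_LC1 laurent_fun_biorth)
    next
      case False
      then show ?thesis using p by (simp add: row_entry_LC2 laurent_fun_biorth)
    qed
    finally show ?thesis .
  qed
  note col = R.border_col[of "w l", OF \<omega>] and step = R.tau_step[of "w l", OF \<omega>]
  have t0: "t l \<noteq> 0" using tau0 unfolding t_def .
  show "biorth S1' l z = lcoeff LC ((-1) ^ l * int NC) / leval LC z * (1 / t l) *
         det_border_col ?A (\<lambda>k. biorth S1 k z) NG NC l" if z: "z \<noteq> 0" "leval LC z \<noteq> 0"
  proof -
    have "(\<Sum>k\<in>{R.lo..R.hi}. w l k * P.phi1 k z) = leval LC z * biorth S1' l z"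
      unfolding w_range using w_expand[of l "Suc R.hi" z] z(1) by simp
    then have "lcoeff LC ((-1) ^ l * int NC) * det_border_col ?A (\<lambda>k. biorth S1 k z) NG NC l
       = t l * (leval LC z * biorth S1' l z)"
      using col[of "\<lambda>k. P.phi1 k z"] unfolding w_top t_def by simp
    then show ?thesis using t0 z(2) by (simp add: field_simps)
  qed
  have "lcoeff LC ((-1) ^ l * int NC) * t (l + 1) = w l R.lo * t l"
    using step unfolding w_top t_def .
  then have "lcoeff LC ((-1) ^ l * int NC) * t (l + 1) * H R.lo = H' l * ?LG * t l"
    using w_bot by (metis mult.assoc mult.commute)
  then show "H' l = lcoeff LC ((-1) ^ l * int NC) / ?LG * H (l - 2 * NG) * (t (l + 1) / t l)"
    using t0 LG0 by (simp add: field_simps)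
  show "cnj (biorth S2' l z) = - (cnj (leval LGs z) / ?LG) * (H (l - 2 * NG) / t l) *
         det_border_row ?A (B21 u LC zC LG NG zG Xi (biorth S1) H (biorth S2) l z) NG NC l"
    if z: "z \<noteq> 0" "leval LGs z \<noteq> 0"
  proof -
    let ?B = "B21 u LC zC LG NG zG Xi (biorth S1) H (biorth S2) l z"
    let ?c = "cnj (leval LGs z)" and ?P = "\<lambda>j. cnj (biorth S2' j z)"
    \<comment> \<open>Multiplied by the conjugate of LGs, the border will equal \<open>?b\<close>
      times the row at lo plus the rows strictly between with coefficients \<open>?d\<close>. The
      sum over j < l in \<open>?d\<close> comes from the perturbed kernel of order l.\<close>
    let ?b = "w l R.lo / H' l * ?P l"
    let ?d = "\<lambda>k. - (\<Sum>j<l. ?P j / H' j * w j k)"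
    have main: "?c * det_border_row ?A ?B NG NC l = - ?b * t l"
      unfolding t_def
    proof (rule R.border_row[OF dim_B21])
      fix p assume p: "p < 2 * NG + 2 * NC"
      let ?g = "if p < 2 * NG then cnj (gtest p z) else 0"
      let ?a = "\<lambda>k. vec_index (?A k) p"
      \<comment> \<open>For k \<le> lo the product of LGs and phi2 k lies in the span of the first l
        + 1 basis functions, so the perturbed kernel of order l + 1 reproduces it, and by
        \<open>w_F'\<close> the coefficients are again given by w.\<close>
      have cw: "?c * (cnj (P.phi2 k z) * inverse (H k)) = (\<Sum>j<Suc l. ?P j / H' j * w j k)" if "k \<le> R.lo" for k
      proof -
        have "k + 2 * NG < Suc l" using that l by linarith
        from Q.expand2[OF inVk[OF this] z(1)]
        have "cnj (leval LGs z * P.phi2 k z) = (\<Sum>j<Suc l. w j k * H k / H' j * ?P j)"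
          unfolding w_F' .
        also have "\<dots> = H k * (\<Sum>j<Suc l. ?P j / H' j * w j k)"
          by (simp add: sum_distrib_left mult_ac del: sum.lessThan_Suc)
        finally show ?thesis using P.H_nonzero[of k] by (simp add: field_simps del: sum.lessThan_Suc)
      qed
      have "?c * vec_index ?B p = (\<Sum>k<Suc R.lo. ?c * (cnj (P.phi2 k z) * inverse (H k)) * ?a k) + ?g"
        using B21_index[OF p laurent_fun_biorth z] z(2) R21_index[OF p laurent_fun_biorth]
        by (simp add: distrib_left sum_distrib_left mult.assoc del: sum.lessThan_Suc)
      also have "(\<Sum>k<Suc R.lo. ?c * (cnj (P.phi2 k z) * inverse (H k)) * ?a k)
         = (\<Sum>k<Suc R.lo. \<Sum>j<Suc l. ?P j / H' j * (w j k * ?a k))"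
        by (intro sum.cong refl) (simp add: cw sum_distrib_right mult.assoc del: sum.lessThan_Suc)
      also have "\<dots> = (\<Sum>j<Suc l. ?P j / H' j * (\<Sum>k<Suc R.lo. w j k * ?a k))"
        by (subst sum.swap) (simp add: sum_distrib_left del: sum.lessThan_Suc)
      \<comment> \<open>The term j = l is separated: of its k \<le> lo only k = lo lies in the
        band.\<close>
      also have "\<dots> = (\<Sum>j<l. ?P j / H' j * (\<Sum>k<Suc R.lo. w j k * ?a k)) + ?P l / H' l * (w l R.lo * ?a R.lo)"
      proof -
        have "(\<Sum>k<R.lo. w l k * ?a k) = 0" by (intro sum.neutral) (auto intro!: w_low)
        then show ?thesis by simp
      qed
      \<comment> \<open>For j < l the inner sum is completed to all k < hi, where it is the row
        functional at LC times the j-th perturbed function. The terms added have lo < k < hi and are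
        multiples of rows already in the determinant.\<close>
      also have "(\<Sum>j<l. ?P j / H' j * (\<Sum>k<Suc R.lo. w j k * ?a k))
         = (\<Sum>j<l. ?P j / H' j * row_entry p (?f j)) - (\<Sum>j<l. ?P j / H' j * (\<Sum>k\<in>{R.lo<..<R.hi}. w j k * ?a k))"
      proof -
        have "(\<Sum>k<Suc R.lo. w j k * ?a k) = row_entry p (?f j) - (\<Sum>k\<in>{R.lo<..<R.hi}. w j k * ?a k)" if "j < l" for j
        proof -
          have u: "{..<R.hi} = {..<Suc R.lo} \<union> {R.lo<..<R.hi}"
            using NG l by (intro equalityI subsetI) auto
          have s: "(\<Sum>k<R.hi. w j k * ?a k) = (\<Sum>k<Suc R.lo. w j k * ?a k) + (\<Sum>k\<in>{R.lo<..<R.hi}. w j k * ?a k)"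
            unfolding u by (rule sum.union_disjoint) auto
          have e: "(\<Sum>k<R.hi. w j k * ?a k) = row_entry p (?f j)"
            by (rule entry[OF _ p]) (use that in simp)
          show ?thesis unfolding e[symmetric] s by (rule add_diff_cancel_right'[symmetric])
        qed
        then show ?thesis by (simp add: right_diff_distrib sum_subtractf del: sum.lessThan_Suc)
      qed
      \<comment> \<open>The perturbed kernel of order l reproduces \<open>gtest p\<close>; the
        resulting term cancels the correction from the difference quotient.\<close>
      also have "(\<Sum>j<l. ?P j / H' j * row_entry p (?f j)) = - ?g"
      proof (cases "p < 2 * NG")
        case True
        have "cnj (gtest p z) = (\<Sum>j<l. F' (Q.phi1 j) (gtest p) / H' j * ?P j)"
          by (rule Q.expand2[OF in_span_mono[OF in_span_gtest[OF True] l] z(1)])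
        then show ?thesis using True by (simp add: row_entry_LC1 laurent_fun_biorth sum_negf mult.commute)
      next
        case False
        then show ?thesis using p by (simp add: row_entry_LC2 laurent_fun_biorth)
      qed
      also have "(\<Sum>j<l. ?P j / H' j * (\<Sum>k\<in>{R.lo<..<R.hi}. w j k * ?a k)) = - (\<Sum>k\<in>{R.lo<..<R.hi}. ?d k * ?a k)"
        by (simp add: sum_distrib_left sum_distrib_right sum_negf mult.assoc) (rule sum.swap)
      finally show "?c * vec_index ?B p = ?b * ?a R.lo + (\<Sum>k\<in>{R.lo<..<R.hi}. ?d k * ?a k)"
        by simp
    qed
    have b: "?b = ?P l * ?LG / H R.lo"
      using w_bot P.H_nonzero[of R.lo] Q.H_nonzero[of l] by (simp add: field_simps)
    have "?c * det_border_row ?A ?B NG NC l = - (?P l * ?LG / H R.lo) * t l"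
      using main unfolding b .
    then show ?thesis using t0 LG0 P.H_nonzero[of R.lo] by (simp add: field_simps)
  qed
qed

end

section \<open>Duality\<close>

lemma comm_ring_hom_cnj: "comm_ring_hom cnj"
  by unfold_locales auto

lemma det_rows_cnj:
  assumes "\<And>r. r \<in> set rs \<Longrightarrow> dim_vec r = length rs"
  shows "det_rows (map (map_vec cnj) rs) = cnj (det_rows rs)"
proof -
  interpret comm_ring_hom cnj by (rule comm_ring_hom_cnj)
  have "mat_of_rows (length rs) (map (map_vec cnj) rs) = map_mat cnj (mat_of_rows (length rs) rs)"
    by (rule eq_matI) (use assms in \<open>auto simp: mat_of_rows_def\<close>)
  then show ?thesis unfolding det_rows_def by (simp add: hom_det)
qed

lemma map_vec_kernel_jet:
  assumes "\<And>k. dim_vec (Jf k) = n"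
  shows "map_vec cnj (kernel_jet r c H Jf) = kernel_jet r (\<lambda>k. cnj (c k)) (\<lambda>k. cnj (H k)) (\<lambda>k. map_vec cnj (Jf k))"
  unfolding kernel_jet_def by (rule eq_vecI) (simp_all add: assms)

lemma map_vec_row_mult:
  assumes "dim_vec v = dim_row M"
  shows "map_vec cnj (row_mult v M) = row_mult (map_vec cnj v) (map_mat cnj M)"
  unfolding row_mult_def by (rule eq_vecI) (use assms in \<open>auto simp: scalar_prod_def\<close>)

lemma map_vec_add: "dim_vec v = dim_vec w \<Longrightarrow> map_vec cnj (v + w) = map_vec cnj v + map_vec cnj w"
  by (rule eq_vecI) auto

lemma map_vec_minus: "dim_vec v = dim_vec w \<Longrightarrow> map_vec cnj (v - w) = map_vec cnj v - map_vec cnj w"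
  by (rule eq_vecI) auto

lemma map_vec_append: "map_vec cnj (v @\<^sub>v w) = map_vec cnj v @\<^sub>v map_vec cnj w"
  by (rule eq_vecI) auto

lemma map_vec_smult: "map_vec cnj (c \<cdot>\<^sub>v v) = cnj c \<cdot>\<^sub>v map_vec cnj v"
  by (rule eq_vecI) auto

text \<open>Conjugate transposition of the factorisation exchanges the two triangular
  factors.\<close>

lemma gauss_borel_conj:
  assumes "gauss_borel G S1 H S2"
  shows "gauss_borel (\<lambda>k l. cnj (G l k)) S2 (\<lambda>k. cnj (H k)) S1"
proof -
  obtain T1 T2 where T: "lower_inverses S1 T1" "lower_inverses S2 T2"
    "\<And>k l. G k l = (\<Sum>i\<le>min k l. T1 k i * H i * cnj (T2 l i))"
    using assms unfolding gauss_borel_def by blast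
  show ?thesis
    unfolding gauss_borel_def
  proof (intro exI conjI allI)
    show "lower_inverses S2 T2" "lower_inverses S1 T1" by (rule T)+
    show "cnj (G l k) = (\<Sum>i\<le>min k l. T2 k i * cnj (H i) * cnj (T1 l i))" for k l
      unfolding T(3) by (simp add: min.commute mult_ac)
  qed
qed

lemma map_zeros_comp: "map_zeros g (map_zeros h zs) = map_zeros (\<lambda>a. g (h a)) zs"
  unfolding map_zeros_def by (simp add: o_def split_beta)

lemma map_zeros_ident: "map_zeros (\<lambda>a. a) zs = zs"
  unfolding map_zeros_def by (simp add: case_prod_eta)

context geronimus_uvarov
begin

text \<open>The masses with conjugate transposed matrix. The zeros of LGs are enumerated in the
  order of those of LG, so the index pairs are only swapped.\<close>

definition mass_conj :: "nat \<Rightarrow> nat \<Rightarrow> nat \<Rightarrow> nat \<Rightarrow> complex" where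
  "mass_conj i k j l = cnj (X j l i k)"

abbreviation "LCs \<equiv> lrecip LC"
abbreviation "zCs \<equiv> map_zeros (\<lambda>a. inverse (cnj a)) zC"
abbreviation "uc \<equiv> conj_functional u"

lemma zeros_back: "map_zeros (\<lambda>a. inverse (cnj a)) zGs = zG" "map_zeros inverse zGs = map_zeros cnj zG"
  by (simp_all add: map_zeros_comp map_zeros_ident)

lemma dual: "geronimus_uvarov uc LCs LGs NC NG zCs zGs"
proof -
  interpret c: toeplitz_distribution uc
    by (rule toeplitz_distribution_conj) unfold_locales
  have s: "fst ` set zGs = (\<lambda>a. inverse (cnj a)) ` (fst ` set zG)"
    by (simp add: map_zeros_def image_image split_beta)
  show ?thesis
  proof
    show "prepared NC LCs" "prepared NG LGs" by (rule prepared_lrecip[OF prepC], rule prepared_lrecip[OF prepG])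
    show "zeros_with_mult NC LCs zCs" "zeros_with_mult NG LGs zGs"
      by (rule zeros_lrecip[OF prepC zerosC], rule zeros_lrecip[OF prepG zerosG])
    \<comment> \<open>The reflection fixes every point of the circle; if the reflected point lay in
      the support, a would be that point.\<close>
    have "inverse (cnj a) \<notin> supp u" if "a \<notin> supp u" for a
    proof
      assume w: "inverse (cnj a) \<in> supp u"
      have "inverse a * inverse (cnj a) = 1" using supp_cnj[OF w] by simp
      then have "inverse (cnj a) = a" by (metis inverse_inverse_eq inverse_unique)
      then show False using w that by simp
    qed
    then show "\<forall>a\<in>fst ` set zGs. a \<notin> supp uc" using off_supp unfolding s supp_conj by auto
    show "\<forall>a\<in>fst ` set zGs. leval LCs a \<noteq> 0"
      using no_common unfolding s by (auto simp: leval_lrecip)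
  qed
qed

interpretation c: geronimus_uvarov uc LCs LGs NC NG zCs zGs mass_conj
  by (rule dual)

lemma Xi_conj: "mass_matrix zGs mass_conj = map_mat cnj (transpose_mat Xi)"
  by (rule eq_matI) (auto simp: mass_matrix_def map_zeros_simps mass_conj_def)

lemma zero_order_conj:
  assumes "laurent_fun f" "laurent_fun g"
  shows "zero_order_form uc f g = cnj (zero_order_form u g f)"
proof -
  have "smooth_near u (\<lambda>z. f z * cnj (g z))"
    by (rule smooth_near_mult[OF smooth_near_Lau[OF assms(1)] smooth_near_cnj_comp[OF smooth_near_Lau[OF assms(2)]]])
  then show ?thesis
    unfolding zero_order_form_def by (simp add: pairing_conj_functional mult.commute)
qed

lemma mass_form_conj: "mass_form zGs mass_conj f g = cnj (mass_form zG X g f)"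
proof -
  have z: "fst (zGs ! idx p) = alpha p" if "p < 2 * NG" for p using zGs_nth(1)[OF that] .
  have "mass_form zGs mass_conj f g = (\<Sum>p<2 * NG. \<Sum>p'<2 * NG. cnj (Xi $$ (p', p)) *
       tcoeff f (alpha p) (ord p) * cnj (tcoeff g (zeta p') (ord p')))"
    unfolding mass_form_def Xi_conj map_zeros_simps(3) lenJ
    using Xi_carrier by (intro sum.cong refl) (simp add: z)
  also have "\<dots> = (\<Sum>p'<2 * NG. \<Sum>p<2 * NG. cnj (Xi $$ (p', p)) *
       tcoeff f (alpha p) (ord p) * cnj (tcoeff g (zeta p') (ord p')))"
    by (rule sum.swap)
  also have "\<dots> = cnj (mass_form zG X g f)"
    unfolding mass_form_def lenJ by (simp add: mult_ac)
  finally show ?thesis .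
qed

text \<open>Conjugating LCs / LGs gives LC / LG at 1 / cnj w, which agrees with LC / LG on the
  circle but in general not near it; the congruence modulo the Toeplitz relation makes the two
  interchangeable under the pairing.\<close>

lemma perturbed_conj:
  assumes "laurent_fun f" "laurent_fun g"
  shows "perturbed_form uc LCs LGs zGs mass_conj f g = cnj (perturbed_form u LC LG zG X g f)"
proof -
  have inv: "inverse (cnj w) = w" if "w \<in> supp u" for w
    using supp_cnj[OF that] by (rule inverse_unique)
  have circle_eq: "circle_eq (\<lambda>w. leval LC (inverse (cnj w)) * inverse (leval LG (inverse (cnj w)))) (\<lambda>w. leval LC w * inverse (leval LG w))"
    by (intro circle_eq_mult circle_eq_leval circle_eq_inverse) (auto simp: inv LG_supp)
  have n: "smooth_near u (\<lambda>w. g w * cnj (f w))" using assms by (intro smooth_near_mult smooth_near_Lau smooth_near_cnj_comp)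
  have nc: "smooth_near u (\<lambda>z. leval LCs z / leval LGs z * (f z * cnj (g z)))"
    using smooth_near_mult[OF c.smooth_near_rho smooth_near_mult[OF c.smooth_near_Lau[OF assms(1)] smooth_near_cnj_comp[OF c.smooth_near_Lau[OF assms(2)]]]]
    unfolding smooth_near_conj_functional .
  have "pairing uc (\<lambda>z. leval LCs z / leval LGs z * (f z * cnj (g z)))
     = cnj (pairing u (\<lambda>z. cnj (leval LCs z / leval LGs z * (f z * cnj (g z)))))"
    by (rule pairing_conj_functional[OF nc])
  also have "(\<lambda>z. cnj (leval LCs z / leval LGs z * (f z * cnj (g z))))
     = (\<lambda>w. g w * cnj (f w) * (leval LC (inverse (cnj w)) * inverse (leval LG (inverse (cnj w)))))"
    by (simp add: fun_eq_iff leval_lrecip divide_inverse mult_ac)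
  also have "pairing u \<dots> = pairing u (\<lambda>w. g w * cnj (f w) * (leval LC w * inverse (leval LG w)))"
    by (rule ceqD[OF circle_eq n])
  also have "\<dots> = pairing u (\<lambda>z. rho z * (g z * cnj (f z)))"
    by (simp only: divide_inverse mult_ac)
  finally have e: "pairing uc (\<lambda>z. leval LCs z / leval LGs z * (f z * cnj (g z)))
     = cnj (pairing u (\<lambda>z. rho z * (g z * cnj (f z))))" .
  show ?thesis unfolding perturbed_form_eq by (simp only: e mass_form_conj complex_cnj_add)
qed

lemma biorthogonal_dual:
  assumes "biorthogonal F S1 S2 H"
  shows "biorthogonal c.F S2 S1 (\<lambda>k. cnj (H k))"
proof -
  interpret P: biorthogonal F S1 S2 H by fact
  show ?thesis
  proof
    show "sesquilinear_form c.F" by (rule c.sesquilinear_zero_order)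
    have "gram c.F = (\<lambda>k l. cnj (gram F l k))"
      by (simp add: gram_def fun_eq_iff zero_order_conj laurent_fun_cmv)
    then show "gauss_borel (gram c.F) S2 (\<lambda>k. cnj (H k)) S1" using gauss_borel_conj[OF P.gb] by simp
    show "cnj (H k) \<noteq> 0" for k using P.H_nonzero by simp
  qed
qed

lemma biorthogonal_perturbed_dual:
  assumes "biorthogonal F' S1 S2 H"
  shows "biorthogonal c.F' S2 S1 (\<lambda>k. cnj (H k))"
proof -
  interpret P: biorthogonal F' S1 S2 H by fact
  show ?thesis
  proof
    show "sesquilinear_form c.F'" by (rule c.sesquilinear_perturbed)
    have "gram c.F' = (\<lambda>k l. cnj (gram F' l k))"
      by (simp add: gram_def fun_eq_iff perturbed_conj laurent_fun_cmv)
    then show "gauss_borel (gram c.F') S2 (\<lambda>k. cnj (H k)) S1" using gauss_borel_conj[OF P.gb] by simp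
    show "cnj (H k) \<noteq> 0" for k using P.H_nonzero by simp
  qed
qed

text \<open>The two functions agree off the conjugated support, where the Cauchy kernel is smooth
  near the support. The points \<open>cnj (zeta p)\<close> lie in this open set, and jets see only a
  neighbourhood.\<close>

lemma second_kind_conj:
  assumes "laurent_fun f"
  shows "jet (second_kind1 uc f) (map_zeros cnj zG) = jet (second_kind2 u f) (map_zeros cnj zG)"
proof (rule eq_vecI)
  show "dim_vec (jet (second_kind1 uc f) (map_zeros cnj zG)) = dim_vec (jet (second_kind2 u f) (map_zeros cnj zG))"
    by (simp add: dim_jet map_zeros_simps)
  fix p assume "p < dim_vec (jet (second_kind2 u f) (map_zeros cnj zG))"
  then have p: "p < 2 * NG" by (simp add: dim_jet map_zeros_simps lenJ)
  have "tcoeff (second_kind1 uc f) (cnj (zeta p)) (ord p) = tcoeff (second_kind2 u f) (cnj (zeta p)) (ord p)"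
  proof (rule tcoeff_cong)
    show "open (- (cnj ` supp u))" by (rule open_compl_image)
    show "cnj (zeta p) \<in> - (cnj ` supp u)" using zeta_facts(4)[OF p] by auto
    fix z assume z: "z \<in> - (cnj ` supp u)"
    have "smooth_near u (\<lambda>w. f w * (1 / (z - cnj w)))"
      by (intro smooth_near_mult smooth_near_Lau assms smooth_near_kernel) (use z in auto)
    then have "pairing uc (\<lambda>w. f w * (1 / (z - cnj w))) = cnj (pairing u (\<lambda>w. cnj (f w * (1 / (z - cnj w)))))"
      by (rule pairing_conj_functional)
    then show "second_kind1 uc f z = second_kind2 u f z"
      unfolding second_kind1_def second_kind2_def zero_order_form_def by (simp add: mult.commute)
  qed
  then show "vec_index (jet (second_kind1 uc f) (map_zeros cnj zG)) p = vec_index (jet (second_kind2 u f) (map_zeros cnj zG)) p"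
    using p zeta_facts(1)[OF p]
    by (subst (1 2) jet_nth) (simp_all add: map_zeros_simps lenJ)
qed

text \<open>Reflecting twice restores zeros and polynomials, so the recipe of \<open>A21\<close>
  applied to the dual data produces the ingredients of \<open>A12\<close>.\<close>

lemma A12_dual:
  assumes "laurent_fun (phi k)"
  shows "A12 u LC zC LG NG zG Xi phi k = c.R21 phi k"
  unfolding A12_def A21_def zeros_back second_kind_conj[OF assms] Xi_conj lrecip_lrecip ..

text \<open>The difference quotient is symmetric, which moves the jet from the first variable to the
  second; conjugation then passes to the coefficients. The jet is taken away from z because LG does
  not vanish at z.\<close>

lemma delta_jet_dual:
  assumes z: "z \<noteq> 0" "leval LG z \<noteq> 0"
  shows "jet (\<lambda>w. ldelta LG w z) zG = map_vec cnj (jet (\<lambda>w. ldelta (lconj LG) (cnj z) w) (map_zeros cnj zG))"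
proof (rule eq_vecI)
  show "dim_vec (jet (\<lambda>w. ldelta LG w z) zG) = dim_vec (map_vec cnj (jet (\<lambda>w. ldelta (lconj LG) (cnj z) w) (map_zeros cnj zG)))"
    by (simp add: dim_jet map_zeros_simps)
  fix p assume "p < dim_vec (map_vec cnj (jet (\<lambda>w. ldelta (lconj LG) (cnj z) w) (map_zeros cnj zG)))"
  then have p: "p < 2 * NG" by (simp add: dim_jet map_zeros_simps lenJ)
  have sym: "ldelta LG w z = ldelta LG z w" for w
    unfolding ldelta_def by (metis minus_diff_eq minus_divide_divide)
  have h: "(\<lambda>w. ldelta LG w z) holomorphic_on - {0, z}"
    unfolding ldelta_def
    by (intro holomorphic_intros holomorphic_on_subset[OF leval_holomorphic]) auto
  have "zeta p \<in> - {0, z}" using zeta_facts(3)[OF p] z(2) zeros_nth(3)[OF zerosG zeta_facts(1)[OF p]] by auto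
  then have "tcoeff (\<lambda>w. cnj (ldelta LG (cnj w) z)) (cnj (zeta p)) (ord p) = cnj (tcoeff (\<lambda>w. ldelta LG w z) (zeta p) (ord p))"
    by (intro tcoeff_cnj[OF _ h]) auto
  moreover have "cnj (ldelta LG (cnj w) z) = ldelta (lconj LG) (cnj z) w" for w
    unfolding sym by (simp add: ldelta_def leval_lconj)
  ultimately have "tcoeff (\<lambda>w. ldelta (lconj LG) (cnj z) w) (cnj (zeta p)) (ord p) = cnj (tcoeff (\<lambda>w. ldelta LG w z) (zeta p) (ord p))"
    by simp
  then show "vec_index (jet (\<lambda>w. ldelta LG w z) zG) p
      = vec_index (map_vec cnj (jet (\<lambda>w. ldelta (lconj LG) (cnj z) w) (map_zeros cnj zG))) p"
    using p zeta_facts(1)[OF p] by (simp add: dim_jet map_zeros_simps lenJ jet_nth)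
qed

text \<open>Conjugation passes through kernel jets, matrix products and sums, and it turns the dual
  weights \<open>cnj (H k)\<close> back into \<open>H k\<close>.\<close>

lemma B12_dual:
  assumes L: "\<And>k. laurent_fun (phi2 k)" and z: "z \<noteq> 0" "leval LG z \<noteq> 0"
  shows "B12 u LC zC LG NG zG Xi phi1 H phi2 l z
     = map_vec cnj (B21 uc LCs zCs LGs NG zGs c.Xi phi2 (\<lambda>k. cnj (H k)) phi1 l z)"
proof -
  have X: "map_mat cnj (map_mat cnj (transpose_mat Xi)) = transpose_mat Xi" by (rule eq_matI) auto
  have dx: "dim_row Xi = 2 * NG" "dim_col Xi = 2 * NG" using Xi_carrier by auto
  have de: "dim_row (ell_matrix LG NG zG) = 2 * NG" "dim_col (ell_matrix LG NG zG) = 2 * NG"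
    using ell_matrix_carrier[of LG NG zG] lenJ by auto
  note dims = dim_jet map_zeros_simps lenJ dx de
  have dk: "dim_vec (kernel_jet r c H Jf) = dim_vec (Jf 0)" for r c H Jf by (simp add: kernel_jet_def)
  have dr: "dim_vec (row_mult v M) = dim_col M" for v M by (simp add: row_mult_def)
  show ?thesis
    unfolding B12_def B21_def Let_def zeros_back Xi_conj lrecip_lrecip
      second_kind_conj[OF L] delta_jet_dual[OF z]
    by (simp add: map_vec_append map_vec_add map_vec_minus map_vec_smult map_vec_row_mult
        map_vec_kernel_jet[where n = "2 * NG"] map_vec_kernel_jet[where n = "2 * NC"] dims dk dr X)
qed

end

theorem proposition15:
  fixes u :: "(complex \<Rightarrow> complex) \<Rightarrow> complex"
    and LC LG :: laurent and NC NG :: nat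
    and zC zG :: "(complex \<times> nat) list"
    and X :: "nat \<Rightarrow> nat \<Rightarrow> nat \<Rightarrow> nat \<Rightarrow> complex"
    and S1 S2 S1' S2' :: "nat \<Rightarrow> nat \<Rightarrow> complex"
    and H H' :: "nat \<Rightarrow> complex"
    and l :: nat
  defines "G \<equiv> gram (zero_order_form u)"
    and "G' \<equiv> gram (perturbed_form u LC LG zG X)"
    and "phi1 \<equiv> biorth S1"
    and "phi2 \<equiv> biorth S2"
    and "phi1' \<equiv> biorth S1'"
    and "phi2' \<equiv> biorth S2'"
    and "Xi \<equiv> mass_matrix zG X"
  defines "R21 \<equiv> A21 u LC zC LG NG zG Xi phi1"
    and "R12 \<equiv> A12 u LC zC LG NG zG Xi phi2"
  defines "tau21 \<equiv> tau R21 NG NC"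
    and "tau12 \<equiv> tau R12 NG NC"
  assumes "compactly_supported_distribution u"
    and "supp u \<subseteq> sphere 0 1"
    and "toeplitz_functional u"
    and "prepared NC LC" and "prepared NG LG"
    and "lcoprime LC LG"
    and "zeros_with_mult NC LC zC" and "zeros_with_mult NG LG zG"
    and "\<forall>a\<in>fst ` set zG. a \<notin> supp u"
    and "quasidefinite G" and "gauss_borel G S1 H S2"
    and "quasidefinite G'" and "gauss_borel G' S1' H' S2'"
    and "l \<ge> 2 * max NG NC"
    and "tau21 l * tau12 l \<noteq> 0"
  shows
    "(\<forall>z. z \<noteq> 0 \<longrightarrow> leval LC z \<noteq> 0 \<longrightarrow>
           phi1' l z = lcoeff LC ((-1) ^ l * int NC) / leval LC z * (1 / tau21 l) *
             det_border_col R21 (\<lambda>k. phi1 k z) NG NC l) \<and>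
    (\<forall>z. z \<noteq> 0 \<longrightarrow> leval LG z \<noteq> 0 \<longrightarrow>
           phi1' l z = - (leval LG z / lcoeff LG ((-1) ^ l * int NG)) *
             (H (l - 2 * NG) / cnj (tau12 l)) *
             det_border_row (\<lambda>k. map_vec cnj (R12 k))
               (B12 u LC zC LG NG zG Xi phi1 H phi2 l z) NG NC l) \<and>
    (H' l = lcoeff LC ((-1) ^ l * int NC) / lcoeff LG ((-1) ^ (l + 1) * int NG) *
           H (l - 2 * NG) * (tau21 (l + 1) / tau21 l)) \<and>
    (H' l = lcoeff LC ((-1) ^ (l + 1) * int NC) / lcoeff LG ((-1) ^ l * int NG) *
           H (l - 2 * NG) * (cnj (tau12 (l + 1)) / cnj (tau12 l))) \<and>
    (\<forall>z. z \<noteq> 0 \<longrightarrow> leval (lrecip LG) z \<noteq> 0 \<longrightarrow>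
           cnj (phi2' l z) = - (cnj (leval (lrecip LG) z) / lcoeff LG ((-1) ^ (l + 1) * int NG)) *
             (H (l - 2 * NG) / tau21 l) *
             det_border_row R21
               (B21 u LC zC LG NG zG Xi phi1 H phi2 l z) NG NC l) \<and>
    (\<forall>z. z \<noteq> 0 \<longrightarrow> leval (lrecip LC) z \<noteq> 0 \<longrightarrow>
           cnj (phi2' l z) = lcoeff LC ((-1) ^ (l + 1) * int NC) / cnj (leval (lrecip LC) z) *
             (1 / cnj (tau12 l)) *
             cnj (det_border_col R12 (\<lambda>k. phi2 k z) NG NC l))"
proof -
  \<comment> \<open>Coprimality takes effect in this form.\<close>
  have common: "\<forall>a\<in>fst ` set zG. leval LC a \<noteq> 0"
  proof
    fix a assume "a \<in> fst ` set zG"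
    then obtain i where i: "i < length zG" "a = fst (zG ! i)" by (auto simp: in_set_conv_nth)
    show "leval LC a \<noteq> 0"
    proof
      assume "leval LC a = 0"
      from common_zero_not_lcoprime[OF assms(17) _ this]
      show False using zeros_nth[OF assms(19) i(1)] i(2) by simp
    qed
  qed
  interpret geronimus_uvarov u LC LG NC NG zC zG X
    using assms(12-16,18-20) common by unfold_locales
  interpret c: geronimus_uvarov "conj_functional u" "lrecip LC" "lrecip LG" NC NG zCs zGs mass_conj
    by (rule dual)
  have P: "biorthogonal F S1 S2 H"
  proof -
    interpret gauss_borel_form F S1 S2 H
      using sesquilinear_zero_order assms(22) unfolding G_def by unfold_locales
    show ?thesis using quasidefinite_nonzero assms(21) unfolding G_def by unfold_locales
  qed
  have Q: "biorthogonal F' S1' S2' H'"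
  proof -
    interpret gauss_borel_form F' S1' S2' H'
      using sesquilinear_perturbed assms(24) unfolding G'_def by unfold_locales
    show ?thesis using quasidefinite_nonzero assms(23) unfolding G'_def by unfold_locales
  qed
  have l: "l \<ge> 2 * NG" using assms(25) by simp
  have R12: "R12 = c.R21 (biorth S2)"
    unfolding R12_def phi2_def Xi_def by (rule ext) (rule A12_dual[OF laurent_fun_biorth])
  have R21: "R21 = A21 u LC zC LG NG zG (mass_matrix zG X) (biorth S1)"
    unfolding R21_def phi1_def Xi_def ..
  have t: "tau21 l \<noteq> 0" "tau12 l \<noteq> 0" using assms(26) by auto
  note f = determinantal_formulas[OF P Q l t(1)[unfolded tau21_def R21], folded R21, folded tau21_def]
  \<comment> \<open>For the dual data the two families are exchanged: the first formula now concerns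
    \<open>phi2'\<close> and the third \<open>phi1'\<close>.\<close>
  note d = c.determinantal_formulas[OF biorthogonal_dual[OF P] biorthogonal_perturbed_dual[OF Q] l
      t(2)[unfolded tau12_def R12], folded R12, folded tau12_def]
  \<comment> \<open>Coefficients of a reciprocal are conjugated and carry the opposite index.
    Conjugating the dual formulas undoes the first effect; the second exchanges the exponents l and
    l + 1.\<close>
  have neg: "- ((-1) ^ l * int N) = (-1) ^ (l + 1) * int N" "- ((-1) ^ (l + 1) * int N) = (-1) ^ l * int N" for N
    by simp_all
  show ?thesis
  proof (intro conjI allI impI)
    fix z :: complex assume z: "z \<noteq> 0"
    show "phi1' l z = lcoeff LC ((-1) ^ l * int NC) / leval LC z * (1 / tau21 l) *
             det_border_col R21 (\<lambda>k. phi1 k z) NG NC l" if "leval LC z \<noteq> 0"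
      using f(1)[OF z that] unfolding phi1'_def phi1_def .
    show "cnj (phi2' l z) = - (cnj (leval (lrecip LG) z) / lcoeff LG ((-1) ^ (l + 1) * int NG)) *
             (H (l - 2 * NG) / tau21 l) *
             det_border_row R21 (B21 u LC zC LG NG zG Xi phi1 H phi2 l z) NG NC l"
      if "leval (lrecip LG) z \<noteq> 0"
      using f(3)[OF z that] unfolding phi2'_def phi1_def phi2_def Xi_def .
    show "cnj (phi2' l z) = lcoeff LC ((-1) ^ (l + 1) * int NC) / cnj (leval (lrecip LC) z) *
             (1 / cnj (tau12 l)) * cnj (det_border_col R12 (\<lambda>k. phi2 k z) NG NC l)"
      if "leval (lrecip LC) z \<noteq> 0"
      using arg_cong[OF d(1)[OF z that], of cnj] unfolding lcoeff_lrecip phi2'_def phi2_def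
      by (simp only: complex_cnj_mult complex_cnj_divide complex_cnj_cnj complex_cnj_one neg)
    show "phi1' l z = - (leval LG z / lcoeff LG ((-1) ^ l * int NG)) *
             (H (l - 2 * NG) / cnj (tau12 l)) *
             det_border_row (\<lambda>k. map_vec cnj (R12 k)) (B12 u LC zC LG NG zG Xi phi1 H phi2 l z) NG NC l"
      if "leval LG z \<noteq> 0"
    proof -
      let ?B = "B21 (conj_functional u) (lrecip LC) zCs (lrecip LG) NG zGs c.Xi phi2 (\<lambda>k. cnj (H k)) phi1 l z"
      have B: "B12 u LC zC LG NG zG Xi phi1 H phi2 l z = map_vec cnj ?B"
        unfolding Xi_def by (rule B12_dual[OF _ z that]) (simp add: phi2_def laurent_fun_biorth)
      \<comment> \<open>The formula to be shown conjugates the rows, the dual formula the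
        determinant; \<open>det_rows_cnj\<close> reconciles them.\<close>
      have "det_border_row (\<lambda>k. map_vec cnj (R12 k)) (map_vec cnj ?B) NG NC l
         = det_rows (map (map_vec cnj) (map R12 [l - 2 * NG + 1..<l + 2 * NC] @ [?B]))"
        unfolding det_border_row_def by (simp add: o_def)
      also have "\<dots> = cnj (det_border_row R12 ?B NG NC l)"
        unfolding det_border_row_def
        by (rule det_rows_cnj) (use l prepG in \<open>auto simp: R12 c.dim_R21 c.dim_B21 prepared_def\<close>)
      finally have D: "det_border_row (\<lambda>k. map_vec cnj (R12 k)) (map_vec cnj ?B) NG NC l
         = cnj (det_border_row R12 ?B NG NC l)" .
      have "leval (lrecip (lrecip LG)) z \<noteq> 0" using that by (simp add: lrecip_lrecip)
      from arg_cong[OF d(3)[OF z this], of cnj] show ?thesis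
        unfolding B D
        unfolding lcoeff_lrecip lrecip_lrecip phi1'_def phi1_def phi2_def
        by (simp only: complex_cnj_mult complex_cnj_divide complex_cnj_cnj complex_cnj_minus neg)
    qed
  next
    show "H' l = lcoeff LC ((-1) ^ l * int NC) / lcoeff LG ((-1) ^ (l + 1) * int NG) *
           H (l - 2 * NG) * (tau21 (l + 1) / tau21 l)"
      by (rule f(2))
    show "H' l = lcoeff LC ((-1) ^ (l + 1) * int NC) / lcoeff LG ((-1) ^ l * int NG) *
           H (l - 2 * NG) * (cnj (tau12 (l + 1)) / cnj (tau12 l))"
      using arg_cong[OF d(2), of cnj] unfolding lcoeff_lrecip
      by (simp only: complex_cnj_mult complex_cnj_divide complex_cnj_cnj neg)
  qed
qed

end
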